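(* Let $G/H$ be a compact CR symmetric contact space of dimension $2n+1$ (setting described in the context), and let $p,q\ge0$, $m\in\mathbb Z$. For every $\alpha\in C^\infty(G,\Lambda^{p,q}\mathfrak p^* )^H_m$, $$\widetilde{\mathcal L_T}\,\alpha=\frac{m+p-q}{2n}\cdot i\,\alpha.$$ Therefore $$\widetilde{-\mathcal L_T^2}\,\alpha=\left(\frac{m+p-q}{2n}\right)^2\alpha.$$
   Context: **Setting (compact CR symmetric contact space).** $G$ is a compact connected semisimple Lie group with Lie algebra $\mathfrak g$ and (negative definite) Killing form $B$. $\xi\in\mathfrak g$, $K=Z_G(\xi)=\{k\in G:\mathrm{Ad}_k\xi=\xi\}$ (connected) with Lie algebra $\mathfrak k$, $\mathfrak p$ is the $B$-orthogonal complement of $\mathfrak k$, $\dim\mathfrak p=2n\ge 2$; $\mathfrak g=\mathfrak k\oplus\mathfrak p$ is a symmetric decomposition ($[\mathfrak p,\mathfrak p]\subset\mathfrak k$), $G/K$ is simply connected, and $J:=\mathrm{ad}_\xi|_{\mathfrak p}$ satisfies $J^2=-\mathrm{Id}$. $S^1:=\{\exp_G(t\xi):t\in\mathbb R\}$ with $\exp_G(t\xi)=e\iff t\in2\pi\mathbb Z$. $H\subset K$ is a closed Lie subgroup with Lie algebra $\mathfrak h=\ker B(\xi,\cdot)\cap\mathfrak k$, commuting with $S^1$, with $K=H\cdot S^1$, i.e. $K=(H\times S^1)/\Gamma$ where $\Gamma=H\cap S^1=\{\exp_G(l\tfrac{2\pi}{N}\xi):1\le l\le N\}$ has order $N$. $G$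 acts effectively on $G/H$. $G/H$ carries the $G$-invariant contact form $\theta$ induced by $B(\xi,\cdot)$, contact structure $\mathcal D=\ker\theta$ (the $G$-invariant extension of $\mathfrak p$), the $G$-invariant complex structure on $\mathcal D$ induced by $J$, and Reeb field $T$ ($\theta(T)=1$, $d\theta(T,\cdot)=0$), induced by $-\frac1{2n}\xi$. $\mathcal L_T$ is the Lie derivative along $T$. **Forms as equivariant functions.** $\mathfrak p^{1,0},\mathfrak p^{0,1}\subset\mathfrak p\otimes\mathbb C$ are the $\pm i$-eigenspaces of $J$, $\Lambda^{p,q}\mathfrak p^*=\Lambda^p(\mathfrak p^{1,0})^*\wedge\Lambda^q(\mathfrak p^{0,1})^*$ with the dual adjoint action of $K$; $\mathfrak A^{p,q}(\mathcal D)$ is the space of smooth sections over $G/H$ of $\Lambda^p(\mathcal D^{1,0})^*\wedge\Lambda^q(\mathcal D^{0,1})^*$. For a representation $(V,\rho)$ of $H$, $C^\infty(G,V)^H=\{f\in C^\infty(G,V):f(gh)=\rho(h^{-1})f(g)\ \forall g\in G,h\in H\}$. There is the isomorphism $\psi:\mathfrak A^{p,q}(\mathcal D)\to C^\infty(G,\Lambda^{p,q}\mathfrak p^* )^H$, $\psi(\alpha)|_g(Y_1,\dots,Y_k)=(\pi_H^*\alpha)|_g(T_eL_gY_1,\dots,T_eL_gY_k)$, with $\pi_H:G\to G/H$ the projection and $L_g$ left translation. For an operator $\varphi$ on forms, $\widetilde\varphi=\psi\circ\varphi\circ\psi^{-1}$. For $m\in\mathbb Z$, $$C^\infty(G,\Lambda^{p,q}\mathfrak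 p^* )^H_m=\{\alpha\in C^\infty(G,\Lambda^{p,q}\mathfrak p^* )^H:\alpha|_{g\exp_G(t\xi)}=e^{-imt}\alpha|_g\ \ \forall t\in\mathbb R,g\in G\}.$$ *)

theory Defs
  imports
    "HOL-Analysis.Analysis"
    "HOL-Algebra.Left_Coset"
    "HOL-Library.Function_Algebras"
begin

section \<open>Smooth manifolds\<close>

text \<open>The set \<open>S\<close> is meant to be open in the following two definitions.\<close>

primrec Ck_on :: "nat \<Rightarrow> 'a::real_normed_vector set \<Rightarrow> ('a \<Rightarrow> 'b::real_normed_vector) \<Rightarrow> bool" where
  "Ck_on 0 S f \<longleftrightarrow> continuous_on S f"
| "Ck_on (Suc k) S f \<longleftrightarrow> (\<forall>x\<in>S. f differentiable (at x)) \<and>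
     (\<forall>v. Ck_on k S (\<lambda>x. frechet_derivative f (at x) v))"

definition smooth_on :: "'a::real_normed_vector set \<Rightarrow> ('a \<Rightarrow> 'b::real_normed_vector) \<Rightarrow> bool" where
  "smooth_on S f \<longleftrightarrow> (\<forall>k. Ck_on k S f)"

text \<open>A manifold is a topology together with an atlas. A chart is a pair \<open>(U, \<phi>)\<close>; only the
  values of \<open>\<phi>\<close> on \<open>U\<close> matter. The model space is the Euclidean space \<open>'e\<close>, so the dimension
  is \<open>DIM('e)\<close>.\<close>

record ('a, 'e) mfd =
  mtop :: "'a topology"
  atlas :: "('a set \<times> ('a \<Rightarrow> 'e)) set"

definition points :: "('a, 'e) mfd \<Rightarrow> 'a set" where
  "points M = topspace (mtop M)"

definition manifold :: "('a, 'e::euclidean_space) mfd \<Rightarrow> bool" where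
  "manifold M \<longleftrightarrow>
     Hausdorff_space (mtop M) \<and> second_countable (mtop M) \<and>
     (\<Union>(U, \<phi>)\<in>atlas M. U) = points M \<and>
     (\<forall>(U, \<phi>)\<in>atlas M. openin (mtop M) U \<and> open (\<phi> ` U) \<and>
        homeomorphic_map (subtopology (mtop M) U) (top_of_set (\<phi> ` U)) \<phi>) \<and>
     (\<forall>(U, \<phi>)\<in>atlas M. \<forall>(V, \<psi>)\<in>atlas M. smooth_on (\<phi> ` (U \<inter> V)) (\<psi> \<circ> inv_into U \<phi>))"

definition smooth_map ::
  "('a, 'e::euclidean_space) mfd \<Rightarrow> ('b, 'f::euclidean_space) mfd \<Rightarrow> ('a \<Rightarrow> 'b) \<Rightarrow> bool" where
  "smooth_map M N F \<longleftrightarrow>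
     continuous_map (mtop M) (mtop N) F \<and>
     (\<forall>(U, \<phi>)\<in>atlas M. \<forall>(V, \<psi>)\<in>atlas N.
        smooth_on (\<phi> ` {x \<in> U. F x \<in> V}) (\<psi> \<circ> F \<circ> inv_into U \<phi>))"

definition euclid :: "('e::euclidean_space, 'e) mfd" where
  "euclid = \<lparr>mtop = euclidean, atlas = {(UNIV, id)}\<rparr>"

definition prod_mfd :: "('a, 'e::euclidean_space) mfd \<Rightarrow> ('b, 'f::euclidean_space) mfd
    \<Rightarrow> ('a \<times> 'b, 'e \<times> 'f) mfd" where
  "prod_mfd M N = \<lparr>mtop = prod_topology (mtop M) (mtop N),
     atlas = {(U \<times> V, map_prod \<phi> \<psi>) | U \<phi> V \<psi>. (U, \<phi>) \<in> atlas M \<and> (V, \<psi>) \<in> atlas N}\<rparr>"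

definition restrict_mfd :: "('a, 'e::euclidean_space) mfd \<Rightarrow> 'a set \<Rightarrow> ('a, 'e) mfd" where
  "restrict_mfd M W = \<lparr>mtop = subtopology (mtop M) W,
     atlas = {(U \<inter> W, \<phi>) | U \<phi>. (U, \<phi>) \<in> atlas M}\<rparr>"

definition C_inf :: "('a, 'e::euclidean_space) mfd \<Rightarrow> ('a \<Rightarrow> real) set" where
  "C_inf M = {f. smooth_map M euclid f}"

section \<open>Tangent vectors\<close>

text \<open>Tangent vectors are derivations of the smooth functions, extended by \<open>0\<close> to non-smooth
  functions so that equality of tangent vectors is equality of functions. The Leibniz rule forces
  \<open>v f\<close> to depend only on the values of \<open>f\<close> on the manifold. Complex tangent vectors are
  complex-valued derivations, written \<open>Y + iZ\<close> with real tangent vectors \<open>Y, Z\<close>.\<close>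

type_synonym 'a tvec = "('a \<Rightarrow> real) \<Rightarrow> real"
type_synonym 'a ctvec = "('a \<Rightarrow> real) \<Rightarrow> complex"

definition tscale :: "real \<Rightarrow> ('x \<Rightarrow> real) \<Rightarrow> ('x \<Rightarrow> real)" where
  "tscale c v = (\<lambda>f. c * v f)"

global_interpretation tv: vector_space "tscale :: real \<Rightarrow> ('x \<Rightarrow> real) \<Rightarrow> ('x \<Rightarrow> real)"
  by standard (auto simp: tscale_def algebra_simps fun_eq_iff)

definition tangent_space :: "('a, 'e::euclidean_space) mfd \<Rightarrow> 'a \<Rightarrow> 'a tvec set" where
  "tangent_space M x = {v.
     (\<forall>f\<in>C_inf M. \<forall>g\<in>C_inf M. \<forall>a b. v (\<lambda>y. a * f y + b * g y) = a * v f + b * v g) \<and>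
     (\<forall>f\<in>C_inf M. \<forall>g\<in>C_inf M. v (\<lambda>y. f y * g y) = f x * v g + g x * v f) \<and>
     (\<forall>f. f \<notin> C_inf M \<longrightarrow> v f = 0)}"

text \<open>The differential of a smooth map \<open>F\<close> into \<open>N\<close>, on real and on complex tangent vectors.\<close>

definition push :: "('b, 'f::euclidean_space) mfd \<Rightarrow> ('a \<Rightarrow> 'b)
    \<Rightarrow> (('a \<Rightarrow> real) \<Rightarrow> 'k::zero) \<Rightarrow> (('b \<Rightarrow> real) \<Rightarrow> 'k)" where
  "push N F v = (\<lambda>f. if f \<in> C_inf N then v (f \<circ> F) else 0)"

definition velocity :: "('a, 'e::euclidean_space) mfd \<Rightarrow> (real \<Rightarrow> 'a) \<Rightarrow> real \<Rightarrow> 'a tvec" where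
  "velocity M \<gamma> t = (\<lambda>f. if f \<in> C_inf M then deriv (\<lambda>s. f (\<gamma> s)) t else 0)"

definition local_vector_field ::
  "('a, 'e::euclidean_space) mfd \<Rightarrow> 'a set \<Rightarrow> ('a \<Rightarrow> 'a tvec) \<Rightarrow> bool" where
  "local_vector_field M W X \<longleftrightarrow> (\<forall>x\<in>W. X x \<in> tangent_space M x) \<and>
     (\<forall>f\<in>C_inf M. (\<lambda>x. X x f) \<in> C_inf (restrict_mfd M W))"

abbreviation vector_field :: "('a, 'e::euclidean_space) mfd \<Rightarrow> ('a \<Rightarrow> 'a tvec) \<Rightarrow> bool" where
  "vector_field M \<equiv> local_vector_field M (points M)"

definition vf_bracket :: "('a, 'e::euclidean_space) mfd \<Rightarrow> ('a \<Rightarrow> 'a tvec) \<Rightarrow> ('a \<Rightarrow> 'a tvec)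
    \<Rightarrow> 'a \<Rightarrow> 'a tvec" where
  "vf_bracket M X Y x =
     (\<lambda>f. if f \<in> C_inf M then X x (\<lambda>y. Y y f) - Y x (\<lambda>y. X y f) else 0)"

text \<open>The \<open>SOME\<close> in \<open>flow\<close> selects the flow of a complete vector field, which is unique on the
  points of \<open>M\<close>.\<close>

definition is_flow :: "('a, 'e::euclidean_space) mfd \<Rightarrow> ('a \<Rightarrow> 'a tvec) \<Rightarrow> (real \<Rightarrow> 'a \<Rightarrow> 'a) \<Rightarrow> bool"
  where
  "is_flow M X \<Phi> \<longleftrightarrow> smooth_map (prod_mfd euclid M) M (\<lambda>(t, x). \<Phi> t x) \<and>
     (\<forall>x\<in>points M. \<Phi> 0 x = x \<and> (\<forall>t. velocity M (\<lambda>s. \<Phi> s x) t = X (\<Phi> t x)))"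

definition flow :: "('a, 'e::euclidean_space) mfd \<Rightarrow> ('a \<Rightarrow> 'a tvec) \<Rightarrow> real \<Rightarrow> 'a \<Rightarrow> 'a" where
  "flow M X = (SOME \<Phi>. is_flow M X \<Phi>)"

section \<open>Contact forms\<close>

definition one_form :: "('a, 'e::euclidean_space) mfd \<Rightarrow> ('a \<Rightarrow> 'a tvec \<Rightarrow> real) \<Rightarrow> bool" where
  "one_form M \<theta> \<longleftrightarrow>
     (\<forall>x\<in>points M. \<forall>v\<in>tangent_space M x. \<forall>w\<in>tangent_space M x. \<forall>a b.
        \<theta> x (tscale a v + tscale b w) = a * \<theta> x v + b * \<theta> x w) \<and>
     (\<forall>X. vector_field M X \<longrightarrow> (\<lambda>x. \<theta> x (X x)) \<in> C_inf M)"

definition ext_deriv :: "('a, 'e::euclidean_space) mfd \<Rightarrow> ('a \<Rightarrow> 'a tvec \<Rightarrow> real)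
    \<Rightarrow> ('a \<Rightarrow> 'a tvec) \<Rightarrow> ('a \<Rightarrow> 'a tvec) \<Rightarrow> 'a \<Rightarrow> real" where
  "ext_deriv M \<theta> X Y x =
     X x (\<lambda>y. \<theta> y (Y y)) - Y x (\<lambda>y. \<theta> y (X y)) - \<theta> x (vf_bracket M X Y x)"

definition contact_dist :: "('a, 'e::euclidean_space) mfd \<Rightarrow> ('a \<Rightarrow> 'a tvec \<Rightarrow> real)
    \<Rightarrow> 'a \<Rightarrow> 'a tvec set" where
  "contact_dist M \<theta> x = {v \<in> tangent_space M x. \<theta> x v = 0}"

text \<open>\<open>\<theta>\<close> vanishes nowhere and \<open>d\<theta>\<close> is nondegenerate on \<open>ker \<theta>\<close>.\<close>

definition contact_form :: "('a, 'e::euclidean_space) mfd \<Rightarrow> ('a \<Rightarrow> 'a tvec \<Rightarrow> real) \<Rightarrow> bool" where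
  "contact_form M \<theta> \<longleftrightarrow> one_form M \<theta> \<and>
     (\<forall>x\<in>points M. (\<exists>v\<in>tangent_space M x. \<theta> x v \<noteq> 0) \<and>
        (\<forall>v\<in>contact_dist M \<theta> x. v \<noteq> 0 \<longrightarrow>
          (\<exists>X Y. vector_field M X \<and> vector_field M Y \<and> X x = v \<and>
             Y x \<in> contact_dist M \<theta> x \<and> ext_deriv M \<theta> X Y x \<noteq> 0)))"

definition reeb_field ::
  "('a, 'e::euclidean_space) mfd \<Rightarrow> ('a \<Rightarrow> 'a tvec \<Rightarrow> real) \<Rightarrow> ('a \<Rightarrow> 'a tvec) \<Rightarrow> bool" where
  "reeb_field M \<theta> T \<longleftrightarrow> vector_field M T \<and>
     (\<forall>x\<in>points M. \<theta> x (T x) = 1 \<and> (\<forall>Y. vector_field M Y \<longrightarrow> ext_deriv M \<theta> T Y x = 0))"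

section \<open>Complexification and forms of type $(p,q)$\<close>

definition cx_space :: "('x \<Rightarrow> real) set \<Rightarrow> ('x \<Rightarrow> complex) set" where
  "cx_space V = {(\<lambda>f. Complex (Y f) (Z f)) | Y Z. Y \<in> V \<and> Z \<in> V}"

definition cx_vec :: "('x \<Rightarrow> real) \<Rightarrow> ('x \<Rightarrow> complex)" where
  "cx_vec Y = (\<lambda>f. complex_of_real (Y f))"

definition cx_map :: "(('x \<Rightarrow> real) \<Rightarrow> ('x \<Rightarrow> real)) \<Rightarrow> ('x \<Rightarrow> complex) \<Rightarrow> ('x \<Rightarrow> complex)" where
  "cx_map A W = (\<lambda>f. Complex (A (\<lambda>h. Re (W h)) f) (A (\<lambda>h. Im (W h)) f))"

definition space10 :: "('x \<Rightarrow> real) set \<Rightarrow> (('x \<Rightarrow> real) \<Rightarrow> ('x \<Rightarrow> real)) \<Rightarrow> ('x \<Rightarrow> complex) set" where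
  "space10 V J = {Z \<in> cx_space V. cx_map J Z = (\<lambda>f. \<i> * Z f)}"

definition space01 :: "('x \<Rightarrow> real) set \<Rightarrow> (('x \<Rightarrow> real) \<Rightarrow> ('x \<Rightarrow> real)) \<Rightarrow> ('x \<Rightarrow> complex) set" where
  "space01 V J = {Z \<in> cx_space V. cx_map J Z = (\<lambda>f. - \<i> * Z f)}"

definition clinear_form_on :: "('x \<Rightarrow> complex) set \<Rightarrow> (('x \<Rightarrow> complex) \<Rightarrow> complex) \<Rightarrow> bool" where
  "clinear_form_on V l \<longleftrightarrow>
     (\<forall>v\<in>V. \<forall>w\<in>V. \<forall>a b. l (\<lambda>f. a * v f + b * w f) = a * l v + b * l w)"

text \<open>The dual of one eigenspace is embedded in the dual of the complexification of \<open>V\<close> by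
  extending with \<open>0\<close> to the other eigenspace.\<close>

definition dual10 :: "('x \<Rightarrow> real) set \<Rightarrow> (('x \<Rightarrow> real) \<Rightarrow> ('x \<Rightarrow> real))
    \<Rightarrow> (('x \<Rightarrow> complex) \<Rightarrow> complex) set" where
  "dual10 V J = {l. clinear_form_on (cx_space V) l \<and> (\<forall>Z\<in>space01 V J. l Z = 0)}"

definition dual01 :: "('x \<Rightarrow> real) set \<Rightarrow> (('x \<Rightarrow> real) \<Rightarrow> ('x \<Rightarrow> real))
    \<Rightarrow> (('x \<Rightarrow> complex) \<Rightarrow> complex) set" where
  "dual01 V J = {l. clinear_form_on (cx_space V) l \<and> (\<forall>Z\<in>space10 V J. l Z = 0)}"

definition wedge :: "nat \<Rightarrow> (nat \<Rightarrow> 'v \<Rightarrow> complex) \<Rightarrow> 'v list \<Rightarrow> complex" where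
  "wedge k l vs = (\<Sum>\<sigma> | \<sigma> permutes {..<k}. of_int (sign \<sigma>) * (\<Prod>i<k. l i (vs ! \<sigma> i)))"

text \<open>A \<open>k\<close>-form takes the list of its \<open>k\<close> arguments, and is \<open>0\<close> on all lists that are
  not lists of \<open>k\<close> vectors of the complexification of \<open>V\<close>. The space \<open>\<Lambda>\<^sup>p\<^sup>,\<^sup>q V\<^sup>*\<close> is the complex
  span of the wedge products of \<open>p\<close> elements of \<open>dual10\<close> with \<open>q\<close> elements of \<open>dual01\<close>.\<close>

definition pq_forms :: "('x \<Rightarrow> real) set \<Rightarrow> (('x \<Rightarrow> real) \<Rightarrow> ('x \<Rightarrow> real)) \<Rightarrow> nat \<Rightarrow> nat
    \<Rightarrow> (('x \<Rightarrow> complex) list \<Rightarrow> complex) set" where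
  "pq_forms V J p q = {\<omega>. \<exists>(r::nat) (a :: nat \<Rightarrow> complex) l.
     (\<forall>j<r. (\<forall>i<p. l j i \<in> dual10 V J) \<and> (\<forall>i\<in>{p..<p + q}. l j i \<in> dual01 V J)) \<and>
     \<omega> = (\<lambda>vs. if length vs = p + q \<and> set vs \<subseteq> cx_space V
                then \<Sum>j<r. a j * wedge (p + q) (l j) vs else 0)}"

section \<open>Sections over a manifold\<close>

definition local_frame :: "('a, 'e::euclidean_space) mfd \<Rightarrow> ('a \<Rightarrow> 'a tvec set) \<Rightarrow> 'a set
    \<Rightarrow> ('a \<Rightarrow> 'a tvec) list \<Rightarrow> bool" where
  "local_frame M D W Es \<longleftrightarrow> (\<forall>E\<in>set Es. local_vector_field M W E) \<and>
     (\<forall>x\<in>W. distinct (map (\<lambda>E. E x) Es) \<and> tv.independent ((\<lambda>E. E x) ` set Es) \<and>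
        tv.span ((\<lambda>E. E x) ` set Es) = D x)"

text \<open>The smooth \<open>(p,q)\<close>-forms on a distribution \<open>D\<close> with complex structure \<open>J\<close>. Smoothness of
  a section means smoothness of its components in a smooth frame of \<open>D\<close> near each point.\<close>

definition A_forms :: "('a, 'e::euclidean_space) mfd \<Rightarrow> ('a \<Rightarrow> 'a tvec set)
    \<Rightarrow> ('a \<Rightarrow> 'a tvec \<Rightarrow> 'a tvec) \<Rightarrow> nat \<Rightarrow> nat \<Rightarrow> ('a \<Rightarrow> 'a ctvec list \<Rightarrow> complex) set" where
  "A_forms M D J p q = {\<beta>.
     (\<forall>x\<in>points M. \<beta> x \<in> pq_forms (D x) (J x) p q) \<and>
     (\<forall>x. x \<notin> points M \<longrightarrow> \<beta> x = (\<lambda>_. 0)) \<and>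
     (\<forall>x\<in>points M. \<exists>W Es. openin (mtop M) W \<and> x \<in> W \<and> local_frame M D W Es \<and>
        (\<forall>js. set js \<subseteq> {..<length Es} \<and> length js = p + q \<longrightarrow>
           smooth_map (restrict_mfd M W) euclid (\<lambda>y. \<beta> y (map (\<lambda>i. cx_vec ((Es ! i) y)) js))))}"

definition pull_form :: "('b, 'f::euclidean_space) mfd \<Rightarrow> ('a \<Rightarrow> 'b)
    \<Rightarrow> ('b \<Rightarrow> 'b ctvec list \<Rightarrow> complex) \<Rightarrow> 'a \<Rightarrow> 'a ctvec list \<Rightarrow> complex" where
  "pull_form N F \<beta> = (\<lambda>x vs. \<beta> (F x) (map (push N F) vs))"

text \<open>Lie derivative along a complete vector field \<open>X\<close>, for forms on a distribution \<open>D\<close> that is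
  invariant under the flow of \<open>X\<close>.\<close>

definition lie_derivative :: "('a, 'e::euclidean_space) mfd \<Rightarrow> ('a \<Rightarrow> 'a tvec set) \<Rightarrow> ('a \<Rightarrow> 'a tvec)
    \<Rightarrow> ('a \<Rightarrow> 'a ctvec list \<Rightarrow> complex) \<Rightarrow> 'a \<Rightarrow> 'a ctvec list \<Rightarrow> complex" where
  "lie_derivative M D X \<beta> = (\<lambda>x vs. if x \<in> points M \<and> set vs \<subseteq> cx_space (D x)
     then vector_derivative (\<lambda>t. pull_form M (flow M X t) \<beta> x vs) (at 0) else 0)"

section \<open>Lie groups\<close>

record ('g, 'e) lgroup = "'g monoid" +
  mfd :: "('g, 'e) mfd"

definition lie_group :: "('g, 'e::euclidean_space) lgroup \<Rightarrow> bool" where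
  "lie_group G \<longleftrightarrow> group G \<and> manifold (mfd G) \<and> points (mfd G) = carrier G \<and>
     smooth_map (prod_mfd (mfd G) (mfd G)) (mfd G) (\<lambda>(x, y). x \<otimes>\<^bsub>G\<^esub> y) \<and>
     smooth_map (mfd G) (mfd G) (\<lambda>x. inv\<^bsub>G\<^esub> x)"

definition lie_algebra :: "('g, 'e::euclidean_space) lgroup \<Rightarrow> 'g tvec set" where
  "lie_algebra G = tangent_space (mfd G) \<one>\<^bsub>G\<^esub>"

definition left_push :: "('g, 'e::euclidean_space) lgroup \<Rightarrow> 'g
    \<Rightarrow> (('g \<Rightarrow> real) \<Rightarrow> 'k::zero) \<Rightarrow> (('g \<Rightarrow> real) \<Rightarrow> 'k)" where
  "left_push G g = push (mfd G) (\<lambda>h. g \<otimes>\<^bsub>G\<^esub> h)"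

definition lie_bracket :: "('g, 'e::euclidean_space) lgroup \<Rightarrow> 'g tvec \<Rightarrow> 'g tvec \<Rightarrow> 'g tvec" where
  "lie_bracket G X Y = vf_bracket (mfd G) (\<lambda>g. left_push G g X) (\<lambda>g. left_push G g Y) \<one>\<^bsub>G\<^esub>"

definition Ad :: "('g, 'e::euclidean_space) lgroup \<Rightarrow> 'g
    \<Rightarrow> (('g \<Rightarrow> real) \<Rightarrow> 'k::zero) \<Rightarrow> (('g \<Rightarrow> real) \<Rightarrow> 'k)" where
  "Ad G k = push (mfd G) (\<lambda>h. k \<otimes>\<^bsub>G\<^esub> h \<otimes>\<^bsub>G\<^esub> inv\<^bsub>G\<^esub> k)"

text \<open>\<open>one_param G X \<gamma>\<close> says \<open>\<gamma> t = exp (t X)\<close> for all \<open>t\<close>.\<close>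

definition one_param :: "('g, 'e::euclidean_space) lgroup \<Rightarrow> 'g tvec \<Rightarrow> (real \<Rightarrow> 'g) \<Rightarrow> bool" where
  "one_param G X \<gamma> \<longleftrightarrow> smooth_map euclid (mfd G) \<gamma> \<and>
     (\<forall>s t. \<gamma> (s + t) = \<gamma> s \<otimes>\<^bsub>G\<^esub> \<gamma> t) \<and> velocity (mfd G) \<gamma> 0 = X"

definition closed_subgroup :: "('g, 'e::euclidean_space) lgroup \<Rightarrow> 'g set \<Rightarrow> bool" where
  "closed_subgroup G H \<longleftrightarrow> subgroup H G \<and> closedin (mtop (mfd G)) H"

definition lie_subalgebra :: "('g, 'e::euclidean_space) lgroup \<Rightarrow> 'g set \<Rightarrow> 'g tvec set" where
  "lie_subalgebra G H = {X \<in> lie_algebra G. \<exists>\<gamma>. one_param G X \<gamma> \<and> (\<forall>t. \<gamma> t \<in> H)}"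

text \<open>Trace of an endomorphism \<open>A\<close> of a finite-dimensional subspace \<open>V\<close>, computed in some basis.\<close>

definition trace_on :: "('x \<Rightarrow> real) set \<Rightarrow> (('x \<Rightarrow> real) \<Rightarrow> ('x \<Rightarrow> real)) \<Rightarrow> real" where
  "trace_on V A = (let \<B> = (SOME \<B>. \<B> \<subseteq> V \<and> tv.independent \<B> \<and> tv.span \<B> = V)
     in \<Sum>b\<in>\<B>. tv.representation \<B> (A b) b)"

definition killing :: "('g, 'e::euclidean_space) lgroup \<Rightarrow> 'g tvec \<Rightarrow> 'g tvec \<Rightarrow> real" where
  "killing G X Y = trace_on (lie_algebra G) (\<lambda>Z. lie_bracket G X (lie_bracket G Y Z))"

definition semisimple :: "('g, 'e::euclidean_space) lgroup \<Rightarrow> bool" where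
  "semisimple G \<longleftrightarrow> (\<forall>I. tv.subspace I \<and> I \<subseteq> lie_algebra G \<and>
     (\<forall>X\<in>lie_algebra G. \<forall>Y\<in>I. lie_bracket G X Y \<in> I) \<and>
     (\<forall>X\<in>I. \<forall>Y\<in>I. lie_bracket G X Y = 0) \<longrightarrow> I = {0})"

section \<open>Homogeneous spaces\<close>

definition quotient_topology :: "'a topology \<Rightarrow> ('a \<Rightarrow> 'b) \<Rightarrow> 'b topology" where
  "quotient_topology X f =
     topology (\<lambda>V. V \<subseteq> f ` topspace X \<and> openin X {x \<in> topspace X. f x \<in> V})"

text \<open>The analogue of \<^const>\<open>simply_connected\<close> for abstract topologies.\<close>

definition simply_connected_space :: "'a topology \<Rightarrow> bool" where
  "simply_connected_space X \<longleftrightarrow>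
     (\<forall>c d. pathin X c \<and> c 1 = c 0 \<and> pathin X d \<and> d 1 = d 0 \<longrightarrow>
        homotopic_with (\<lambda>r. r 1 = r 0) (top_of_set {0..1}) X c d)"

text \<open>The manifold structure of \<open>G/H\<close> is the unique one for which the projection is smooth and
  has smooth local sections through every point.\<close>

definition quotient_manifold ::
  "('g, 'e::euclidean_space) lgroup \<Rightarrow> 'g set \<Rightarrow> ('g set, 'f::euclidean_space) mfd \<Rightarrow> bool" where
  "quotient_manifold G H Q \<longleftrightarrow> manifold Q \<and> points Q = lcosets\<^bsub>G\<^esub> H \<and>
     smooth_map (mfd G) Q (\<lambda>g. g <#\<^bsub>G\<^esub> H) \<and>
     (\<forall>x\<in>points Q. \<exists>W \<sigma>. openin (mtop Q) W \<and> x \<in> W \<and>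
        smooth_map (restrict_mfd Q W) (mfd G) \<sigma> \<and> (\<forall>y\<in>W. \<sigma> y <#\<^bsub>G\<^esub> H = y))"

section \<open>Compact CR symmetric contact spaces\<close>

text \<open>The data are \<open>G\<close>, \<open>\<xi> \<in> \<gg>\<close>, the curve \<open>t \<mapsto> exp (t \<xi>)\<close>, the subgroup \<open>H\<close>, the order \<open>N\<close>
  of \<open>\<Gamma>\<close>, half of the dimension of \<open>\<pp>\<close>, the manifold \<open>G/H\<close>, and on it the contact
  form, the complex structure on the contact distribution and the Reeb field.\<close>

record ('g, 'e, 'f) cr_data =
  grp :: "('g, 'e) lgroup"
  xi :: "'g tvec"
  exp_xi :: "real \<Rightarrow> 'g"
  subH :: "'g set"
  ordN :: nat
  half_dim :: nat
  quot :: "('g set, 'f) mfd"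
  theta :: "'g set \<Rightarrow> 'g set tvec \<Rightarrow> real"
  cxJ :: "'g set \<Rightarrow> 'g set tvec \<Rightarrow> 'g set tvec"
  reeb :: "'g set \<Rightarrow> 'g set tvec"

definition stabK :: "('g, 'e::euclidean_space, 'f::euclidean_space) cr_data \<Rightarrow> 'g set" where
  "stabK S = {k \<in> carrier (grp S). Ad (grp S) k (xi S) = xi S}"

definition kk :: "('g, 'e::euclidean_space, 'f::euclidean_space) cr_data \<Rightarrow> 'g tvec set" where
  "kk S = lie_subalgebra (grp S) (stabK S)"

definition pp :: "('g, 'e::euclidean_space, 'f::euclidean_space) cr_data \<Rightarrow> 'g tvec set" where
  "pp S = {X \<in> lie_algebra (grp S). \<forall>Y\<in>kk S. killing (grp S) X Y = 0}"

definition adJ :: "('g, 'e::euclidean_space, 'f::euclidean_space) cr_data \<Rightarrow> 'g tvec \<Rightarrow> 'g tvec"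
  where "adJ S = lie_bracket (grp S) (xi S)"

definition proj :: "('g, 'e::euclidean_space, 'f::euclidean_space) cr_data \<Rightarrow> 'g \<Rightarrow> 'g set" where
  "proj S g = g <#\<^bsub>grp S\<^esub> subH S"

text \<open>The tangent vector of \<open>G/H\<close> at \<open>gH\<close> induced by \<open>X \<in> \<gg>\<close>.\<close>

definition induced :: "('g, 'e::euclidean_space, 'f::euclidean_space) cr_data \<Rightarrow> 'g
    \<Rightarrow> 'g tvec \<Rightarrow> 'g set tvec" where
  "induced S g X = push (quot S) (proj S) (left_push (grp S) g X)"

definition cdist :: "('g, 'e::euclidean_space, 'f::euclidean_space) cr_data \<Rightarrow> 'g set
    \<Rightarrow> 'g set tvec set" where
  "cdist S = contact_dist (quot S) (theta S)"

definition compact_CR_symmetric_contact_space ::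
  "('g, 'e::euclidean_space, 'f::euclidean_space) cr_data \<Rightarrow> bool" where
  "compact_CR_symmetric_contact_space S \<longleftrightarrow>
     (let G = grp S; \<gg> = lie_algebra G; B = killing G; br = lie_bracket G; \<xi> = xi S;
          e = exp_xi S; H = subH S; K = stabK S; \<kk> = kk S; \<pp> = pp S; n = half_dim S; N = ordN S in
      lie_group G \<and> compact_space (mtop (mfd G)) \<and> connected_space (mtop (mfd G)) \<and>
      semisimple G \<and> (\<forall>X\<in>\<gg>. X \<noteq> 0 \<longrightarrow> B X X < 0) \<and>
      \<xi> \<in> \<gg> \<and> connectedin (mtop (mfd G)) K \<and>
      n \<ge> 1 \<and> tv.dim \<pp> = 2 * n \<and>
      (\<forall>X\<in>\<gg>. \<exists>Y\<in>\<kk>. \<exists>Z\<in>\<pp>. X = Y + Z) \<and> \<kk> \<inter> \<pp> = {0} \<and>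
      (\<forall>X\<in>\<kk>. \<forall>Y\<in>\<kk>. br X Y \<in> \<kk>) \<and> (\<forall>X\<in>\<kk>. \<forall>Y\<in>\<pp>. br X Y \<in> \<pp>) \<and>
      (\<forall>X\<in>\<pp>. \<forall>Y\<in>\<pp>. br X Y \<in> \<kk>) \<and>
      simply_connected_space (quotient_topology (mtop (mfd G)) (\<lambda>g. g <#\<^bsub>G\<^esub> K)) \<and>
      (\<forall>Y\<in>\<pp>. adJ S Y \<in> \<pp> \<and> adJ S (adJ S Y) = - Y) \<and>
      one_param G \<xi> e \<and> (\<forall>t. e t = \<one>\<^bsub>G\<^esub> \<longleftrightarrow> (\<exists>k::int. t = 2 * pi * of_int k)) \<and>
      closed_subgroup G H \<and> H \<subseteq> K \<and> lie_subalgebra G H = {X \<in> \<kk>. B \<xi> X = 0} \<and>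
      (\<forall>h\<in>H. \<forall>t. h \<otimes>\<^bsub>G\<^esub> e t = e t \<otimes>\<^bsub>G\<^esub> h) \<and> K = H <#>\<^bsub>G\<^esub> range e \<and>
      N \<ge> 1 \<and> H \<inter> range e = (\<lambda>l. e (real l * (2 * pi / real N))) ` {1..N} \<and>
      card (H \<inter> range e) = N \<and>
      (\<forall>g\<in>carrier G. (\<forall>x\<in>lcosets\<^bsub>G\<^esub> H. g <#\<^bsub>G\<^esub> x = x) \<longrightarrow> g = \<one>\<^bsub>G\<^esub>) \<and>
      quotient_manifold G H (quot S) \<and> DIM('f) = 2 * n + 1 \<and>
      contact_form (quot S) (theta S) \<and>
      (\<forall>g\<in>carrier G. \<forall>X\<in>\<gg>. theta S (proj S g) (induced S g X) = B \<xi> X) \<and>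
      (\<forall>g\<in>carrier G. \<forall>Y\<in>\<pp>. cxJ S (proj S g) (induced S g Y) = induced S g (adJ S Y)) \<and>
      reeb_field (quot S) (theta S) (reeb S) \<and>
      (\<forall>g\<in>carrier G. reeb S (proj S g) = induced S g (tscale (- 1 / (2 * real n)) \<xi>)))"

section \<open>Forms as equivariant functions\<close>

definition A_D :: "('g, 'e::euclidean_space, 'f::euclidean_space) cr_data \<Rightarrow> nat \<Rightarrow> nat
    \<Rightarrow> ('g set \<Rightarrow> 'g set ctvec list \<Rightarrow> complex) set" where
  "A_D S p q = A_forms (quot S) (cdist S) (cxJ S) p q"

text \<open>Functions on \<open>G\<close> are extended by \<open>0\<close> outside the carrier. The second-to-last condition is
  smoothness of a map into a finite-dimensional space of forms, and the last one is
  \<open>\<alpha> (gh) = \<rho>(h\<inverse>) \<alpha>(g)\<close> for the dual adjoint action \<open>\<rho>\<close>.\<close>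

definition C_inf_H :: "('g, 'e::euclidean_space, 'f::euclidean_space) cr_data \<Rightarrow> nat \<Rightarrow> nat
    \<Rightarrow> ('g \<Rightarrow> 'g ctvec list \<Rightarrow> complex) set" where
  "C_inf_H S p q = {\<alpha>.
     (\<forall>g\<in>carrier (grp S). \<alpha> g \<in> pq_forms (pp S) (adJ S) p q) \<and>
     (\<forall>g. g \<notin> carrier (grp S) \<longrightarrow> \<alpha> g = (\<lambda>_. 0)) \<and>
     (\<forall>Ys. set Ys \<subseteq> cx_space (pp S) \<and> length Ys = p + q \<longrightarrow>
        smooth_map (mfd (grp S)) euclid (\<lambda>g. \<alpha> g Ys)) \<and>
     (\<forall>g\<in>carrier (grp S). \<forall>h\<in>subH S. \<forall>Ys. set Ys \<subseteq> cx_space (pp S) \<longrightarrow>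
        \<alpha> (g \<otimes>\<^bsub>grp S\<^esub> h) Ys = \<alpha> g (map (Ad (grp S) h) Ys))}"

definition C_inf_H_m :: "('g, 'e::euclidean_space, 'f::euclidean_space) cr_data \<Rightarrow> nat \<Rightarrow> nat \<Rightarrow> int
    \<Rightarrow> ('g \<Rightarrow> 'g ctvec list \<Rightarrow> complex) set" where
  "C_inf_H_m S p q m = {\<alpha> \<in> C_inf_H S p q. \<forall>g\<in>carrier (grp S). \<forall>t.
     \<alpha> (g \<otimes>\<^bsub>grp S\<^esub> exp_xi S t) = (\<lambda>Ys. exp (- \<i> * of_int m * of_real t) * \<alpha> g Ys)}"

definition psi :: "('g, 'e::euclidean_space, 'f::euclidean_space) cr_data
    \<Rightarrow> ('g set \<Rightarrow> 'g set ctvec list \<Rightarrow> complex) \<Rightarrow> ('g \<Rightarrow> 'g ctvec list \<Rightarrow> complex)" where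
  "psi S \<beta> = (\<lambda>g Ys. if g \<in> carrier (grp S) \<and> set Ys \<subseteq> cx_space (pp S)
     then pull_form (quot S) (proj S) \<beta> g (map (left_push (grp S) g) Ys) else 0)"

definition tilde :: "('g, 'e::euclidean_space, 'f::euclidean_space) cr_data \<Rightarrow> nat \<Rightarrow> nat
    \<Rightarrow> (('g set \<Rightarrow> 'g set ctvec list \<Rightarrow> complex) \<Rightarrow> ('g set \<Rightarrow> 'g set ctvec list \<Rightarrow> complex))
    \<Rightarrow> ('g \<Rightarrow> 'g ctvec list \<Rightarrow> complex) \<Rightarrow> ('g \<Rightarrow> 'g ctvec list \<Rightarrow> complex)" where
  "tilde S p q P = psi S \<circ> P \<circ> inv_into (A_D S p q) (psi S)"

definition lie_T :: "('g, 'e::euclidean_space, 'f::euclidean_space) cr_data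
    \<Rightarrow> ('g set \<Rightarrow> 'g set ctvec list \<Rightarrow> complex) \<Rightarrow> ('g set \<Rightarrow> 'g set ctvec list \<Rightarrow> complex)" where
  "lie_T S = lie_derivative (quot S) (cdist S) (reeb S)"

end

(*
  Since alpha is equivariant under H and G/H has smooth local sections, alpha descends to a form
  beta on G/H with psi beta = alpha; so tilde is applied to a genuine preimage. The flow of the
  Reeb field is right translation by exp (- t xi / 2n), and left-invariant vectors are moved by it
  through Ad (exp (t xi / 2n)). Hence psi of the pulled back form is alpha (g exp s) evaluated on
  Ad (exp (- s)) Y with s = - t xi / 2n. The weight of alpha gives the factor exp (- i m s) and, as
  Ad (exp (s xi)) acts by exp (i s) and exp (- i s) on the two eigenspaces of ad xi, the bidegree
  gives exp (- i (p - q) s). Differentiating exp (i t (m + p - q) / 2n) at t = 0 gives the claim.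
*)
theory Submission
  imports Defs "HOL-Real_Asymp.Real_Asymp"
begin

section \<open>Differential calculus\<close>

text \<open>Tangent vectors are derivations, so calculus on them has to be recovered: Hadamard's
  lemma turns each derivation into a directional derivative in a chart, and only in that form can it
  be exchanged with a derivative in a parameter. This exchange yields d/dt Ad (exp (t X)) Z = Ad
  (exp (t X)) [X, Z], the source of the rotation of p. The flow inside the Lie derivative is a
  choice, so an explicit formula for it rests on uniqueness of flows. The space p is defined by
  orthogonality but used as the image of ad xi: ad xi kills k and is invertible on p, which makes p
  a subspace stable under Ad K. Descending a form requires p to map injectively to the contact
  distribution. This comes from a count of dimensions in the tangent space of G/H. The factor - 1 /
  2n in the Reeb field is the normalisation theta T = 1: the square of ad xi is 0 on k and - 1 on p,
  so B(xi, xi) = - 2n. The computation uses nothing of beta beyond psi beta = alpha, so it holds for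
  whichever preimage is chosen, and it can be repeated for the second Lie derivative.\<close>

lemma Ck_on_cong:
  assumes "open S" "\<And>x. x \<in> S \<Longrightarrow> f x = g x" "Ck_on k S f"
  shows "Ck_on k S g"
  using assms(2,3)
proof (induction k arbitrary: f g)
  case 0
  then show ?case using continuous_on_cong by (metis Ck_on.simps(1))
next
  case (Suc k)
  have d: "(g has_derivative frechet_derivative f (at x)) (at x)" if "x \<in> S" for x
    using Suc.prems that assms(1) frechet_derivative_works has_derivative_transform_within_open
    by (metis Ck_on.simps(2))
  have "frechet_derivative g (at x) = frechet_derivative f (at x)" if "x \<in> S" for x
    using d[OF that] frechet_derivative_at by metis
  then show ?case
    using Suc.prems d Suc.IH[of "\<lambda>x. frechet_derivative f (at x) v" "\<lambda>x. frechet_derivative g (at x) v" for v]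
    by (simp add: differentiable_def) blast
qed

text \<open>\<open>frechet_derivative\<close> is a chosen object; since derivatives at a point are
  unique, an explicit formula may replace it on the open set \<open>S\<close>.\<close>

lemma Ck_on_SucI:
  assumes "open S" "\<And>x. x \<in> S \<Longrightarrow> (f has_derivative f' x) (at x)" "\<And>v. Ck_on k S (\<lambda>x. f' x v)"
  shows "Ck_on (Suc k) S f"
proof -
  have "frechet_derivative f (at x) = f' x" if "x \<in> S" for x
    using assms(2)[OF that] frechet_derivative_at by metis
  then show ?thesis
    using assms by (auto simp: differentiable_def intro: Ck_on_cong[of S "\<lambda>x. f' x v" for v])
qed

lemma Ck_on_subset: "Ck_on k S f \<Longrightarrow> T \<subseteq> S \<Longrightarrow> Ck_on k T f"
  by (induction k arbitrary: f) (auto intro: continuous_on_subset)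

lemma Ck_on_SucD: "Ck_on (Suc k) S f \<Longrightarrow> Ck_on k S f"
proof (induction k arbitrary: f)
  case 0
  then show ?case
    by (auto intro!: continuous_at_imp_continuous_on differentiable_imp_continuous_within)
qed auto

lemma Ck_on_Suc_has_derivative:
  "Ck_on (Suc k) S f \<Longrightarrow> x \<in> S \<Longrightarrow> (f has_derivative frechet_derivative f (at x)) (at x)"
  by (simp add: frechet_derivative_works)

lemma Ck_on_local:
  assumes "\<And>x. x \<in> S \<Longrightarrow> \<exists>T. open T \<and> x \<in> T \<and> Ck_on k T f"
  shows "Ck_on k S f"
  using assms
proof (induction k arbitrary: f)
  case 0
  have "continuous (at x) f" if "x \<in> S" for x
    using 0[OF that] by (auto simp: continuous_on_eq_continuous_at)
  then show ?case by (simp add: continuous_at_imp_continuous_on)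
next
  case (Suc k)
  then show ?case by (fastforce intro!: Suc.IH)
qed

lemma Ck_on_const: "Ck_on k S (\<lambda>x. c)"
  by (induction k arbitrary: c) auto

lemma Ck_on_bounded_linear:
  assumes "bounded_linear h" "open S"
  shows "Ck_on k S h"
proof (cases k)
  case (Suc n)
  then show ?thesis
    using Ck_on_SucI[OF assms(2), of h "\<lambda>_. h" n] assms(1) bounded_linear_imp_has_derivative Ck_on_const
    by blast
qed (use assms in \<open>auto intro: linear_continuous_on\<close>)

lemma Ck_on_bounded_linear_compose:
  assumes "bounded_linear h" "open S" "Ck_on k S f"
  shows "Ck_on k S (\<lambda>x. h (f x))"
  using assms(3)
proof (induction k arbitrary: f)
  case 0
  then show ?case
    using assms(1) by (auto intro: bounded_linear.continuous_on)
next
  case (Suc k)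
  show ?case
    using Suc.prems
    by (intro Ck_on_SucI[where f' = "\<lambda>x v. h (frechet_derivative f (at x) v)"] Suc.IH assms
        bounded_linear.has_derivative[OF assms(1)]) (auto simp: frechet_derivative_works)
qed

lemma Ck_on_add:
  assumes "open S" "Ck_on k S f" "Ck_on k S g"
  shows "Ck_on k S (\<lambda>x. f x + g x)"
  using assms(2,3)
proof (induction k arbitrary: f g)
  case 0
  then show ?case by (auto intro: continuous_intros)
next
  case (Suc k)
  show ?case
    using Suc.prems
    by (intro Ck_on_SucI[where f' = "\<lambda>x v. frechet_derivative f (at x) v + frechet_derivative g (at x) v"]
        Suc.IH assms has_derivative_add) (auto simp: frechet_derivative_works)
qed

lemma Ck_on_sum:
  assumes "open S" "\<And>i. i \<in> I \<Longrightarrow> Ck_on k S (f i)"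
  shows "Ck_on k S (\<lambda>x. \<Sum>i\<in>I. f i x)"
  using assms(2)
  by (induction I rule: infinite_finite_induct) (auto intro: Ck_on_const Ck_on_add assms(1))

lemma Ck_on_bilinear:
  assumes "bounded_bilinear h" "open S" "Ck_on k S f" "Ck_on k S g"
  shows "Ck_on k S (\<lambda>x. h (f x) (g x))"
  using assms(3,4)
proof (induction k arbitrary: f g)
  case 0
  then show ?case by (auto intro: bounded_bilinear.continuous_on[OF assms(1)])
next
  case (Suc k)
  \<comment> \<open>The product rule leaves one factor undifferentiated, so both factors are also
    needed one order lower.\<close>
  have "Ck_on k S f" "Ck_on k S g"
    using Suc.prems Ck_on_SucD by blast+
  then show ?case
    using Suc.prems
    by (intro Ck_on_SucI[where f' = "\<lambda>x v. h (f x) (frechet_derivative g (at x) v) + h (frechet_derivative f (at x) v) (g x)"]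
        Ck_on_add Suc.IH assms bounded_bilinear.FDERIV[OF assms(1)]) (auto simp: frechet_derivative_works)
qed

lemma Ck_on_compose:
  fixes f :: "'a::real_normed_vector \<Rightarrow> 'b::euclidean_space"
  assumes "open S" "open T" "Ck_on k S f" "Ck_on k T g" "f ` S \<subseteq> T"
  shows "Ck_on k S (\<lambda>x. g (f x))"
  using assms(3,4,5)
proof (induction k arbitrary: g)
  case 0
  then show ?case by (auto intro: continuous_on_compose2)
next
  case (Suc k)
  have f: "(f has_derivative frechet_derivative f (at x)) (at x)" if "x \<in> S" for x
    using Ck_on_Suc_has_derivative Suc.prems(1) that by blast
  have g: "(g has_derivative frechet_derivative g (at (f x))) (at (f x))" if "x \<in> S" for x
    using Ck_on_Suc_has_derivative Suc.prems(2,3) that by blast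
  have gl: "linear (frechet_derivative g (at (f x)))" if "x \<in> S" for x
    using g[OF that] has_derivative_linear by blast
  \<comment> \<open>The chain rule applies the derivative of \<open>g\<close> to a direction that
    varies with \<open>x\<close>, which the induction hypothesis does not cover. Expanding that
    direction in a basis leaves only derivatives of \<open>g\<close> in fixed directions; this is
    why the middle space is Euclidean.\<close>
  let ?h = "\<lambda>x v. \<Sum>i\<in>Basis. (frechet_derivative f (at x) v \<bullet> i) *\<^sub>R frechet_derivative g (at (f x)) i"
  have eq: "?h x v = frechet_derivative g (at (f x)) (frechet_derivative f (at x) v)" if "x \<in> S" for x v
    using euclidean_representation[of "frechet_derivative f (at x) v"]
      linear_sum[OF gl[OF that]] linear_scale[OF gl[OF that]]
    by (metis (mono_tags, lifting) sum.cong)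
  have fk: "Ck_on k S f"
    using Suc.prems Ck_on_SucD by blast
  have "Ck_on k S (\<lambda>x. ?h x v)" for v
    using Suc.prems fk
    by (intro Ck_on_sum Ck_on_bilinear[OF bounded_bilinear_scaleR] assms(1)
        Ck_on_bounded_linear_compose[OF bounded_linear_inner_left] Suc.IH) auto
  moreover have "((\<lambda>x. g (f x)) has_derivative ?h x) (at x)" if "x \<in> S" for x
    unfolding eq[OF that] using has_derivative_compose[OF f[OF that] g[OF that]] .
  ultimately show ?case
    using assms(1) by (intro Ck_on_SucI) auto
qed

section \<open>Closure properties of smooth functions\<close>

lemma smooth_on_cong: "open S \<Longrightarrow> (\<And>x. x \<in> S \<Longrightarrow> f x = g x) \<Longrightarrow> smooth_on S f \<Longrightarrow> smooth_on S g"
  unfolding smooth_on_def using Ck_on_cong by blast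

lemma smooth_on_subset: "smooth_on S f \<Longrightarrow> T \<subseteq> S \<Longrightarrow> smooth_on T f"
  unfolding smooth_on_def using Ck_on_subset by blast

lemma smooth_on_local:
  assumes "\<And>x. x \<in> S \<Longrightarrow> \<exists>T. open T \<and> x \<in> T \<and> smooth_on T f"
  shows "smooth_on S f"
  using assms unfolding smooth_on_def by (meson Ck_on_local)

lemma smooth_on_const: "smooth_on S (\<lambda>x. c)"
  by (simp add: smooth_on_def Ck_on_const)

lemma smooth_on_bounded_linear: "bounded_linear h \<Longrightarrow> open S \<Longrightarrow> smooth_on S h"
  by (simp add: smooth_on_def Ck_on_bounded_linear)

lemma smooth_on_bounded_linear_compose:
  "bounded_linear h \<Longrightarrow> open S \<Longrightarrow> smooth_on S f \<Longrightarrow> smooth_on S (\<lambda>x. h (f x))"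
  by (simp add: smooth_on_def Ck_on_bounded_linear_compose)

lemma smooth_on_add: "open S \<Longrightarrow> smooth_on S f \<Longrightarrow> smooth_on S g \<Longrightarrow> smooth_on S (\<lambda>x. f x + g x)"
  by (simp add: smooth_on_def Ck_on_add)

lemma smooth_on_bilinear:
  "bounded_bilinear h \<Longrightarrow> open S \<Longrightarrow> smooth_on S f \<Longrightarrow> smooth_on S g \<Longrightarrow> smooth_on S (\<lambda>x. h (f x) (g x))"
  by (simp add: smooth_on_def Ck_on_bilinear)

lemmas smooth_on_mult = smooth_on_bilinear[OF bounded_bilinear_mult]
lemmas smooth_on_inner = smooth_on_bilinear[OF bounded_bilinear_inner]

lemma smooth_on_compose:
  fixes f :: "'a::real_normed_vector \<Rightarrow> 'b::euclidean_space"
  shows "open S \<Longrightarrow> open T \<Longrightarrow> smooth_on S f \<Longrightarrow> smooth_on T g \<Longrightarrow> f ` S \<subseteq> T \<Longrightarrow> smooth_on S (\<lambda>x. g (f x))"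
  by (simp add: smooth_on_def Ck_on_compose)

lemma smooth_on_continuous: "smooth_on S f \<Longrightarrow> continuous_on S f"
  unfolding smooth_on_def by (metis Ck_on.simps(1))

lemma smooth_on_has_derivative:
  "smooth_on S f \<Longrightarrow> x \<in> S \<Longrightarrow> (f has_derivative frechet_derivative f (at x)) (at x)"
  unfolding smooth_on_def using Ck_on_Suc_has_derivative by blast

lemma smooth_on_frechet_derivative: "smooth_on S f \<Longrightarrow> smooth_on S (\<lambda>x. frechet_derivative f (at x) v)"
  unfolding smooth_on_def by (metis Ck_on.simps(2))

lemma smooth_on_Pair:
  fixes f :: "'a::real_normed_vector \<Rightarrow> 'b::real_normed_vector" and g :: "'a \<Rightarrow> 'c::real_normed_vector"
  assumes "open S" "smooth_on S f" "smooth_on S g"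
  shows "smooth_on S (\<lambda>x. (f x, g x))"
proof -
  have "smooth_on S (\<lambda>x. (f x, 0) + (0, g x))"
    by (intro smooth_on_add assms smooth_on_bounded_linear_compose[where h = "\<lambda>a. (a, 0)"]
        smooth_on_bounded_linear_compose[where h = "\<lambda>a. (0, a)"] bounded_linear_Pair
        bounded_linear_ident bounded_linear_zero)
  then show ?thesis by simp
qed

subsection \<open>A bump function\<close>

text \<open>The powers of \<open>1 / t\<close> make the family closed under differentiation.\<close>

definition exp_bump :: "nat \<Rightarrow> real \<Rightarrow> real" where
  "exp_bump n t = (if t \<le> 0 then 0 else inverse t ^ n * exp (- inverse t))"

lemma exp_bump_tendsto_0: "(exp_bump n \<longlongrightarrow> 0) (at 0)"
proof -
  have "((\<lambda>t::real. inverse t ^ n * exp (- inverse t)) \<longlongrightarrow> 0) (at_right 0)"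
    by real_asymp
  then have "(exp_bump n \<longlongrightarrow> 0) (at_right 0)"
    by (rule Lim_transform_eventually) (auto simp: exp_bump_def eventually_at_right_less
        intro!: eventually_at_rightI[of 0 1])
  moreover have "(exp_bump n \<longlongrightarrow> 0) (at_left 0)"
    by (rule tendsto_eventually) (auto simp: exp_bump_def intro!: eventually_at_leftI[of "-1"])
  ultimately show ?thesis by (simp add: filterlim_split_at)
qed

lemma exp_bump_deriv:
  "(exp_bump n has_real_derivative (exp_bump (n + 2) t - real n * exp_bump (n + 1) t)) (at t)"
proof -
  consider "t < 0" | "t = 0" | "t > 0" by linarith
  then show ?thesis
  proof cases
    case 1
    have "((\<lambda>_. 0) has_real_derivative 0) (at t)" by simp
    then have "(exp_bump n has_real_derivative 0) (at t)"
      by (rule has_field_derivative_transform_within_open[of _ _ _ "{..<0}"]) (use 1 in \<open>auto simp: exp_bump_def\<close>)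
    then show ?thesis using 1 by (simp add: exp_bump_def)
  next
    case 2
    \<comment> \<open>The difference quotient of \<open>exp_bump n\<close> at 0 is
      \<open>exp_bump (n + 1)\<close>.\<close>
    have "((\<lambda>h. (exp_bump n (0 + h) - exp_bump n 0) / h) \<longlongrightarrow> 0) (at (0::real))"
      by (rule Lim_transform_eventually[OF exp_bump_tendsto_0[of "n+1"]])
         (auto simp: exp_bump_def field_simps eventually_at intro!: exI[of _ 1])
    then have "(exp_bump n has_real_derivative 0) (at 0)" by (rule iffD2[OF DERIV_def])
    then show ?thesis using 2 by (simp add: exp_bump_def)
  next
    case 3
    \<comment> \<open>\<open>DERIV_power\<close> produces the exponent \<open>n - Suc 0\<close>,
      truncated at \<open>n = 0\<close>; the factor \<open>real n\<close> absorbs that case.\<close>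
    have p: "real n * inverse t ^ n = real n * (inverse t * inverse t ^ (n - Suc 0))"
      by (cases n) auto
    have "((\<lambda>t. inverse t ^ n * exp (- inverse t)) has_real_derivative
        (inverse t ^ (n+2) * exp (- inverse t) - real n * (inverse t ^ (n + 1) * exp (- inverse t)))) (at t)"
      by (rule DERIV_cong[OF DERIV_mult[OF DERIV_power[OF DERIV_inverse] DERIV_fun_exp[OF DERIV_minus[OF DERIV_inverse]]]])
         (use 3 p in \<open>auto simp: algebra_simps power2_eq_square\<close>)
    then have "(exp_bump n has_real_derivative
        (inverse t ^ (n+2) * exp (- inverse t) - real n * (inverse t ^ (n + 1) * exp (- inverse t)))) (at t)"
      by (rule has_field_derivative_transform_within_open[of _ _ _ "{0<..}"]) (use 3 in \<open>auto simp: exp_bump_def\<close>)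
    then show ?thesis using 3 by (simp add: exp_bump_def)
  qed
qed

lemma smooth_on_exp_bump: "smooth_on UNIV (exp_bump n)"
proof -
  have "Ck_on k UNIV (exp_bump n)" for k
  proof (induction k arbitrary: n)
    case 0
    show ?case
      by (simp add: continuous_on_eq_continuous_at DERIV_isCont[OF exp_bump_deriv])
  next
    case (Suc k)
    have "Ck_on k UNIV (\<lambda>t. exp_bump (n + 2) t * v + (- real n * v) * exp_bump (n + 1) t)" for v
      by (intro Ck_on_add Ck_on_bounded_linear_compose[OF bounded_linear_mult_left]
          Ck_on_bounded_linear_compose[OF bounded_linear_mult_right] Suc open_UNIV)
    then show ?case
      using has_derivative_eq_rhs[OF exp_bump_deriv[of n, unfolded has_field_derivative_def]]
      by (intro Ck_on_SucI[where f' = "\<lambda>t v. exp_bump (n + 2) t * v + (- real n * v) * exp_bump (n + 1) t"])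
         (auto simp: fun_eq_iff algebra_simps)
  qed
  then show ?thesis by (simp add: smooth_on_def)
qed

text \<open>The function r^2 - |y - a|^2 is positive exactly inside the ball, so
  \<open>exp_bump 0\<close> of it vanishes outside; dividing by its value at the centre normalises
  it.\<close>

lemma smooth_bump_exists:
  fixes a :: "'a::euclidean_space"
  assumes "r > 0"
  obtains \<rho> :: "'a \<Rightarrow> real" where "smooth_on UNIV \<rho>" "\<rho> a = 1" "\<And>y. y \<notin> cball a r \<Longrightarrow> \<rho> y = 0"
proof -
  let ?q = "\<lambda>y. r\<^sup>2 + (-1) * ((y + (- a)) \<bullet> (y + (- a)))"
  let ?\<rho> = "\<lambda>y. inverse (exp_bump 0 (r\<^sup>2)) * exp_bump 0 (?q y)"
  have "smooth_on UNIV ?q"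
    by (intro smooth_on_add smooth_on_mult smooth_on_inner smooth_on_const open_UNIV
        smooth_on_bounded_linear bounded_linear_ident)
  then have "smooth_on UNIV (\<lambda>y. exp_bump 0 (?q y))"
    using smooth_on_compose smooth_on_exp_bump by blast
  then have "smooth_on UNIV ?\<rho>"
    by (intro smooth_on_mult smooth_on_const open_UNIV)
  moreover have "?\<rho> a = 1"
    using assms by (simp add: exp_bump_def)
  moreover have "?\<rho> y = 0" if "y \<notin> cball a r" for y
  proof -
    have "norm (y - a) \<ge> r" using that by (simp add: dist_norm norm_minus_commute)
    then have "(y - a) \<bullet> (y - a) \<ge> r\<^sup>2"
      using assms by (simp add: dot_square_norm power2_eq_square mult_mono)
    then show ?thesis by (simp add: exp_bump_def)
  qed
  ultimately show ?thesis using that by blast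
qed

subsection \<open>Hadamard's lemma and mixed partial derivatives\<close>

lemma Ck_on_imp_continuous_on: "Ck_on k S f \<Longrightarrow> continuous_on S f"
  by (induction k) (use Ck_on_SucD in \<open>auto simp del: Ck_on.simps(2)\<close>)

text \<open>Differentiating under the integral turns \<open>h\<close> into a partial derivative of
  \<open>h\<close> times an extra factor \<open>t\<close>. The arbitrary power \<open>t ^ j\<close>
  is what closes the induction.\<close>

lemma Ck_on_radial_integral:
  fixes h :: "'a::euclidean_space \<Rightarrow> real"
  assumes S: "open S" "convex S" "p \<in> S" and h: "Ck_on k S h"
  shows "Ck_on k S (\<lambda>y. integral (cbox 0 1) (\<lambda>t::real. t ^ j * h (p + t *\<^sub>R (y - p))))"
  using h
proof (induction k arbitrary: h j)
  have mem: "p + t *\<^sub>R (y - p) \<in> S" if "y \<in> S" "0 \<le> t" "t \<le> 1" for y t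
    using convexD_alt[OF S(2,3) that(1), of t] that by (simp add: algebra_simps)
  have cont: "continuous_on (S \<times> cbox 0 1) (\<lambda>(y, t). t ^ j * h (p + t *\<^sub>R (y - p)))"
    if "continuous_on S h" for j and h :: "'a \<Rightarrow> real"
    unfolding split_beta
    by (intro continuous_intros continuous_on_compose2[OF that]) (auto intro: mem)
  {
    case 0
    then show ?case
      using integral_continuous_on_param[OF cont] by simp
  next
    case (Suc k)
    \<comment> \<open>The Leibniz rule for integrals wants the derivative as one continuous map into
      the bounded linear maps.\<close>
    define D where "D y = Blinfun (frechet_derivative h (at y))" for y
    have hd: "(h has_derivative frechet_derivative h (at y)) (at y)" if "y \<in> S" for y
      using that Suc.prems Ck_on_Suc_has_derivative by blast
    have D: "blinfun_apply (D y) = frechet_derivative h (at y)" if "y \<in> S" for y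
      unfolding D_def using has_derivative_bounded_linear[OF hd[OF that]] bounded_linear_Blinfun_apply by blast
    have Dk: "Ck_on k S (\<lambda>y. blinfun_apply (D y) v)" for v
      by (rule Ck_on_cong[OF S(1), of "\<lambda>x. frechet_derivative h (at x) v"]) (use Suc.prems D in auto)
    \<comment> \<open>In finite dimension, continuity in each direction gives continuity in operator
      norm.\<close>
    have Dc: "continuous_on S D"
      by (intro continuous_on_blinfun_componentwise Ck_on_imp_continuous_on[OF Dk])
    let ?F = "\<lambda>x t. (t ^ Suc j) *\<^sub>R D (p + t *\<^sub>R (x - p))"
    have Fc: "continuous_on (S \<times> cbox 0 1) (\<lambda>(x, t). ?F x t)"
      unfolding split_beta
      by (intro continuous_intros continuous_on_compose2[OF Dc]) (auto intro: mem)
    have hc: "continuous_on S h"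
      using Suc.prems Ck_on_imp_continuous_on by blast
    have der: "((\<lambda>y. integral (cbox 0 1) (\<lambda>t::real. t ^ j * h (p + t *\<^sub>R (y - p)))) has_derivative
        blinfun_apply (integral (cbox 0 1) (?F y))) (at y)" if y: "y \<in> S" for y
    proof -
      have "((\<lambda>y. integral (cbox 0 1) (\<lambda>t::real. t ^ j * h (p + t *\<^sub>R (y - p)))) has_derivative
        blinfun_apply (integral (cbox 0 1) (?F y))) (at y within S)"
      proof (rule leibniz_rule[OF _ _ Fc y S(2)])
        fix x and t :: real assume xt: "x \<in> S" "t \<in> cbox 0 1"
        then have m: "p + t *\<^sub>R (x - p) \<in> S" using mem by auto
        have "((\<lambda>x. h (p + t *\<^sub>R (x - p))) has_derivative (\<lambda>v. D (p + t *\<^sub>R (x - p)) (t *\<^sub>R v))) (at x)"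
          by (rule has_derivative_compose[of "\<lambda>x. p + t *\<^sub>R (x - p)"])
             (use hd[OF m] D[OF m] in \<open>auto intro!: derivative_eq_intros\<close>)
        then have "((\<lambda>x. t ^ j * h (p + t *\<^sub>R (x - p))) has_derivative (\<lambda>v. t ^ j * D (p + t *\<^sub>R (x - p)) (t *\<^sub>R v))) (at x)"
          by (rule has_derivative_mult_right)
        then show "((\<lambda>x. t ^ j * h (p + t *\<^sub>R (x - p))) has_derivative blinfun_apply (?F x t)) (at x within S)"
          by (rule has_derivative_at_withinI[OF has_derivative_eq_rhs])
             (auto simp: fun_eq_iff blinfun.scaleR_left blinfun.scaleR_right)
      next
        fix x assume x: "x \<in> S"
        then have "continuous_on (cbox 0 1) (\<lambda>t::real. t ^ j * h (p + t *\<^sub>R (x - p)))"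
          by (intro continuous_intros continuous_on_compose2[OF hc]) (auto intro: mem)
        then show "(\<lambda>t::real. t ^ j * h (p + t *\<^sub>R (x - p))) integrable_on cbox 0 1"
          by (rule integrable_continuous)
      qed
      then show ?thesis unfolding at_within_open[OF y S(1)] .
    qed
    have "Ck_on k S (\<lambda>y. blinfun_apply (integral (cbox 0 1) (?F y)) v)" for v
    proof (rule Ck_on_cong[OF S(1) _ Suc.IH[OF Dk, of "Suc j" v]])
      fix y assume y: "y \<in> S"
      have "continuous_on (cbox 0 1) (?F y)"
        by (intro continuous_intros continuous_on_compose2[OF Dc]) (use y in \<open>auto intro: mem\<close>)
      then have "(?F y) integrable_on cbox 0 1" by (rule integrable_continuous)
      from integral_linear[OF this bounded_linear_apply_blinfun[of v], symmetric]
      show "integral (cbox 0 1) (\<lambda>t. t ^ Suc j * blinfun_apply (D (p + t *\<^sub>R (y - p))) v) =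
         blinfun_apply (integral (cbox 0 1) (?F y)) v"
        by (simp add: o_def blinfun.scaleR_left)
    qed
    with der show ?case by (intro Ck_on_SucI S)
  }
qed

text \<open>Integrate the derivative of \<open>f\<close> along the segment from \<open>p\<close> to
  \<open>y\<close> and expand the direction \<open>y - p\<close> in the basis: \<open>g i\<close> is
  the integral of the \<open>i\<close>-th partial derivative over the segment, smooth by
  \<open>Ck_on_radial_integral\<close> with exponent 0.\<close>

lemma hadamard:
  fixes f :: "'a::euclidean_space \<Rightarrow> real"
  assumes S: "open S" "convex S" "p \<in> S" and f: "smooth_on S f"
  obtains g where "\<And>i. smooth_on S (g i)" "\<And>i. g i p = frechet_derivative f (at p) i"
    "\<And>y. y \<in> S \<Longrightarrow> f y = f p + (\<Sum>i\<in>Basis. ((y - p) \<bullet> i) * g i y)"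
proof
  define g where "g i y = integral (cbox 0 1) (\<lambda>t::real. frechet_derivative f (at (p + t *\<^sub>R (y - p))) i)" for i y
  show "smooth_on S (g i)" for i
    using Ck_on_radial_integral[OF S, of _ "\<lambda>x. frechet_derivative f (at x) i" 0]
      smooth_on_frechet_derivative[OF f, of i]
    unfolding smooth_on_def g_def power_0 mult_1 by blast
  show "g i p = frechet_derivative f (at p) i" for i
    by (simp add: g_def)
  show "f y = f p + (\<Sum>i\<in>Basis. ((y - p) \<bullet> i) * g i y)" if y: "y \<in> S" for y
  proof -
    let ?D = "\<lambda>t::real. frechet_derivative f (at (p + t *\<^sub>R (y - p)))"
    have mem: "p + t *\<^sub>R (y - p) \<in> S" if "0 \<le> t" "t \<le> 1" for t
      using convexD_alt[OF S(2,3) y, of t] that by (simp add: algebra_simps)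
    have lin: "linear (?D t)" if "0 \<le> t" "t \<le> 1" for t
      using smooth_on_has_derivative[OF f mem[OF that]] has_derivative_linear by blast
    have "((\<lambda>t. f (p + t *\<^sub>R (y - p))) has_vector_derivative ?D t (y - p)) (at t within {0..1})"
      if "t \<in> {0..1}" for t
    proof -
      have t: "0 \<le> t" "t \<le> 1" using that by auto
      have "((\<lambda>t. p + t *\<^sub>R (y - p)) has_derivative (\<lambda>s. s *\<^sub>R (y - p))) (at t within {0..1})"
        by (auto intro!: derivative_eq_intros)
      from has_derivative_compose[OF this has_derivative_at_withinI[OF smooth_on_has_derivative[OF f mem[OF t]]]]
      have "((\<lambda>t. f (p + t *\<^sub>R (y - p))) has_derivative (\<lambda>s. ?D t (s *\<^sub>R (y - p)))) (at t within {0..1})"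
        by simp
      then show ?thesis
        unfolding has_vector_derivative_def by (simp add: linear_scale[OF lin[OF t]])
    qed
    then have "((\<lambda>t. ?D t (y - p)) has_integral (f (p + 1 *\<^sub>R (y - p)) - f (p + 0 *\<^sub>R (y - p)))) {0..1}"
      by (intro fundamental_theorem_of_calculus) auto
    then have 1: "f y - f p = integral (cbox 0 1) (\<lambda>t. ?D t (y - p))"
      by (simp add: integral_unique)
    have "integral (cbox 0 1) (\<lambda>t. ?D t (y - p)) = integral (cbox 0 1) (\<lambda>t. \<Sum>i\<in>Basis. ((y - p) \<bullet> i) * ?D t i)"
    proof (rule integral_cong)
      fix t :: real assume "t \<in> cbox 0 1"
      then have l: "linear (?D t)" using lin by simp
      have "?D t (y - p) = ?D t (\<Sum>i\<in>Basis. ((y - p) \<bullet> i) *\<^sub>R i)"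
        by (simp only: euclidean_representation)
      also have "\<dots> = (\<Sum>i\<in>Basis. ((y - p) \<bullet> i) * ?D t i)"
        by (simp add: linear_sum[OF l] linear_scale[OF l])
      finally show "?D t (y - p) = (\<Sum>i\<in>Basis. ((y - p) \<bullet> i) * ?D t i)" .
    qed
    also have "\<dots> = (\<Sum>i\<in>Basis. integral (cbox 0 1) (\<lambda>t. ((y - p) \<bullet> i) * ?D t i))"
    proof (rule integral_sum)
      fix i :: 'a
      show "(\<lambda>t. ((y - p) \<bullet> i) * ?D t i) integrable_on cbox 0 1"
        by (intro integrable_continuous continuous_intros
            continuous_on_compose2[OF smooth_on_continuous[OF smooth_on_frechet_derivative[OF f]]])
           (auto intro: mem)
    qed simp
    finally show ?thesis using 1 by (simp add: g_def)
  qed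
qed

lemma DERIV_along_line:
  fixes f :: "'a::real_normed_vector \<Rightarrow> real"
  assumes "smooth_on S f" "a + t *\<^sub>R v \<in> S"
  shows "((\<lambda>t. f (a + t *\<^sub>R v)) has_real_derivative frechet_derivative f (at (a + t *\<^sub>R v)) v) (at t)"
proof -
  note d = smooth_on_has_derivative[OF assms]
  have "((\<lambda>t. a + t *\<^sub>R v) has_derivative (\<lambda>s. s *\<^sub>R v)) (at t)"
    by (auto intro!: derivative_eq_intros)
  from has_derivative_compose[OF this d]
  show ?thesis
    unfolding has_field_derivative_def
    by (rule has_derivative_eq_rhs) (simp add: fun_eq_iff linear_scale[OF has_derivative_linear[OF d]])
qed

text \<open>Two applications of the mean value theorem, first along \<open>v\<close> and then along
  \<open>w\<close>, make the quotient equal to the iterated derivative at an intermediate point,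
  which tends to \<open>x\<close>.\<close>

lemma second_difference_tendsto:
  fixes f :: "'a::real_normed_vector \<Rightarrow> real"
  assumes S: "open S" "x \<in> S" and f: "smooth_on S f"
  shows "((\<lambda>h. (f (x + h *\<^sub>R w + h *\<^sub>R v) - f (x + h *\<^sub>R v) - f (x + h *\<^sub>R w) + f x) / h\<^sup>2) \<longlongrightarrow>
      frechet_derivative (\<lambda>y. frechet_derivative f (at y) v) (at x) w) (at_right 0)"
    (is "(?q \<longlongrightarrow> ?d x) _")
proof (rule tendstoI)
  fix e :: real assume "e > 0"
  note f' = smooth_on_frechet_derivative[OF f]
  have "continuous (at x) ?d"
    using smooth_on_continuous[OF smooth_on_frechet_derivative[OF f'[of v]], of w] S
    by (simp add: continuous_on_eq_continuous_at)
  then obtain d1 where d1: "d1 > 0" "\<And>y. dist y x < d1 \<Longrightarrow> dist (?d y) (?d x) < e"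
    using \<open>e > 0\<close> unfolding continuous_at_eps_delta by blast
  obtain d2 where d2: "d2 > 0" "ball x d2 \<subseteq> S"
    using S open_contains_ball by blast
  define d where "d = min d1 d2"
  \<comment> \<open>For \<open>h < c\<close> every displacement by at most \<open>h\<close> along
    \<open>w\<close> and along \<open>v\<close> stays within \<open>d\<close> of \<open>x\<close>;
    the summand 1 keeps the denominator positive.\<close>
  define c where "c = d / (norm v + norm w + 1)"
  have c: "c > 0" "c * (norm v + norm w + 1) = d"
    using d1(1) d2(1) add_nonneg_pos[of "norm v + norm w" 1] by (auto simp: c_def d_def intro!: divide_pos_pos)
  have near: "dist (x + s *\<^sub>R w + t *\<^sub>R v) x < d" if "0 \<le> s" "s \<le> h" "0 \<le> t" "t \<le> h" "h < c" for s t h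
  proof -
    have "norm (s *\<^sub>R w + t *\<^sub>R v) \<le> s * norm w + t * norm v"
      using that norm_triangle_ineq[of "s *\<^sub>R w" "t *\<^sub>R v"] by simp
    also have "\<dots> \<le> h * norm w + h * norm v"
      using that by (intro add_mono mult_right_mono) auto
    also have "\<dots> \<le> h * (norm v + norm w + 1)"
      using that by (simp add: algebra_simps)
    also have "\<dots> < d"
      unfolding c(2)[symmetric] using that by (intro mult_strict_right_mono) (auto simp: add_nonneg_pos)
    finally show ?thesis by (simp add: dist_norm algebra_simps)
  qed
  then have nearS: "x + s *\<^sub>R w + t *\<^sub>R v \<in> S" if "0 \<le> s" "s \<le> h" "0 \<le> t" "t \<le> h" "h < c" for s t h
    using that d2(2) by (fastforce simp: d_def dist_commute)
  have "dist (?q h) (?d x) < e" if h: "0 < h" "h < c" for h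
  proof -
    have D: "((\<lambda>t. f ((x + h *\<^sub>R w) + t *\<^sub>R v) - f (x + t *\<^sub>R v)) has_real_derivative
        frechet_derivative f (at ((x + h *\<^sub>R w) + t *\<^sub>R v)) v - frechet_derivative f (at (x + t *\<^sub>R v)) v) (at t)"
      if "0 \<le> t" "t \<le> h" for t
      using that h nearS[of h h t] nearS[of 0 h t] by (intro DERIV_diff DERIV_along_line[OF f]) auto
    obtain t where t: "0 < t" "t < h" and
      eq1: "f ((x + h *\<^sub>R w) + h *\<^sub>R v) - f (x + h *\<^sub>R v) - (f ((x + h *\<^sub>R w) + 0 *\<^sub>R v) - f (x + 0 *\<^sub>R v))
        = (h - 0) * (frechet_derivative f (at ((x + h *\<^sub>R w) + t *\<^sub>R v)) v - frechet_derivative f (at (x + t *\<^sub>R v)) v)"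
      using MVT2[OF h(1) D] by blast
    have D': "((\<lambda>s. frechet_derivative f (at ((x + t *\<^sub>R v) + s *\<^sub>R w)) v) has_real_derivative
        ?d ((x + t *\<^sub>R v) + s *\<^sub>R w)) (at s)"
      if "0 \<le> s" "s \<le> h" for s
      using that h t nearS[of s h t] by (intro DERIV_along_line[OF f']) (auto simp: algebra_simps)
    obtain s where s: "0 < s" "s < h" and
      eq2: "frechet_derivative f (at ((x + t *\<^sub>R v) + h *\<^sub>R w)) v - frechet_derivative f (at ((x + t *\<^sub>R v) + 0 *\<^sub>R w)) v
        = (h - 0) * ?d ((x + t *\<^sub>R v) + s *\<^sub>R w)"
      using MVT2[OF h(1) D'] by blast
    have "f (x + h *\<^sub>R w + h *\<^sub>R v) - f (x + h *\<^sub>R v) - f (x + h *\<^sub>R w) + f x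
        = h * (h * ?d (x + s *\<^sub>R w + t *\<^sub>R v))"
      using eq1 eq2 by (simp add: add.assoc add.commute[of "t *\<^sub>R v"])
    then have "?q h = ?d (x + s *\<^sub>R w + t *\<^sub>R v)"
      using h by (simp add: power2_eq_square)
    then show ?thesis
      using near[of s h t] s t h d1(2) by (simp add: d_def)
  qed
  then show "\<forall>\<^sub>F h in at_right 0. dist (?q h) (?d x) < e"
    using c(1) by (auto intro!: eventually_at_rightI[of 0 c])
qed

text \<open>The second difference is symmetric in \<open>v\<close> and \<open>w\<close>, and its
  limit is unique.\<close>

lemma mixed_partials_commute:
  fixes f :: "'a::real_normed_vector \<Rightarrow> real"
  assumes S: "open S" "x \<in> S" and f: "smooth_on S f"
  shows "frechet_derivative (\<lambda>y. frechet_derivative f (at y) v) (at x) w =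
         frechet_derivative (\<lambda>y. frechet_derivative f (at y) w) (at x) v"
proof -
  have "(\<lambda>h. (f (x + h *\<^sub>R v + h *\<^sub>R w) - f (x + h *\<^sub>R w) - f (x + h *\<^sub>R v) + f x) / h\<^sup>2) =
     (\<lambda>h. (f (x + h *\<^sub>R w + h *\<^sub>R v) - f (x + h *\<^sub>R v) - f (x + h *\<^sub>R w) + f x) / h\<^sup>2)"
    by (intro ext arg_cong2[where f = "(/)"] refl) (simp add: algebra_simps)
  then show ?thesis
    using tendsto_unique[OF _ second_difference_tendsto[OF assms, of w v]]
      second_difference_tendsto[OF assms, of v w] by simp
qed

section \<open>Smooth maps between manifolds\<close>

text \<open>A manifold without the separation and countability axioms.\<close>

definition charted :: "('a, 'e::euclidean_space) mfd \<Rightarrow> bool" where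
  "charted M \<longleftrightarrow>
     (\<Union>(U, \<phi>)\<in>atlas M. U) = points M \<and>
     (\<forall>(U, \<phi>)\<in>atlas M. openin (mtop M) U \<and> open (\<phi> ` U) \<and>
        homeomorphic_map (subtopology (mtop M) U) (top_of_set (\<phi> ` U)) \<phi>) \<and>
     (\<forall>(U, \<phi>)\<in>atlas M. \<forall>(V, \<psi>)\<in>atlas M. smooth_on (\<phi> ` (U \<inter> V)) (\<psi> \<circ> inv_into U \<phi>))"

lemma manifold_charted: "manifold M \<Longrightarrow> charted M"
  unfolding manifold_def charted_def by (elim conjE, intro conjI)

lemma chart_at:
  assumes "charted M" "x \<in> points M"
  obtains U \<phi> where "(U, \<phi>) \<in> atlas M" "x \<in> U"
  using assms unfolding charted_def by fast

text \<open>Charts of \<open>restrict_mfd\<close> keep the map and shrink the domain, so their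
  inverses must be compared with the original ones.\<close>

lemma inv_into_restrict: "inj_on f U \<Longrightarrow> W \<subseteq> U \<Longrightarrow> y \<in> f ` W \<Longrightarrow> inv_into W f y = inv_into U f y"
  by (metis f_inv_into_f image_mono inj_on_def inv_into_into subset_iff)

context
  fixes M :: "('a, 'e::euclidean_space) mfd" and U \<phi>
  assumes M: "charted M" and c: "(U, \<phi>) \<in> atlas M"
begin

lemma chart_openin: "openin (mtop M) U"
  and chart_open_image: "open (\<phi> ` U)"
  and chart_homeomorphic: "homeomorphic_map (subtopology (mtop M) U) (top_of_set (\<phi> ` U)) \<phi>"
  using M c unfolding charted_def by blast+

lemma chart_subset: "U \<subseteq> points M"
  using chart_openin openin_subset unfolding points_def by blast

lemma chart_Int_topspace [simp]: "topspace (mtop M) \<inter> U = U"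
  using chart_subset by (auto simp: points_def)

lemma chart_transition: "(V, \<psi>) \<in> atlas M \<Longrightarrow> smooth_on (\<phi> ` (U \<inter> V)) (\<psi> \<circ> inv_into U \<phi>)"
  using M c unfolding charted_def by blast

lemma chart_inj: "inj_on \<phi> U"
  using homeomorphic_imp_injective_map[OF chart_homeomorphic] by simp

lemma chart_inv [simp]: "x \<in> U \<Longrightarrow> inv_into U \<phi> (\<phi> x) = x"
  using chart_inj by simp

lemma chart_inv_mem: "y \<in> \<phi> ` U \<Longrightarrow> inv_into U \<phi> y \<in> U"
  by (rule inv_into_into)

lemma chart_open: "openin (mtop M) W \<Longrightarrow> W \<subseteq> U \<Longrightarrow> open (\<phi> ` W)"
proof -
  assume W: "openin (mtop M) W" "W \<subseteq> U"
  then have "openin (subtopology (mtop M) U) W"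
    by (simp add: openin_open_subtopology chart_openin)
  then have "openin (top_of_set (\<phi> ` U)) (\<phi> ` W)"
    using homeomorphic_imp_open_map[OF chart_homeomorphic] unfolding open_map_def by blast
  then show ?thesis using chart_open_image openin_open_trans by blast
qed

lemma chart_continuous: "continuous_map (subtopology (mtop M) U) euclidean \<phi>"
  using homeomorphic_imp_continuous_map[OF chart_homeomorphic] continuous_map_into_fulltopology by blast

lemma chart_open_vimage: "open V \<Longrightarrow> openin (mtop M) {x \<in> U. \<phi> x \<in> V}"
  using openin_continuous_map_preimage[OF chart_continuous, of V] chart_openin
  by (simp add: openin_open_subtopology)

lemma chart_inv_continuous: "continuous_map (top_of_set (\<phi> ` U)) (mtop M) (inv_into U \<phi>)"
proof -
  obtain g where g: "homeomorphic_maps (subtopology (mtop M) U) (top_of_set (\<phi> ` U)) \<phi> g"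
    using chart_homeomorphic homeomorphic_map_maps by blast
  then have gc: "continuous_map (top_of_set (\<phi> ` U)) (subtopology (mtop M) U) g"
    and ge: "\<And>x. x \<in> U \<Longrightarrow> g (\<phi> x) = x"
    by (simp_all add: homeomorphic_maps_def)
  have "continuous_map (top_of_set (\<phi> ` U)) (mtop M) g"
    using gc continuous_map_into_fulltopology by blast
  then show ?thesis
    by (rule continuous_map_eq) (use ge in auto)
qed

end

lemma smooth_mapD:
  "smooth_map M N F \<Longrightarrow> (U, \<phi>) \<in> atlas M \<Longrightarrow> (V, \<psi>) \<in> atlas N \<Longrightarrow>
    smooth_on (\<phi> ` {x \<in> U. F x \<in> V}) (\<psi> \<circ> F \<circ> inv_into U \<phi>)"
  unfolding smooth_map_def by blast

lemma smooth_map_continuous: "smooth_map M N F \<Longrightarrow> continuous_map (mtop M) (mtop N) F"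
  unfolding smooth_map_def by blast

lemma smooth_map_points: "smooth_map M N F \<Longrightarrow> x \<in> points M \<Longrightarrow> F x \<in> points N"
  using smooth_map_continuous continuous_map_image_subset_topspace unfolding points_def by blast

lemma smooth_mapI:
  assumes "continuous_map (mtop M) (mtop N) F"
    and "\<And>U \<phi> V \<psi>. (U, \<phi>) \<in> atlas M \<Longrightarrow> (V, \<psi>) \<in> atlas N \<Longrightarrow>
      smooth_on (\<phi> ` {x \<in> U. F x \<in> V}) (\<psi> \<circ> F \<circ> inv_into U \<phi>)"
  shows "smooth_map M N F"
  using assms unfolding smooth_map_def by blast

lemma chart_preimage_open:
  assumes "charted M" "(U, \<phi>) \<in> atlas M" "continuous_map (mtop M) X F" "openin X V"
  shows "open (\<phi> ` {x \<in> U. F x \<in> V})"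
proof -
  have "{x \<in> U. F x \<in> V} = U \<inter> {x \<in> topspace (mtop M). F x \<in> V}"
    using chart_subset[OF assms(1,2)] by (auto simp: points_def)
  moreover have "openin (mtop M) (U \<inter> {x \<in> topspace (mtop M). F x \<in> V})"
    using assms chart_openin openin_continuous_map_preimage by blast
  ultimately show ?thesis
    using chart_open[OF assms(1,2)] by (metis inf_le1)
qed

section \<open>Composition, restriction and locality of smooth maps\<close>

lemma smooth_map_compose:
  assumes M: "charted M" and N: "charted N" and P: "charted P"
    and F: "smooth_map M N F" and G: "smooth_map N P G"
  shows "smooth_map M P (\<lambda>x. G (F x))"
proof (rule smooth_mapI)
  note Fc = smooth_map_continuous[OF F] and Gc = smooth_map_continuous[OF G]
  show "continuous_map (mtop M) (mtop P) (\<lambda>x. G (F x))"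
    using continuous_map_compose[OF Fc Gc] by (simp add: o_def)
  fix U \<phi> V \<psi> assume c: "(U, \<phi>) \<in> atlas M" and d: "(V, \<psi>) \<in> atlas P"
  show "smooth_on (\<phi> ` {x \<in> U. G (F x) \<in> V}) (\<psi> \<circ> (\<lambda>x. G (F x)) \<circ> inv_into U \<phi>)"
  proof (rule smooth_on_local)
    fix y assume "y \<in> \<phi> ` {x \<in> U. G (F x) \<in> V}"
    then obtain x where x: "x \<in> U" "G (F x) \<in> V" "y = \<phi> x" by auto
    then have "F x \<in> points N"
      using smooth_map_points[OF F] chart_subset[OF M c] by blast
    then obtain W \<eta> where w: "(W, \<eta>) \<in> atlas N" "F x \<in> W"
      using chart_at[OF N] by blast
    \<comment> \<open>\<open>W'\<close> is the part of a chart around \<open>F x\<close> that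
      \<open>G\<close> sends into \<open>V\<close>. Near \<open>y\<close> the composite, read in the
      given charts, factors through this middle chart.\<close>
    define W' where "W' = {w \<in> W. G w \<in> V}"
    have Veq: "W' = W \<inter> {w \<in> topspace (mtop N). G w \<in> V}"
      using chart_subset[OF N w(1)] by (auto simp: W'_def points_def)
    have W': "openin (mtop N) W'"
      unfolding Veq using chart_openin[OF N w(1)] chart_openin[OF P d] openin_continuous_map_preimage[OF Gc] by blast
    let ?T = "\<phi> ` {x \<in> U. F x \<in> W'}"
    have T: "open ?T"
      by (rule chart_preimage_open[OF M c Fc W'])
    have "smooth_on ?T (\<eta> \<circ> F \<circ> inv_into U \<phi>)"
      by (rule smooth_on_subset[OF smooth_mapD[OF F c w(1)]]) (auto simp: W'_def)
    moreover have "smooth_on (\<eta> ` W') (\<psi> \<circ> G \<circ> inv_into W \<eta>)"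
      unfolding W'_def by (rule smooth_mapD[OF G w(1) d])
    moreover have "open (\<eta> ` W')"
      using chart_open[OF N w(1) W'] by (auto simp: W'_def)
    moreover have "(\<eta> \<circ> F \<circ> inv_into U \<phi>) ` ?T \<subseteq> \<eta> ` W'"
      using chart_inv[OF M c] by auto
    ultimately have "smooth_on ?T (\<lambda>y. (\<psi> \<circ> G \<circ> inv_into W \<eta>) ((\<eta> \<circ> F \<circ> inv_into U \<phi>) y))"
      using smooth_on_compose[OF T] by blast
    then have "smooth_on ?T (\<psi> \<circ> (\<lambda>x. G (F x)) \<circ> inv_into U \<phi>)"
      by (rule smooth_on_cong[OF T, rotated])
         (use chart_inv[OF M c] chart_inv[OF N w(1)] in \<open>auto simp: W'_def\<close>)
    moreover have "y \<in> ?T" using x w by (auto simp: W'_def)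
    ultimately show "\<exists>T. open T \<and> y \<in> T \<and> smooth_on T (\<psi> \<circ> (\<lambda>x. G (F x)) \<circ> inv_into U \<phi>)"
      using T by blast
  qed
qed

lemma smooth_map_cong:
  assumes M: "charted M" and N: "charted N" and F: "smooth_map M N F"
    and eq: "\<And>x. x \<in> points M \<Longrightarrow> F x = G x"
  shows "smooth_map M N G"
proof (rule smooth_mapI)
  show "continuous_map (mtop M) (mtop N) G"
    using smooth_map_continuous[OF F] by (rule continuous_map_eq) (use eq in \<open>auto simp: points_def\<close>)
  fix U \<phi> V \<psi> assume c: "(U, \<phi>) \<in> atlas M" and d: "(V, \<psi>) \<in> atlas N"
  have eqU: "x \<in> U \<Longrightarrow> F x = G x" for x using eq chart_subset[OF M c] by blast
  have "{x \<in> U. G x \<in> V} = {x \<in> U. F x \<in> V}" using eqU by auto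
  moreover have "smooth_on (\<phi> ` {x \<in> U. F x \<in> V}) (\<psi> \<circ> G \<circ> inv_into U \<phi>)"
    by (rule smooth_on_cong[OF chart_preimage_open[OF M c smooth_map_continuous[OF F] chart_openin[OF N d]]
          _ smooth_mapD[OF F c d]])
       (use eqU chart_inv_mem[OF M c] in auto)
  ultimately show "smooth_on (\<phi> ` {x \<in> U. G x \<in> V}) (\<psi> \<circ> G \<circ> inv_into U \<phi>)" by simp
qed

lemma points_restrict: "openin (mtop M) W \<Longrightarrow> points (restrict_mfd M W) = W"
  using openin_subset by (auto simp: points_def restrict_mfd_def)

lemma mtop_restrict [simp]: "mtop (restrict_mfd M W) = subtopology (mtop M) W"
  by (simp add: restrict_mfd_def)

lemma charted_restrict:
  assumes M: "charted M" and W: "openin (mtop M) W"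
  shows "charted (restrict_mfd M W)"
  unfolding charted_def
proof (intro conjI)
  have "(\<Union>(U, \<phi>)\<in>atlas M. U) = points M" using M unfolding charted_def by blast
  then have *: "\<exists>U \<phi>. (U, \<phi>) \<in> atlas M \<and> x \<in> U" if "x \<in> W" for x
    using that chart_at[OF M] openin_subset[OF W] unfolding points_def by (metis subsetD)
  show "(\<Union>(U, \<phi>)\<in>atlas (restrict_mfd M W). U) = points (restrict_mfd M W)"
    unfolding points_restrict[OF W]
  proof
    show "W \<subseteq> (\<Union>(U, \<phi>)\<in>atlas (restrict_mfd M W). U)"
    proof
      fix x assume x: "x \<in> W"
      then obtain U \<phi> where "(U, \<phi>) \<in> atlas M" "x \<in> U"
        using * by blast
      then show "x \<in> (\<Union>(U, \<phi>)\<in>atlas (restrict_mfd M W). U)"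
        using x by (intro UN_I[of "(U \<inter> W, \<phi>)"]) (auto simp: restrict_mfd_def)
    qed
  qed (auto simp: restrict_mfd_def)
  show "\<forall>(U, \<phi>)\<in>atlas (restrict_mfd M W). openin (mtop (restrict_mfd M W)) U \<and> open (\<phi> ` U) \<and>
        homeomorphic_map (subtopology (mtop (restrict_mfd M W)) U) (top_of_set (\<phi> ` U)) \<phi>"
  proof clarify
    fix V \<phi> assume "(V, \<phi>) \<in> atlas (restrict_mfd M W)"
    then obtain U where V: "V = U \<inter> W" and c: "(U, \<phi>) \<in> atlas M" by (auto simp: restrict_mfd_def)
    have oV: "openin (mtop M) V" unfolding V using chart_openin[OF M c] W by blast
    have st: "subtopology (subtopology (mtop M) W) V = subtopology (subtopology (mtop M) U) V"
      unfolding subtopology_subtopology by (rule arg_cong[of _ _ "subtopology (mtop M)"]) (auto simp: V)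
    have "homeomorphic_map (subtopology (subtopology (mtop M) U) V) (subtopology (top_of_set (\<phi> ` U)) (\<phi> ` V)) \<phi>"
      by (rule homeomorphic_map_subtopologies[OF chart_homeomorphic[OF M c]])
         (use chart_Int_topspace[OF M c] chart_inj[OF M c] in \<open>auto simp: V inj_on_def\<close>)
    then have "homeomorphic_map (subtopology (subtopology (mtop M) W) V) (top_of_set (\<phi> ` V)) \<phi>"
      unfolding st by (simp add: subtopology_subtopology V inf.absorb2 image_mono)
    moreover have "openin (subtopology (mtop M) W) V"
      using oV W by (simp add: openin_open_subtopology V)
    ultimately show "openin (mtop (restrict_mfd M W)) V \<and> open (\<phi> ` V) \<and>
        homeomorphic_map (subtopology (mtop (restrict_mfd M W)) V) (top_of_set (\<phi> ` V)) \<phi>"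
      using chart_open[OF M c oV] by (simp add: V)
  qed
  show "\<forall>(U, \<phi>)\<in>atlas (restrict_mfd M W). \<forall>(V, \<psi>)\<in>atlas (restrict_mfd M W).
      smooth_on (\<phi> ` (U \<inter> V)) (\<psi> \<circ> inv_into U \<phi>)"
  proof clarify
    fix U' V' \<phi> \<psi> assume "(U', \<phi>) \<in> atlas (restrict_mfd M W)" "(V', \<psi>) \<in> atlas (restrict_mfd M W)"
    then obtain U V where U: "U' = U \<inter> W" "(U, \<phi>) \<in> atlas M" and V: "V' = V \<inter> W" "(V, \<psi>) \<in> atlas M"
      by (auto simp: restrict_mfd_def)
    have "openin (mtop M) (U' \<inter> V')"
      using chart_openin[OF M U(2)] chart_openin[OF M V(2)] W U V by auto
    then have o: "open (\<phi> ` (U' \<inter> V'))"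
      using chart_open[OF M U(2)] U by auto
    have "smooth_on (\<phi> ` (U' \<inter> V')) (\<psi> \<circ> inv_into U \<phi>)"
      by (rule smooth_on_subset[OF chart_transition[OF M U(2) V(2)]]) (auto simp: U V)
    then show "smooth_on (\<phi> ` (U' \<inter> V')) (\<psi> \<circ> inv_into U' \<phi>)"
      by (rule smooth_on_cong[OF o, rotated])
         (use inv_into_restrict[OF chart_inj[OF M U(2)], of U'] U(1) in auto)
  qed
qed

lemma smooth_map_restrict:
  assumes M: "charted M" and N: "charted N" and W: "openin (mtop M) W" and F: "smooth_map M N F"
  shows "smooth_map (restrict_mfd M W) N F"
proof (rule smooth_mapI)
  show "continuous_map (mtop (restrict_mfd M W)) (mtop N) F"
    using smooth_map_continuous[OF F] by (simp add: continuous_map_from_subtopology)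
  fix U' \<phi> V \<psi> assume "(U', \<phi>) \<in> atlas (restrict_mfd M W)" and d: "(V, \<psi>) \<in> atlas N"
  then obtain U where U: "U' = U \<inter> W" and c: "(U, \<phi>) \<in> atlas M"
    by (auto simp: restrict_mfd_def)
  have o: "openin (mtop M) {x \<in> U'. F x \<in> V}"
  proof -
    have "{x \<in> U'. F x \<in> V} = U \<inter> W \<inter> {x \<in> topspace (mtop M). F x \<in> V}"
      using openin_subset[OF W] by (auto simp: U)
    then show ?thesis
      using chart_openin[OF M c] W chart_openin[OF N d] openin_continuous_map_preimage[OF smooth_map_continuous[OF F]]
      by auto
  qed
  have "smooth_on (\<phi> ` {x \<in> U'. F x \<in> V}) (\<psi> \<circ> F \<circ> inv_into U \<phi>)"
    by (rule smooth_on_subset[OF smooth_mapD[OF F c d]]) (auto simp: U)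
  then show "smooth_on (\<phi> ` {x \<in> U'. F x \<in> V}) (\<psi> \<circ> F \<circ> inv_into U' \<phi>)"
    by (rule smooth_on_cong[OF chart_open[OF M c o], rotated 2])
       (use chart_inj[OF M c] in \<open>auto simp: U inj_on_Int\<close>)
qed

lemma smooth_map_into_restrict:
  assumes M: "charted M" and F: "smooth_map M N F" and W: "openin (mtop N) W"
    and sub: "\<And>x. x \<in> points M \<Longrightarrow> F x \<in> W"
  shows "smooth_map M (restrict_mfd N W) F"
proof (rule smooth_mapI)
  show "continuous_map (mtop M) (mtop (restrict_mfd N W)) F"
    using smooth_map_continuous[OF F] sub by (auto simp: continuous_map_in_subtopology points_def)
  fix U \<phi> V' \<psi> assume c: "(U, \<phi>) \<in> atlas M" and "(V', \<psi>) \<in> atlas (restrict_mfd N W)"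
  then obtain V where V: "V' = V \<inter> W" and d: "(V, \<psi>) \<in> atlas N"
    by (auto simp: restrict_mfd_def)
  have "{x \<in> U. F x \<in> V'} = {x \<in> U. F x \<in> V}"
    using sub chart_subset[OF M c] by (auto simp: V)
  then show "smooth_on (\<phi> ` {x \<in> U. F x \<in> V'}) (\<psi> \<circ> F \<circ> inv_into U \<phi>)"
    using smooth_mapD[OF F c d] by simp
qed

lemma smooth_map_local:
  assumes M: "charted M" and N: "charted N"
    and loc: "\<And>x. x \<in> points M \<Longrightarrow> \<exists>W. openin (mtop M) W \<and> x \<in> W \<and> smooth_map (restrict_mfd M W) N F"
  shows "smooth_map M N F"
proof (rule smooth_mapI)
  show "continuous_map (mtop M) (mtop N) F"
    unfolding continuous_map_def
  proof (intro conjI allI impI)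
    show "F \<in> topspace (mtop M) \<rightarrow> topspace (mtop N)"
      using loc smooth_map_points points_restrict unfolding points_def by fast
    fix V assume V: "openin (mtop N) V"
    show "openin (mtop M) {x \<in> topspace (mtop M). F x \<in> V}"
    proof (subst openin_subopen, clarify)
      fix x assume x: "x \<in> topspace (mtop M)" "F x \<in> V"
      then obtain W where W: "openin (mtop M) W" "x \<in> W" "smooth_map (restrict_mfd M W) N F"
        using loc unfolding points_def by blast
      have "openin (subtopology (mtop M) W) {x \<in> topspace (subtopology (mtop M) W). F x \<in> V}"
        using openin_continuous_map_preimage[OF smooth_map_continuous[OF W(3)] V] by simp
      then have "openin (mtop M) {x \<in> topspace (subtopology (mtop M) W). F x \<in> V}"
        using W(1) by (simp add: openin_open_subtopology)
      then show "\<exists>T. openin (mtop M) T \<and> x \<in> T \<and> T \<subseteq> {x \<in> topspace (mtop M). F x \<in> V}"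
        using x W(2) by (intro exI[of _ "{x \<in> topspace (subtopology (mtop M) W). F x \<in> V}"]) auto
    qed
  qed
  then have Fc: "openin (mtop N) V \<Longrightarrow> openin (mtop M) {x \<in> topspace (mtop M). F x \<in> V}" for V
    by (rule openin_continuous_map_preimage)
  fix U \<phi> V \<psi> assume c: "(U, \<phi>) \<in> atlas M" and d: "(V, \<psi>) \<in> atlas N"
  show "smooth_on (\<phi> ` {x \<in> U. F x \<in> V}) (\<psi> \<circ> F \<circ> inv_into U \<phi>)"
  proof (rule smooth_on_local)
    fix y assume "y \<in> \<phi> ` {x \<in> U. F x \<in> V}"
    then obtain x where x: "x \<in> U" "F x \<in> V" "y = \<phi> x" by auto
    then obtain W where W: "openin (mtop M) W" "x \<in> W" "smooth_map (restrict_mfd M W) N F"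
      using loc chart_subset[OF M c] by blast
    have cW: "(U \<inter> W, \<phi>) \<in> atlas (restrict_mfd M W)" using c by (auto simp: restrict_mfd_def)
    let ?T = "\<phi> ` {x \<in> U \<inter> W. F x \<in> V}"
    have "{x \<in> U \<inter> W. F x \<in> V} = U \<inter> W \<inter> {x \<in> topspace (mtop M). F x \<in> V}"
      using openin_subset[OF W(1)] by auto
    then have "openin (mtop M) {x \<in> U \<inter> W. F x \<in> V}"
      using chart_openin[OF M c] W(1) Fc[OF chart_openin[OF N d]] by auto
    then have T: "open ?T"
      using chart_open[OF M c] by auto
    have "smooth_on ?T (\<psi> \<circ> F \<circ> inv_into (U \<inter> W) \<phi>)"
      by (rule smooth_mapD[OF W(3) cW d])
    then have "smooth_on ?T (\<psi> \<circ> F \<circ> inv_into U \<phi>)"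
      by (rule smooth_on_cong[OF T, rotated])
         (use chart_inj[OF M c] in \<open>auto simp: inj_on_Int\<close>)
    then show "\<exists>T. open T \<and> y \<in> T \<and> smooth_on T (\<psi> \<circ> F \<circ> inv_into U \<phi>)"
      using T x W(2) by blast
  qed
qed

subsection \<open>Euclidean spaces, charts and products\<close>

lemma mtop_euclid [simp]: "mtop euclid = euclidean"
  and atlas_euclid: "atlas euclid = {(UNIV, id)}"
  and points_euclid [simp]: "points euclid = UNIV"
  by (simp_all add: euclid_def points_def)

lemma charted_euclid: "charted (euclid :: ('e::euclidean_space, 'e) mfd)"
proof -
  have "homeomorphic_map euclidean euclidean (id :: 'e \<Rightarrow> 'e)"
    by (metis homeomorphic_map_id)
  moreover have "smooth_on UNIV (id :: 'e \<Rightarrow> 'e)"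
    using smooth_on_bounded_linear[OF bounded_linear_ident open_UNIV] by (simp add: id_def)
  ultimately show ?thesis
    by (simp add: charted_def atlas_euclid inv_id flip: id_def)
qed

lemma smooth_map_euclid_iff:
  fixes f :: "'a::euclidean_space \<Rightarrow> 'b::euclidean_space"
  assumes "open S"
  shows "smooth_map (restrict_mfd euclid S) euclid f \<longleftrightarrow> smooth_on S f"
proof -
  have inv: "inv_into S id y = y" if "y \<in> S" for y :: 'a
    using f_inv_into_f[of y id S] that by simp
  have "smooth_on S (f \<circ> inv_into S id) \<longleftrightarrow> smooth_on S f"
    using smooth_on_cong[OF assms, of "f \<circ> inv_into S id" f] smooth_on_cong[OF assms, of f "f \<circ> inv_into S id"] inv
    by auto
  then show ?thesis
    using smooth_on_continuous[of S f] by (auto simp: smooth_map_def restrict_mfd_def atlas_euclid)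
qed

lemma restrict_euclid_UNIV [simp]: "restrict_mfd euclid UNIV = (euclid :: ('e::euclidean_space, 'e) mfd)"
  by (simp add: restrict_mfd_def euclid_def)

lemma smooth_map_euclid_UNIV_iff: "smooth_map euclid euclid f \<longleftrightarrow> smooth_on UNIV f"
  using smooth_map_euclid_iff[of UNIV f] by simp

text \<open>Read in any other chart, \<open>\<phi>\<close> is a transition map.\<close>

lemma smooth_map_chart:
  assumes M: "charted M" and c: "(U, \<phi>) \<in> atlas M"
  shows "smooth_map (restrict_mfd M U) euclid \<phi>"
proof (rule smooth_mapI)
  show "continuous_map (mtop (restrict_mfd M U)) (mtop euclid) \<phi>"
    using chart_continuous[OF M c] by simp
  fix V' \<psi> and V :: "'b set" and \<eta> :: "'b \<Rightarrow> 'b"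
  assume "(V', \<psi>) \<in> atlas (restrict_mfd M U)" "(V, \<eta>) \<in> atlas euclid"
  then obtain W where W: "V' = W \<inter> U" "(W, \<psi>) \<in> atlas M" and V: "V = UNIV" "\<eta> = id"
    by (auto simp: restrict_mfd_def atlas_euclid)
  have o: "open (\<psi> ` (W \<inter> U))"
    using chart_open[OF M W(2)] chart_openin[OF M W(2)] chart_openin[OF M c] by auto
  have "smooth_on (\<psi> ` (W \<inter> U)) (\<phi> \<circ> inv_into V' \<psi>)"
    by (rule smooth_on_cong[OF o _ chart_transition[OF M W(2) c]])
       (use inv_into_restrict[OF chart_inj[OF M W(2)], of V'] W(1) in auto)
  then show "smooth_on (\<psi> ` {x \<in> V'. \<phi> x \<in> V}) (\<eta> \<circ> \<phi> \<circ> inv_into V' \<psi>)"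
    by (simp add: V W(1) Int_def)
qed

lemma smooth_map_chart_inv:
  assumes M: "charted M" and c: "(U, \<phi>) \<in> atlas M"
  shows "smooth_map (restrict_mfd euclid (\<phi> ` U)) M (inv_into U \<phi>)"
proof (rule smooth_mapI)
  show "continuous_map (mtop (restrict_mfd euclid (\<phi> ` U))) (mtop M) (inv_into U \<phi>)"
    using chart_inv_continuous[OF M c] by simp
  fix V' :: "'b set" and \<psi> :: "'b \<Rightarrow> 'b" and V \<eta>
  assume "(V', \<psi>) \<in> atlas (restrict_mfd euclid (\<phi> ` U))" and d: "(V, \<eta>) \<in> atlas M"
  then have V': "V' = \<phi> ` U" "\<psi> = id" by (auto simp: restrict_mfd_def atlas_euclid)
  have eq: "{x \<in> \<phi> ` U. inv_into U \<phi> x \<in> V} = \<phi> ` (U \<inter> V)"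
    using chart_inv[OF M c] by force
  have inv: "inv_into (\<phi> ` U) id y = y" if "y \<in> \<phi> ` U" for y :: 'b
    using f_inv_into_f[of y id "\<phi> ` U"] that by simp
  have o: "open (\<phi> ` (U \<inter> V))"
    using chart_open[OF M c] chart_openin[OF M c] chart_openin[OF M d] by auto
  have "smooth_on (\<phi> ` (U \<inter> V)) (\<eta> \<circ> inv_into U \<phi> \<circ> inv_into (\<phi> ` U) id)"
    by (rule smooth_on_cong[OF o _ chart_transition[OF M c d]]) (use inv in auto)
  then show "smooth_on (\<psi> ` {x \<in> V'. inv_into U \<phi> x \<in> V}) (\<eta> \<circ> inv_into U \<phi> \<circ> inv_into V' \<psi>)"
    unfolding V' using eq by simp
qed

lemma points_prod [simp]: "points (prod_mfd M N) = points M \<times> points N"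
  by (simp add: points_def prod_mfd_def)

lemma mtop_prod [simp]: "mtop (prod_mfd M N) = prod_topology (mtop M) (mtop N)"
  by (simp add: prod_mfd_def)

lemma inv_into_map_prod:
  assumes "inj_on \<phi> U" "inj_on \<psi> V" "a \<in> U" "b \<in> V"
  shows "inv_into (U \<times> V) (map_prod \<phi> \<psi>) (\<phi> a, \<psi> b) = (a, b)"
  using assms map_prod_inj_on[OF assms(1,2)] by (intro inv_into_f_eq) auto

lemma charted_prod:
  assumes M: "charted M" and N: "charted N"
  shows "charted (prod_mfd M N)"
  unfolding charted_def
proof (intro conjI)
  show "(\<Union>(U, \<phi>)\<in>atlas (prod_mfd M N). U) = points (prod_mfd M N)"
  proof
    show "(\<Union>(U, \<phi>)\<in>atlas (prod_mfd M N). U) \<subseteq> points (prod_mfd M N)"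
      using chart_subset[OF M] chart_subset[OF N] by (auto simp: prod_mfd_def points_def) blast+
    show "points (prod_mfd M N) \<subseteq> (\<Union>(U, \<phi>)\<in>atlas (prod_mfd M N). U)"
    proof clarify
      fix a b assume "(a, b) \<in> points (prod_mfd M N)"
      then have "a \<in> points M" "b \<in> points N" by auto
      then obtain U \<phi> V \<psi> where "(U, \<phi>) \<in> atlas M" "a \<in> U" "(V, \<psi>) \<in> atlas N" "b \<in> V"
        using chart_at[OF M] chart_at[OF N] by metis
      then show "(a, b) \<in> (\<Union>(U, \<phi>)\<in>atlas (prod_mfd M N). U)"
        by (intro UN_I[of "(U \<times> V, map_prod \<phi> \<psi>)"]) (auto simp: prod_mfd_def)
    qed
  qed
  show "\<forall>(W, \<eta>)\<in>atlas (prod_mfd M N). openin (mtop (prod_mfd M N)) W \<and> open (\<eta> ` W) \<and>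
        homeomorphic_map (subtopology (mtop (prod_mfd M N)) W) (top_of_set (\<eta> ` W)) \<eta>"
  proof clarify
    fix W \<eta> assume "(W, \<eta>) \<in> atlas (prod_mfd M N)"
    then obtain U \<phi> V \<psi> where W: "W = U \<times> V" "\<eta> = map_prod \<phi> \<psi>"
      and c: "(U, \<phi>) \<in> atlas M" and d: "(V, \<psi>) \<in> atlas N" by (auto simp: prod_mfd_def)
    have im: "\<eta> ` W = \<phi> ` U \<times> \<psi> ` V" by (auto simp: W map_prod_def)
    have "homeomorphic_map (prod_topology (subtopology (mtop M) U) (subtopology (mtop N) V))
       (prod_topology (top_of_set (\<phi> ` U)) (top_of_set (\<psi> ` V))) (\<lambda>(x, y). (\<phi> x, \<psi> y))"
      using homeomorphic_maps_prod chart_homeomorphic[OF M c] chart_homeomorphic[OF N d]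
      unfolding homeomorphic_map_maps by blast
    then show "openin (mtop (prod_mfd M N)) W \<and> open (\<eta> ` W) \<and>
        homeomorphic_map (subtopology (mtop (prod_mfd M N)) W) (top_of_set (\<eta> ` W)) \<eta>"
      using chart_openin[OF M c] chart_openin[OF N d] chart_open_image[OF M c] chart_open_image[OF N d]
      unfolding im by (simp add: W openin_prod_Times_iff open_Times subtopology_Times map_prod_def)
  qed
  show "\<forall>(W, \<eta>)\<in>atlas (prod_mfd M N). \<forall>(W', \<eta>')\<in>atlas (prod_mfd M N).
      smooth_on (\<eta> ` (W \<inter> W')) (\<eta>' \<circ> inv_into W \<eta>)"
  proof clarify
    fix W \<eta> W' \<eta>' assume "(W, \<eta>) \<in> atlas (prod_mfd M N)" "(W', \<eta>') \<in> atlas (prod_mfd M N)"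
    then obtain U \<phi> V \<psi> U' \<phi>' V' \<psi>' where W: "W = U \<times> V" "\<eta> = map_prod \<phi> \<psi>"
      and c: "(U, \<phi>) \<in> atlas M" and d: "(V, \<psi>) \<in> atlas N"
      and W': "W' = U' \<times> V'" "\<eta>' = map_prod \<phi>' \<psi>'"
      and c': "(U', \<phi>') \<in> atlas M" and d': "(V', \<psi>') \<in> atlas N" unfolding prod_mfd_def by auto
    have im: "\<eta> ` (W \<inter> W') = \<phi> ` (U \<inter> U') \<times> \<psi> ` (V \<inter> V')"
      unfolding W W' Times_Int_Times by (auto simp: map_prod_def)
    have o1: "open (\<phi> ` (U \<inter> U'))"
      using chart_open[OF M c] chart_openin[OF M c] chart_openin[OF M c'] by auto
    have o2: "open (\<psi> ` (V \<inter> V'))"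
      using chart_open[OF N d] chart_openin[OF N d] chart_openin[OF N d'] by auto
    have o: "open (\<eta> ` (W \<inter> W'))" unfolding im by (intro open_Times o1 o2)
    have "smooth_on (\<eta> ` (W \<inter> W')) (\<lambda>y. ((\<phi>' \<circ> inv_into U \<phi>) (fst y), (\<psi>' \<circ> inv_into V \<psi>) (snd y)))"
      by (intro smooth_on_Pair o
          smooth_on_compose[OF o o1 _ chart_transition[OF M c c']] smooth_on_bounded_linear bounded_linear_fst
          smooth_on_compose[OF o o2 _ chart_transition[OF N d d']] bounded_linear_snd)
         (auto simp: im)
    then show "smooth_on (\<eta> ` (W \<inter> W')) (\<eta>' \<circ> inv_into W \<eta>)"
      by (rule smooth_on_cong[OF o, rotated])
         (use chart_inv[OF M c] chart_inv[OF N d] inv_into_map_prod[OF chart_inj[OF M c] chart_inj[OF N d]] in \<open>auto simp: W W'\<close>)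
  qed
qed

text \<open>An equality of records, atlas included: several real parameters can be treated as points
  of one Euclidean manifold.\<close>

lemma prod_euclid: "prod_mfd euclid euclid = euclid"
  by (simp add: prod_mfd_def euclid_def euclidean_product_topology map_prod.id)

lemma smooth_map_Pair:
  assumes P: "charted P" and M: "charted M" and N: "charted N"
    and F: "smooth_map P M F" and G: "smooth_map P N G"
  shows "smooth_map P (prod_mfd M N) (\<lambda>x. (F x, G x))"
proof (rule smooth_mapI)
  note Fc = smooth_map_continuous[OF F] and Gc = smooth_map_continuous[OF G]
  show c: "continuous_map (mtop P) (mtop (prod_mfd M N)) (\<lambda>x. (F x, G x))"
    using Fc Gc by (simp add: continuous_map_pairedI)
  fix U \<phi> V' \<eta> assume e: "(U, \<phi>) \<in> atlas P" and "(V', \<eta>) \<in> atlas (prod_mfd M N)"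
  then obtain A f B g where V: "V' = A \<times> B" "\<eta> = map_prod f g"
    and a: "(A, f) \<in> atlas M" and b: "(B, g) \<in> atlas N" by (auto simp: prod_mfd_def)
  have "openin (mtop (prod_mfd M N)) V'"
    using chart_openin[OF M a] chart_openin[OF N b] by (simp add: V openin_prod_Times_iff)
  then have o: "open (\<phi> ` {x \<in> U. (F x, G x) \<in> V'})"
    by (rule chart_preimage_open[OF P e c])
  have "smooth_on (\<phi> ` {x \<in> U. (F x, G x) \<in> V'}) (\<lambda>y. ((f \<circ> F \<circ> inv_into U \<phi>) y, (g \<circ> G \<circ> inv_into U \<phi>) y))"
    by (intro smooth_on_Pair o smooth_on_subset[OF smooth_mapD[OF F e a]] smooth_on_subset[OF smooth_mapD[OF G e b]])
       (auto simp: V)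
  then show "smooth_on (\<phi> ` {x \<in> U. (F x, G x) \<in> V'}) (\<eta> \<circ> (\<lambda>x. (F x, G x)) \<circ> inv_into U \<phi>)"
    by (simp add: V o_def map_prod_def)
qed

lemma smooth_map_fst:
  assumes M: "charted M" and N: "charted N"
  shows "smooth_map (prod_mfd M N) M fst"
proof (rule smooth_mapI)
  show c: "continuous_map (mtop (prod_mfd M N)) (mtop M) fst"
    by (simp add: continuous_map_fst)
  fix W \<eta> U' \<phi>' assume w: "(W, \<eta>) \<in> atlas (prod_mfd M N)" and c': "(U', \<phi>') \<in> atlas M"
  then obtain U \<phi> V \<psi> where W: "W = U \<times> V" "\<eta> = map_prod \<phi> \<psi>"
    and c: "(U, \<phi>) \<in> atlas M" and d: "(V, \<psi>) \<in> atlas N" by (auto simp: prod_mfd_def)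
  have im: "\<eta> ` {x \<in> W. fst x \<in> U'} = \<phi> ` (U \<inter> U') \<times> \<psi> ` V"
    unfolding W by (force simp: map_prod_def image_iff)
  have o1: "open (\<phi> ` (U \<inter> U'))"
    using chart_open[OF M c] chart_openin[OF M c] chart_openin[OF M c'] by auto
  have o: "open (\<eta> ` {x \<in> W. fst x \<in> U'})"
    unfolding im by (intro open_Times o1 chart_open_image[OF N d])
  have "smooth_on (\<eta> ` {x \<in> W. fst x \<in> U'}) (\<lambda>y. (\<phi>' \<circ> inv_into U \<phi>) (fst y))"
    by (intro smooth_on_compose[OF o o1 _ chart_transition[OF M c c']] smooth_on_bounded_linear bounded_linear_fst o)
       (auto simp: im)
  then show "smooth_on (\<eta> ` {x \<in> W. fst x \<in> U'}) (\<phi>' \<circ> fst \<circ> inv_into W \<eta>)"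
    by (rule smooth_on_cong[OF o, rotated])
       (use chart_inv[OF M c] chart_inv[OF N d] inv_into_map_prod[OF chart_inj[OF M c] chart_inj[OF N d]] in \<open>auto simp: W\<close>)
qed

lemma smooth_map_snd:
  assumes M: "charted M" and N: "charted N"
  shows "smooth_map (prod_mfd M N) N snd"
proof (rule smooth_mapI)
  show c: "continuous_map (mtop (prod_mfd M N)) (mtop N) snd"
    by (simp add: continuous_map_snd)
  fix W \<eta> V' \<psi>' assume w: "(W, \<eta>) \<in> atlas (prod_mfd M N)" and d': "(V', \<psi>') \<in> atlas N"
  then obtain U \<phi> V \<psi> where W: "W = U \<times> V" "\<eta> = map_prod \<phi> \<psi>"
    and c: "(U, \<phi>) \<in> atlas M" and d: "(V, \<psi>) \<in> atlas N" by (auto simp: prod_mfd_def)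
  have im: "\<eta> ` {x \<in> W. snd x \<in> V'} = \<phi> ` U \<times> \<psi> ` (V \<inter> V')"
    unfolding W by (force simp: map_prod_def image_iff)
  have o1: "open (\<psi> ` (V \<inter> V'))"
    using chart_open[OF N d] chart_openin[OF N d] chart_openin[OF N d'] by auto
  have o: "open (\<eta> ` {x \<in> W. snd x \<in> V'})"
    unfolding im by (intro open_Times o1 chart_open_image[OF M c])
  have "smooth_on (\<eta> ` {x \<in> W. snd x \<in> V'}) (\<lambda>y. (\<psi>' \<circ> inv_into V \<psi>) (snd y))"
    by (intro smooth_on_compose[OF o o1 _ chart_transition[OF N d d']] smooth_on_bounded_linear bounded_linear_snd o)
       (auto simp: im)
  then show "smooth_on (\<eta> ` {x \<in> W. snd x \<in> V'}) (\<psi>' \<circ> snd \<circ> inv_into W \<eta>)"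
    by (rule smooth_on_cong[OF o, rotated])
       (use chart_inv[OF M c] chart_inv[OF N d] inv_into_map_prod[OF chart_inj[OF M c] chart_inj[OF N d]] in \<open>auto simp: W\<close>)
qed

lemma smooth_map_const:
  assumes "charted M" "charted N" "c \<in> points N"
  shows "smooth_map M N (\<lambda>x. c)"
  using assms(3) by (intro smooth_mapI) (auto simp: points_def o_def smooth_on_const)

lemma smooth_map_ident:
  assumes M: "charted M"
  shows "smooth_map M M (\<lambda>x. x)"
proof (rule smooth_mapI)
  fix U \<phi> V \<psi> assume c: "(U, \<phi>) \<in> atlas M" "(V, \<psi>) \<in> atlas M"
  have "{x \<in> U. x \<in> V} = U \<inter> V" by auto
  then show "smooth_on (\<phi> ` {x \<in> U. x \<in> V}) (\<psi> \<circ> (\<lambda>x. x) \<circ> inv_into U \<phi>)"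
    using chart_transition[OF M c] by (simp add: o_def)
qed simp

text \<open>Local sections exist over open sets \<open>W\<close> of the quotient, so smoothness of a
  flow is checked on strips \<open>UNIV \<times> W\<close>. This identifies such a strip with a
  product manifold.\<close>

lemma restrict_prod_Times:
  "restrict_mfd (prod_mfd euclid N) (UNIV \<times> W) = prod_mfd (euclid :: ('e::euclidean_space, 'e) mfd) (restrict_mfd N W)"
proof -
  have "atlas (restrict_mfd (prod_mfd (euclid :: ('e, 'e) mfd) N) (UNIV \<times> W)) = atlas (prod_mfd euclid (restrict_mfd N W))"
  proof -
    have "atlas (restrict_mfd (prod_mfd (euclid :: ('e, 'e) mfd) N) (UNIV \<times> W)) =
        {((UNIV \<times> V) \<inter> (UNIV \<times> W), map_prod id \<psi>) | V \<psi>. (V, \<psi>) \<in> atlas N}"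
      unfolding restrict_mfd_def prod_mfd_def euclid_def by auto
    also have "\<dots> = {(UNIV \<times> (V \<inter> W), map_prod id \<psi>) | V \<psi>. (V, \<psi>) \<in> atlas N}"
      by (simp add: Times_Int_Times)
    also have "\<dots> = atlas (prod_mfd (euclid :: ('e, 'e) mfd) (restrict_mfd N W))"
      unfolding restrict_mfd_def prod_mfd_def euclid_def by auto
    finally show ?thesis .
  qed
  moreover have "mtop (restrict_mfd (prod_mfd (euclid :: ('e, 'e) mfd) N) (UNIV \<times> W)) = mtop (prod_mfd euclid (restrict_mfd N W))"
    by (simp add: prod_topology_subtopology)
  ultimately show ?thesis by (simp add: restrict_mfd_def prod_mfd_def)
qed

section \<open>Smooth functions and tangent vectors\<close>

lemma smooth_map_euclidI:
  fixes M :: "('a, 'e::euclidean_space) mfd" and f :: "'a \<Rightarrow> 'f::euclidean_space"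
  assumes M: "charted M" and f: "\<And>U \<phi>. (U, \<phi>) \<in> atlas M \<Longrightarrow> smooth_on (\<phi> ` U) (\<lambda>y. f (inv_into U \<phi> y))"
  shows "smooth_map M euclid f"
proof (rule smooth_map_local[OF M charted_euclid])
  fix x assume "x \<in> points M"
  then obtain U \<phi> where c: "(U, \<phi>) \<in> atlas M" "x \<in> U" using chart_at[OF M] by blast
  note oU = chart_openin[OF M c(1)] and im = chart_open_image[OF M c(1)]
  have cU: "charted (restrict_mfd M U)" by (rule charted_restrict[OF M oU])
  have "smooth_map (restrict_mfd M U) (restrict_mfd euclid (\<phi> ` U)) \<phi>"
    by (rule smooth_map_into_restrict[OF cU smooth_map_chart[OF M c(1)]])
       (use im points_restrict[OF oU] in auto)
  moreover have "smooth_map (restrict_mfd euclid (\<phi> ` U)) euclid (\<lambda>y. f (inv_into U \<phi> y))"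
    using f[OF c(1)] smooth_map_euclid_iff[OF im] by blast
  ultimately have "smooth_map (restrict_mfd M U) euclid (\<lambda>x. f (inv_into U \<phi> (\<phi> x)))"
    using smooth_map_compose[OF cU _ charted_euclid] charted_restrict[OF charted_euclid, of "\<phi> ` U"] im by force
  then have "smooth_map (restrict_mfd M U) euclid f"
    by (rule smooth_map_cong[OF cU charted_euclid])
       (use points_restrict[OF oU] chart_inv[OF M c(1)] in auto)
  then show "\<exists>W. openin (mtop M) W \<and> x \<in> W \<and> smooth_map (restrict_mfd M W) euclid f"
    using oU c(2) by blast
qed

lemma smooth_map_euclidD:
  assumes M: "charted M" and f: "smooth_map M euclid f" and c: "(U, \<phi>) \<in> atlas M"
  shows "smooth_on (\<phi> ` U) (\<lambda>y. f (inv_into U \<phi> y))"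
proof -
  have im: "open (\<phi> ` U)" by (rule chart_open_image[OF M c])
  have "smooth_map (restrict_mfd euclid (\<phi> ` U)) euclid (\<lambda>y. f (inv_into U \<phi> y))"
    by (rule smooth_map_compose[OF _ M charted_euclid smooth_map_chart_inv[OF M c] f])
       (use charted_restrict[OF charted_euclid] im in auto)
  then show ?thesis using smooth_map_euclid_iff[OF im] by blast
qed

lemma restrict_restrict: "restrict_mfd (restrict_mfd M U) W = restrict_mfd M (U \<inter> W)"
proof -
  have "atlas (restrict_mfd (restrict_mfd M U) W) = atlas (restrict_mfd M (U \<inter> W))"
  proof -
    have "atlas (restrict_mfd N V) = (\<lambda>(A, \<phi>). (A \<inter> V, \<phi>)) ` atlas N" for N :: "('a, 'b) mfd" and V
      by (auto simp: restrict_mfd_def image_iff)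
    then show ?thesis by (simp add: image_image split_beta Int_assoc)
  qed
  then show ?thesis by (simp add: restrict_mfd_def subtopology_subtopology)
qed

lemma smooth_map_restrict_subset:
  assumes "charted M" "charted N" "openin (mtop M) U" "openin (mtop M) W" "W \<subseteq> U"
    and "smooth_map (restrict_mfd M U) N F"
  shows "smooth_map (restrict_mfd M W) N F"
  using smooth_map_restrict[OF charted_restrict[OF assms(1,3)] assms(2) _ assms(6), of W] assms(3,4,5)
  by (simp add: restrict_restrict openin_open_subtopology inf.absorb2)

text \<open>Sums and products of smooth functions are obtained by composing a pair with addition or
  multiplication, without returning to charts.\<close>

lemma smooth_map_euclid2:
  fixes f :: "'a \<Rightarrow> 'b::euclidean_space" and g :: "'a \<Rightarrow> 'c::euclidean_space" and h :: "'b \<times> 'c \<Rightarrow> 'd::euclidean_space"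
  assumes M: "charted M" and f: "smooth_map M euclid f" and g: "smooth_map M euclid g" and h: "smooth_on UNIV h"
  shows "smooth_map M euclid (\<lambda>x. h (f x, g x))"
proof -
  have "smooth_map M euclid (\<lambda>x. (f x, g x))"
    using smooth_map_Pair[OF M charted_euclid charted_euclid f g] by (simp add: prod_euclid)
  then show ?thesis
    using smooth_map_compose[OF M charted_euclid charted_euclid] h smooth_map_euclid_UNIV_iff by blast
qed

section \<open>The algebra of smooth functions and its derivations\<close>

lemma C_inf_iff: "f \<in> C_inf M \<longleftrightarrow> smooth_map M euclid f"
  by (simp add: C_inf_def)

context
  fixes M :: "('a, 'e::euclidean_space) mfd"
  assumes M: "charted M"
begin

lemma C_inf_const: "(\<lambda>_. c) \<in> C_inf M"
  unfolding C_inf_iff by (rule smooth_map_const[OF M charted_euclid]) simp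

lemma C_inf_add: "f \<in> C_inf M \<Longrightarrow> g \<in> C_inf M \<Longrightarrow> (\<lambda>x. f x + g x) \<in> C_inf M"
  unfolding C_inf_iff
  using smooth_map_euclid2[OF M, of f g "\<lambda>z. fst z + snd z"]
  by (simp add: smooth_on_bounded_linear bounded_linear_add bounded_linear_fst bounded_linear_snd)

lemma C_inf_mult: "f \<in> C_inf M \<Longrightarrow> g \<in> C_inf M \<Longrightarrow> (\<lambda>x. f x * g x) \<in> C_inf M"
  unfolding C_inf_iff
  using smooth_map_euclid2[OF M, of f g "\<lambda>z. fst z * snd z"]
  by (simp add: smooth_on_mult smooth_on_bounded_linear bounded_linear_fst bounded_linear_snd)

lemma C_inf_cmult: "f \<in> C_inf M \<Longrightarrow> (\<lambda>x. c * f x) \<in> C_inf M"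
  by (intro C_inf_mult C_inf_const)

lemma C_inf_lincomb: "f \<in> C_inf M \<Longrightarrow> g \<in> C_inf M \<Longrightarrow> (\<lambda>x. a * f x + b * g x) \<in> C_inf M"
  by (intro C_inf_add C_inf_cmult)

lemma C_inf_sum: "(\<And>i. i \<in> I \<Longrightarrow> f i \<in> C_inf M) \<Longrightarrow> (\<lambda>x. \<Sum>i\<in>I. f i x) \<in> C_inf M"
  by (induction I rule: infinite_finite_induct) (auto intro: C_inf_const C_inf_add)

lemma C_inf_cong: "f \<in> C_inf M \<Longrightarrow> (\<And>x. x \<in> points M \<Longrightarrow> f x = g x) \<Longrightarrow> g \<in> C_inf M"
  unfolding C_inf_iff by (rule smooth_map_cong[OF M charted_euclid])

lemma C_inf_compose:
  "charted N \<Longrightarrow> smooth_map M N F \<Longrightarrow> f \<in> C_inf N \<Longrightarrow> (\<lambda>x. f (F x)) \<in> C_inf M"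
  unfolding C_inf_iff using smooth_map_compose[OF M _ charted_euclid] by blast

lemma tangent_lincomb:
  "v \<in> tangent_space M x \<Longrightarrow> f \<in> C_inf M \<Longrightarrow> g \<in> C_inf M \<Longrightarrow> v (\<lambda>y. a * f y + b * g y) = a * v f + b * v g"
  unfolding tangent_space_def by blast

lemma tangent_mult:
  "v \<in> tangent_space M x \<Longrightarrow> f \<in> C_inf M \<Longrightarrow> g \<in> C_inf M \<Longrightarrow> v (\<lambda>y. f y * g y) = f x * v g + g x * v f"
  unfolding tangent_space_def by blast

lemma tangent_not_smooth: "v \<in> tangent_space M x \<Longrightarrow> f \<notin> C_inf M \<Longrightarrow> v f = 0"
  unfolding tangent_space_def by blast

lemma tangentI:
  assumes "\<And>f g a b. f \<in> C_inf M \<Longrightarrow> g \<in> C_inf M \<Longrightarrow> v (\<lambda>y. a * f y + b * g y) = a * v f + b * v g"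
    and "\<And>f g. f \<in> C_inf M \<Longrightarrow> g \<in> C_inf M \<Longrightarrow> v (\<lambda>y. f y * g y) = f x * v g + g x * v f"
    and "\<And>f. f \<notin> C_inf M \<Longrightarrow> v f = 0"
  shows "v \<in> tangent_space M x"
  using assms unfolding tangent_space_def by blast

lemma tangent_add: "v \<in> tangent_space M x \<Longrightarrow> f \<in> C_inf M \<Longrightarrow> g \<in> C_inf M \<Longrightarrow> v (\<lambda>y. f y + g y) = v f + v g"
  using tangent_lincomb[of v x f g 1 1] by simp

lemma tangent_cmult: "v \<in> tangent_space M x \<Longrightarrow> f \<in> C_inf M \<Longrightarrow> v (\<lambda>y. c * f y) = c * v f"
  using tangent_lincomb[of v x f f c 0] by simp

lemma tangent_const: "v \<in> tangent_space M x \<Longrightarrow> v (\<lambda>_. c) = 0"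
  using tangent_mult[of v x "\<lambda>_. 1" "\<lambda>_. 1"] tangent_cmult[of v x "\<lambda>_. 1" c] C_inf_const by simp

lemma tangent_sum:
  assumes v: "v \<in> tangent_space M x" and f: "\<And>i. i \<in> I \<Longrightarrow> f i \<in> C_inf M"
  shows "v (\<lambda>y. \<Sum>i\<in>I. f i y) = (\<Sum>i\<in>I. v (f i))"
  using f
proof (induction I rule: infinite_finite_induct)
  case (insert i I)
  then show ?case
    using tangent_add[OF v, of "f i" "\<lambda>y. \<Sum>i\<in>I. f i y"] by (simp add: C_inf_sum)
qed (simp_all add: tangent_const[OF v])

text \<open>The indicator \<open>k\<close> of the complement of the points is smooth, as it agrees
  with 0 on the points, and idempotent, so Leibniz gives \<open>v k = 0\<close>. The difference
  \<open>h\<close> of the two functions satisfies \<open>h = h * k\<close>, and a second use of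
  Leibniz gives \<open>v h = 0\<close>.\<close>

lemma tangent_cong:
  assumes v: "v \<in> tangent_space M x" and x: "x \<in> points M"
    and eq: "\<And>y. y \<in> points M \<Longrightarrow> f y = g y"
  shows "v f = v g"
proof (cases "f \<in> C_inf M")
  case True
  then have g: "g \<in> C_inf M" using C_inf_cong eq by blast
  define k :: "'a \<Rightarrow> real" where "k y = (if y \<in> points M then 0 else 1)" for y
  define h where "h y = 1 * f y + (-1) * g y" for y
  have k: "k \<in> C_inf M" by (rule C_inf_cong[OF C_inf_const[of 0]]) (simp add: k_def)
  have h: "h \<in> C_inf M" unfolding h_def using C_inf_lincomb[OF True g] .
  have "(\<lambda>y. k y * k y) = k" by (auto simp: k_def)
  with tangent_mult[OF v k k] x have vk: "v k = 0" by (simp add: k_def)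
  have "(\<lambda>y. h y * k y) = h" using eq by (auto simp: k_def h_def)
  with tangent_mult[OF v h k] vk x have "v h = 0" by (simp add: k_def)
  moreover have "v h = v f - v g"
    unfolding h_def using tangent_lincomb[OF v True g, of 1 "-1"] by simp
  ultimately show ?thesis by simp
next
  case False
  then have "g \<notin> C_inf M" using C_inf_cong eq by (metis (full_types))
  then show ?thesis using False v tangent_not_smooth by metis
qed

lemma tangent_subspace: "tv.subspace (tangent_space M x)"
  unfolding tv.subspace_def
  by (auto intro!: tangentI simp: tscale_def tangent_lincomb tangent_mult tangent_not_smooth algebra_simps)

end

section \<open>Differentials of smooth maps and cutoff functions\<close>

lemma push_apply: "f \<in> C_inf N \<Longrightarrow> push N F v f = v (\<lambda>x. f (F x))"
  by (simp add: push_def o_def)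

lemma push_not_smooth: "f \<notin> C_inf N \<Longrightarrow> push N F v f = 0"
  by (simp add: push_def)

lemma push_tangent:
  assumes M: "charted M" and N: "charted N" and F: "smooth_map M N F" and v: "v \<in> tangent_space M x"
  shows "push N F v \<in> tangent_space N (F x)"
proof (rule tangentI[OF N])
  note cf = C_inf_compose[OF M N F]
  show "push N F v (\<lambda>y. a * f y + b * g y) = a * push N F v f + b * push N F v g"
    if "f \<in> C_inf N" "g \<in> C_inf N" for f g a b
    using that by (simp add: push_apply C_inf_lincomb[OF N] tangent_lincomb[OF M v] cf)
  show "push N F v (\<lambda>y. f y * g y) = f (F x) * push N F v g + g (F x) * push N F v f"
    if "f \<in> C_inf N" "g \<in> C_inf N" for f g
    using that by (simp add: push_apply C_inf_mult[OF N] tangent_mult[OF M v] cf)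
qed (simp add: push_not_smooth)

text \<open>Functions cut off by \<open>\<eta>\<close> extend smoothly by \<open>0\<close>: the support of \<open>\<eta>\<close> is compact, hence
  closed because the manifold is Hausdorff.\<close>

lemma cutoff_extension:
  fixes M :: "('a, 'e::euclidean_space) mfd"
  assumes MM: "manifold M" and c: "(U, \<phi>) \<in> atlas M" and x: "x \<in> U"
    and V: "open V" "\<phi> x \<in> V" "V \<subseteq> \<phi> ` U"
  obtains \<eta> where "\<eta> \<in> C_inf M" "\<eta> x = 1" "\<And>y. \<eta> y \<noteq> 0 \<Longrightarrow> y \<in> U \<and> \<phi> y \<in> V"
    "\<And>u. smooth_on V u \<Longrightarrow> (\<lambda>y. \<eta> y * (if y \<in> U \<and> \<phi> y \<in> V then u (\<phi> y) else 0)) \<in> C_inf M"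
proof -
  have M: "charted M" by (rule manifold_charted[OF MM])
  obtain r where r: "r > 0" "cball (\<phi> x) r \<subseteq> V"
    using V open_contains_cball by blast
  obtain \<rho> :: "'e \<Rightarrow> real" where \<rho>: "smooth_on UNIV \<rho>" "\<rho> (\<phi> x) = 1" "\<And>y. y \<notin> cball (\<phi> x) r \<Longrightarrow> \<rho> y = 0"
    using smooth_bump_exists[OF r(1)] by blast
  define K where "K = inv_into U \<phi> ` cball (\<phi> x) r"
  have sub: "cball (\<phi> x) r \<subseteq> \<phi> ` U" using r V by blast
  have "compactin (top_of_set (\<phi> ` U)) (cball (\<phi> x) r)"
    using sub by (simp add: compactin_subtopology)
  then have "compactin (mtop M) K"
    unfolding K_def by (rule image_compactin) (rule chart_inv_continuous[OF M c])
  moreover have "Hausdorff_space (mtop M)" using MM unfolding manifold_def by (elim conjE)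
  ultimately have K: "closedin (mtop M) K" by (intro compactin_imp_closedin)
  have memK: "y \<in> K" if "y \<in> U" "\<phi> y \<in> cball (\<phi> x) r" for y
    unfolding K_def using that chart_inv[OF M c that(1)] by force
  define W where "W = {y \<in> U. \<phi> y \<in> V}"
  have W: "openin (mtop M) W" unfolding W_def by (rule chart_open_vimage[OF M c V(1)])
  have KW: "K \<subseteq> W"
  proof
    fix k assume "k \<in> K"
    then obtain w where w: "w \<in> cball (\<phi> x) r" "k = inv_into U \<phi> w" unfolding K_def by blast
    then have "w \<in> \<phi> ` U" "w \<in> V" using sub r(2) by auto
    then show "k \<in> W" using chart_inv_mem[OF M c] f_inv_into_f[of w \<phi> U] by (simp add: W_def w(2))
  qed
  define e where "e u y = (if y \<in> U \<and> \<phi> y \<in> V then \<rho> (\<phi> y) * u (\<phi> y) else 0)" for u and y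
  have e: "e u \<in> C_inf M" if u: "smooth_on V u" for u
    unfolding C_inf_iff
  proof (rule smooth_map_local[OF M charted_euclid])
    fix z assume z: "z \<in> points M"
    show "\<exists>W. openin (mtop M) W \<and> z \<in> W \<and> smooth_map (restrict_mfd M W) euclid (e u)"
    proof (cases "z \<in> W")
      case True
      have cW: "charted (restrict_mfd M W)" by (rule charted_restrict[OF M W])
      have "smooth_map (restrict_mfd M W) euclid \<phi>"
        by (rule smooth_map_restrict_subset[OF M charted_euclid chart_openin[OF M c] W _ smooth_map_chart[OF M c]])
           (auto simp: W_def)
      then have 1: "smooth_map (restrict_mfd M W) (restrict_mfd euclid V) \<phi>"
        by (rule smooth_map_into_restrict[OF cW])
           (use V(1) points_restrict[OF W] in \<open>auto simp: W_def\<close>)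
      have "smooth_on V (\<lambda>y. \<rho> y * u y)"
        by (intro smooth_on_mult u V(1) smooth_on_subset[OF \<rho>(1)]) simp
      then have 2: "smooth_map (restrict_mfd euclid V) euclid (\<lambda>y. \<rho> y * u y)"
        using smooth_map_euclid_iff[OF V(1)] by blast
      have "charted (restrict_mfd euclid V)"
        using charted_restrict[OF charted_euclid] V(1) by simp
      from smooth_map_compose[OF cW this charted_euclid 1 2]
      have "smooth_map (restrict_mfd M W) euclid (e u)"
        by (rule smooth_map_cong[OF cW charted_euclid])
           (use points_restrict[OF W] in \<open>auto simp: e_def W_def\<close>)
      then show ?thesis using W True by blast
    next
      case False
      \<comment> \<open>Off \<open>K\<close> the bump vanishes and the extension is 0. Since
        \<open>K \<subseteq> W\<close>, the set \<open>W\<close> and the complement of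
        \<open>K\<close> cover the manifold.\<close>
      have o: "openin (mtop M) (points M - K)" unfolding points_def by (rule openin_diff[OF openin_topspace K])
      have co: "charted (restrict_mfd M (points M - K))" by (rule charted_restrict[OF M o])
      have "smooth_map (restrict_mfd M (points M - K)) euclid (\<lambda>_. 0 :: real)"
        by (rule smooth_map_const[OF co charted_euclid]) simp
      then have "smooth_map (restrict_mfd M (points M - K)) euclid (e u)"
        by (rule smooth_map_cong[OF co charted_euclid])
           (use points_restrict[OF o] memK \<rho>(3) in \<open>auto simp: e_def\<close>)
      then show ?thesis using o z False KW by blast
    qed
  qed
  show ?thesis
  proof (rule that[of "e (\<lambda>_. 1)"])
    show "e (\<lambda>_. 1) \<in> C_inf M" by (rule e) (rule smooth_on_const)
    show "e (\<lambda>_. 1) x = 1" using x V(2) \<rho>(2) by (simp add: e_def)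
    show "y \<in> U \<and> \<phi> y \<in> V" if "e (\<lambda>_. 1) y \<noteq> 0" for y
      using that by (auto simp: e_def split: if_splits)
    show "(\<lambda>y. e (\<lambda>_. 1) y * (if y \<in> U \<and> \<phi> y \<in> V then u (\<phi> y) else 0)) \<in> C_inf M" if "smooth_on V u" for u
      using e[OF that] by (rule C_inf_cong[OF M]) (simp add: e_def)
  qed
qed

text \<open>A cutoff that is 1 at \<open>x\<close> and supported in a chart with \<open>y\<close>
  removed distinguishes the points; the chart stays open after the removal because points are closed
  in a Hausdorff space.\<close>

lemma C_inf_separates:
  assumes MM: "manifold M" and x: "x \<in> points M" and y: "y \<in> points M"
    and eq: "\<And>f. f \<in> C_inf M \<Longrightarrow> f x = f y"
  shows "x = y"
proof (rule ccontr)
  assume ne: "x \<noteq> y"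
  have M: "charted M" by (rule manifold_charted[OF MM])
  obtain U \<phi> where c: "(U, \<phi>) \<in> atlas M" "x \<in> U" using chart_at[OF M x] by blast
  have "closedin (mtop M) {y}"
    using MM y unfolding manifold_def points_def by (metis closedin_Hausdorff_sing_eq)
  then have o: "openin (mtop M) (U - {y})"
    using chart_openin[OF M c(1)] openin_diff by blast
  have oV: "open (\<phi> ` (U - {y}))" by (rule chart_open[OF M c(1) o]) auto
  obtain \<eta> where e: "\<eta> \<in> C_inf M" "\<eta> x = 1" "\<And>z. \<eta> z \<noteq> 0 \<Longrightarrow> z \<in> U \<and> \<phi> z \<in> \<phi> ` (U - {y})"
    by (rule cutoff_extension[OF MM c oV]) (use c(2) ne in auto)
  have "y \<in> U" "\<phi> y \<in> \<phi> ` (U - {y})" using e(3)[of y] eq[OF e(1)] e(2) by auto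
  then show False using chart_inj[OF M c(1)] by (auto simp: inj_on_def)
qed

text \<open>The image of the direction \<open>a\<close> at \<open>z\<close> under the differential
  of a parametrisation \<open>c\<close>. The parametrisation need not be an inverse chart: curves
  and inverse charts followed by a section also occur. The value 0 off the smooth functions follows
  the convention of \<open>tangent_space\<close>.\<close>

definition plot_vec :: "('a, 'e::euclidean_space) mfd \<Rightarrow> ('v::real_normed_vector \<Rightarrow> 'a) \<Rightarrow> 'v \<Rightarrow> 'v \<Rightarrow> 'a tvec" where
  "plot_vec M c z a = (\<lambda>f. if f \<in> C_inf M then frechet_derivative (\<lambda>y. f (c y)) (at z) a else 0)"

lemma plot_smooth:
  assumes "charted M" "open S" "smooth_map (restrict_mfd euclid S) M c" "f \<in> C_inf M"
  shows "smooth_on S (\<lambda>y. f (c y))"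
proof -
  have "charted (restrict_mfd euclid S)" using charted_restrict[OF charted_euclid] assms(2) by simp
  from smooth_map_compose[OF this assms(1) charted_euclid assms(3)] assms(4)
  show ?thesis using smooth_map_euclid_iff[OF assms(2)] unfolding C_inf_iff by blast
qed

lemma plot_vec_tangent:
  assumes M: "charted M" and S: "open S" "z \<in> S" and c: "smooth_map (restrict_mfd euclid S) M c"
  shows "plot_vec M c z a \<in> tangent_space M (c z)"
proof (rule tangentI[OF M])
  note d = smooth_on_has_derivative[OF plot_smooth[OF M S(1) c] S(2)]
  show "plot_vec M c z a (\<lambda>y. r * f y + s * g y) = r * plot_vec M c z a f + s * plot_vec M c z a g"
    if "f \<in> C_inf M" "g \<in> C_inf M" for f g r s
  proof -
    have "((\<lambda>y. r * f (c y) + s * g (c y)) has_derivative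
      (\<lambda>v. r * frechet_derivative (\<lambda>y. f (c y)) (at z) v + s * frechet_derivative (\<lambda>y. g (c y)) (at z) v)) (at z)"
      by (intro has_derivative_add has_derivative_mult_right d that)
    from frechet_derivative_at[OF this, symmetric] show ?thesis
      using that C_inf_lincomb[OF M that] by (simp add: plot_vec_def)
  qed
  show "plot_vec M c z a (\<lambda>y. f y * g y) = f (c z) * plot_vec M c z a g + g (c z) * plot_vec M c z a f"
    if "f \<in> C_inf M" "g \<in> C_inf M" for f g
  proof -
    have "((\<lambda>y. f (c y) * g (c y)) has_derivative
      (\<lambda>v. f (c z) * frechet_derivative (\<lambda>y. g (c y)) (at z) v + frechet_derivative (\<lambda>y. f (c y)) (at z) v * g (c z))) (at z)"
      by (intro has_derivative_mult d that)
    from frechet_derivative_at[OF this, symmetric] show ?thesis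
      using that C_inf_mult[OF M that] by (simp add: plot_vec_def)
  qed
qed (simp add: plot_vec_def)

text \<open>By Hadamard's lemma \<open>f\<close> differs from \<open>f x\<close> near
  \<open>x\<close> by a sum of products of centred coordinates with smooth functions. Leibniz leaves
  of each product only \<open>v\<close> of the coordinate times a partial derivative of
  \<open>f\<close>, so the components of \<open>a\<close> are the values of \<open>v\<close> on the
  cut off coordinates \<open>co i\<close>.\<close>

lemma tangent_eq_plot_vec:
  fixes M :: "('a, 'e::euclidean_space) mfd"
  assumes MM: "manifold M" and v: "v \<in> tangent_space M x" and c: "(U, \<phi>) \<in> atlas M" "x \<in> U"
  obtains a where "v = plot_vec M (inv_into U \<phi>) (\<phi> x) a"
proof -
  have M: "charted M" by (rule manifold_charted[OF MM])
  let ?p = "\<phi> x"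
  obtain r where r: "r > 0" "ball ?p r \<subseteq> \<phi> ` U"
    using chart_open_image[OF M c(1)] c(2) open_contains_ball by blast
  let ?V = "ball ?p r"
  obtain \<eta> where e: "\<eta> \<in> C_inf M" "\<eta> x = 1" "\<And>y. \<eta> y \<noteq> 0 \<Longrightarrow> y \<in> U \<and> \<phi> y \<in> ?V"
    "\<And>u. smooth_on ?V u \<Longrightarrow> (\<lambda>y. \<eta> y * (if y \<in> U \<and> \<phi> y \<in> ?V then u (\<phi> y) else 0)) \<in> C_inf M"
    by (rule cutoff_extension[OF MM c open_ball _ r(2)]) (use r(1) in auto)
  define ext where "ext u y = \<eta> y * (if y \<in> U \<and> \<phi> y \<in> ?V then u (\<phi> y) else 0)" for u :: "'e \<Rightarrow> real" and y
  have ext: "ext u \<in> C_inf M" if "smooth_on ?V u" for u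
    unfolding ext_def using e(4)[OF that] .
  define co where "co i = ext (\<lambda>y. (y - ?p) \<bullet> i)" for i
  have co: "co i \<in> C_inf M" for i
  proof -
    have "smooth_on ?V (\<lambda>y. (y + (- ?p)) \<bullet> i)"
      by (intro smooth_on_inner smooth_on_add smooth_on_const smooth_on_bounded_linear bounded_linear_ident open_ball)
    then show ?thesis unfolding co_def by (intro ext) simp
  qed
  define a where "a = (\<Sum>i\<in>Basis. v (co i) *\<^sub>R i)"
  have "v f = plot_vec M (inv_into U \<phi>) ?p a f" for f
  proof (cases "f \<in> C_inf M")
    case True
    define u where "u = (\<lambda>y. f (inv_into U \<phi> y))"
    have usm: "smooth_on (\<phi> ` U) u"
      using smooth_map_euclidD[OF M _ c(1)] True unfolding u_def C_inf_iff by blast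
    then have u: "smooth_on ?V u" using r(2) smooth_on_subset by blast
    obtain g where g: "\<And>i. smooth_on ?V (g i)" "\<And>i. g i ?p = frechet_derivative u (at ?p) i"
      "\<And>y. y \<in> ?V \<Longrightarrow> u y = u ?p + (\<Sum>i\<in>Basis. ((y - ?p) \<bullet> i) * g i y)"
      using hadamard[OF open_ball convex_ball _ u] r(1) by (metis centre_in_ball)
    have fx: "u ?p = f x" using chart_inv[OF M c(1) c(2)] by (simp add: u_def)
    have G: "ext (g i) \<in> C_inf M" for i by (rule ext[OF g(1)])
    have ee: "(\<lambda>y. \<eta> y * \<eta> y) \<in> C_inf M" by (intro C_inf_mult M e(1))
    \<comment> \<open>The cutoff enters squared so that each summand is a product of two globally
      smooth functions, one \<open>\<eta>\<close> for the coordinate and one for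
      \<open>g i\<close>.\<close>
    have "(\<eta> y * \<eta> y) * f y = f x * (\<eta> y * \<eta> y) + (\<Sum>i\<in>Basis. co i y * ext (g i) y)" for y
    proof (cases "\<eta> y = 0")
      case False
      then have y: "y \<in> U" "\<phi> y \<in> ?V" using e(3) by auto
      have "f y = u (\<phi> y)" using chart_inv[OF M c(1) y(1)] by (simp add: u_def)
      also have "\<dots> = f x + (\<Sum>i\<in>Basis. ((\<phi> y - ?p) \<bullet> i) * g i (\<phi> y))"
        using g(3)[OF y(2)] fx by simp
      finally show ?thesis
        using y by (simp add: co_def ext_def sum_distrib_left algebra_simps)
    qed (simp add: co_def ext_def)
    then have "v (\<lambda>y. (\<eta> y * \<eta> y) * f y) = v (\<lambda>y. f x * (\<eta> y * \<eta> y) + (\<Sum>i\<in>Basis. co i y * ext (g i) y))"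
      by presburger
    also have "\<dots> = v (\<lambda>y. f x * (\<eta> y * \<eta> y)) + v (\<lambda>y. \<Sum>i\<in>Basis. co i y * ext (g i) y)"
      by (intro tangent_add[OF M v] C_inf_cmult C_inf_sum C_inf_mult M ee co G)
    also have "v (\<lambda>y. \<Sum>i\<in>Basis. co i y * ext (g i) y) = (\<Sum>i\<in>Basis. v (\<lambda>y. co i y * ext (g i) y))"
      by (intro tangent_sum[OF M v] C_inf_mult M co G)
    also have "v (\<lambda>y. f x * (\<eta> y * \<eta> y)) = f x * v (\<lambda>y. \<eta> y * \<eta> y)"
      by (rule tangent_cmult[OF M v ee])
    also have "v (\<lambda>y. (\<eta> y * \<eta> y) * f y) = \<eta> x * \<eta> x * v f + f x * v (\<lambda>y. \<eta> y * \<eta> y)"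
      by (rule tangent_mult[OF M v ee True])
    finally have "v f = (\<Sum>i\<in>Basis. v (\<lambda>y. co i y * ext (g i) y))" using e(2) by simp
    also have "\<dots> = (\<Sum>i\<in>Basis. v (co i) * frechet_derivative u (at ?p) i)"
    proof (rule sum.cong[OF refl])
      fix i :: 'e
      show "v (\<lambda>y. co i y * ext (g i) y) = v (co i) * frechet_derivative u (at ?p) i"
        using tangent_mult[OF M v co G, of i i] c(2) r(1) e(2) g(2)[of i] by (simp add: co_def ext_def)
    qed
    also have "\<dots> = frechet_derivative u (at ?p) a"
    proof -
      have "linear (frechet_derivative u (at ?p))"
        using smooth_on_has_derivative[OF u] r(1) has_derivative_linear by force
      then show ?thesis unfolding a_def by (simp add: linear_sum linear_scale)
    qed
    finally show ?thesis using True by (simp add: plot_vec_def u_def)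
  next
    case False
    then show ?thesis using tangent_not_smooth[OF M v] by (simp add: plot_vec_def)
  qed
  then show ?thesis using that by blast
qed

subsection \<open>Functions of two variables\<close>

lemma partial_derivatives:
  fixes K :: "'a::real_normed_vector \<times> 'b::real_normed_vector \<Rightarrow> real"
  assumes K: "smooth_on S K" and z: "(s, q) \<in> S"
  shows "((\<lambda>b. K (s, b)) has_derivative (\<lambda>b. frechet_derivative K (at (s, q)) (0, b))) (at q)"
    and "((\<lambda>a. K (a, q)) has_derivative (\<lambda>a. frechet_derivative K (at (s, q)) (a, 0))) (at s)"
    and "frechet_derivative (\<lambda>b. K (s, b)) (at q) b = frechet_derivative K (at (s, q)) (0, b)"
    and "frechet_derivative (\<lambda>a. K (a, q)) (at s) a = frechet_derivative K (at (s, q)) (a, 0)"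
proof -
  note d = smooth_on_has_derivative[OF K z]
  have "((\<lambda>b. (s, b)) has_derivative (\<lambda>b. (0, b))) (at q)" by (auto intro!: derivative_eq_intros)
  from has_derivative_compose[OF this d]
  show 1: "((\<lambda>b. K (s, b)) has_derivative (\<lambda>b. frechet_derivative K (at (s, q)) (0, b))) (at q)" .
  have "((\<lambda>a. (a, q)) has_derivative (\<lambda>a. (a, 0))) (at s)" by (auto intro!: derivative_eq_intros)
  from has_derivative_compose[OF this d]
  show 2: "((\<lambda>a. K (a, q)) has_derivative (\<lambda>a. frechet_derivative K (at (s, q)) (a, 0))) (at s)" .
  show "frechet_derivative (\<lambda>b. K (s, b)) (at q) b = frechet_derivative K (at (s, q)) (0, b)"
    using fun_cong[OF frechet_derivative_at[OF 1]] by simp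
  show "frechet_derivative (\<lambda>a. K (a, q)) (at s) a = frechet_derivative K (at (s, q)) (a, 0)"
    using fun_cong[OF frechet_derivative_at[OF 2]] by simp
qed

lemma smooth_on_prod_charts:
  assumes M: "charted M" and N: "charted N" and F: "smooth_map (prod_mfd M N) euclid F"
    and c: "(U, \<phi>) \<in> atlas M" and d: "(V, \<psi>) \<in> atlas N"
  shows "smooth_on (\<phi> ` U \<times> \<psi> ` V) (\<lambda>z. F (inv_into U \<phi> (fst z), inv_into V \<psi> (snd z)))"
proof -
  have im: "map_prod \<phi> \<psi> ` (U \<times> V) = \<phi> ` U \<times> \<psi> ` V" by (auto simp: map_prod_def)
  have "(U \<times> V, map_prod \<phi> \<psi>) \<in> atlas (prod_mfd M N)" using c d by (auto simp: prod_mfd_def)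
  from smooth_map_euclidD[OF charted_prod[OF M N] F this]
  have "smooth_on (\<phi> ` U \<times> \<psi> ` V) (\<lambda>y. F (inv_into (U \<times> V) (map_prod \<phi> \<psi>) y))" by (simp add: im)
  then show ?thesis
    by (rule smooth_on_cong[rotated 2])
       (use open_Times[OF chart_open_image[OF M c] chart_open_image[OF N d]] chart_inv[OF M c] chart_inv[OF N d]
          inv_into_map_prod[OF chart_inj[OF M c] chart_inj[OF N d]] in auto)
qed

lemma C_inf_slice:
  assumes M: "charted M" and N: "charted N" and F: "smooth_map (prod_mfd M N) euclid F"
  shows "x \<in> points M \<Longrightarrow> (\<lambda>h. F (x, h)) \<in> C_inf N"
    and "y \<in> points N \<Longrightarrow> (\<lambda>h. F (h, y)) \<in> C_inf M"
  unfolding C_inf_iff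
  by (intro smooth_map_compose[OF _ charted_prod[OF M N] charted_euclid _ F] smooth_map_Pair
      smooth_map_const smooth_map_ident M N; assumption)+

text \<open>In charts \<open>v\<close> is the derivative in a fixed direction \<open>(0, a)\<close>
  of a jointly smooth function, and such a derivative stays smooth in the first variable.\<close>

lemma C_inf_tangent_param:
  fixes M :: "('a, 'e::euclidean_space) mfd" and N :: "('b, 'f::euclidean_space) mfd"
  assumes M: "charted M" and NN: "manifold N" and F: "smooth_map (prod_mfd M N) euclid F"
    and v: "v \<in> tangent_space N y" and y: "y \<in> points N"
  shows "(\<lambda>x. v (\<lambda>h. F (x, h))) \<in> C_inf M"
  unfolding C_inf_iff
proof (rule smooth_map_euclidI[OF M])
  have N: "charted N" by (rule manifold_charted[OF NN])
  fix U \<phi> assume c: "(U, \<phi>) \<in> atlas M"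
  obtain V \<psi> where d: "(V, \<psi>) \<in> atlas N" "y \<in> V" using chart_at[OF N y] by blast
  obtain a where a: "v = plot_vec N (inv_into V \<psi>) (\<psi> y) a"
    using tangent_eq_plot_vec[OF NN v d] by blast
  let ?K = "\<lambda>z. F (inv_into U \<phi> (fst z), inv_into V \<psi> (snd z))"
  have K: "smooth_on (\<phi> ` U \<times> \<psi> ` V) ?K"
    by (rule smooth_on_prod_charts[OF M N F c d(1)])
  note oU = chart_open_image[OF M c] and oV = chart_open_image[OF N d(1)]
  have "smooth_on (\<phi> ` U) (\<lambda>s. frechet_derivative ?K (at (s, \<psi> y)) (0, a))"
    by (rule smooth_on_compose[OF oU open_Times[OF oU oV] _ smooth_on_frechet_derivative[OF K]])
       (use d smooth_on_Pair[OF oU smooth_on_bounded_linear[OF bounded_linear_ident oU] smooth_on_const] in auto)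
  then show "smooth_on (\<phi> ` U) (\<lambda>s. v (\<lambda>h. F (inv_into U \<phi> s, h)))"
  proof (rule smooth_on_cong[OF oU, rotated])
    fix s assume s: "s \<in> \<phi> ` U"
    then have "inv_into U \<phi> s \<in> points M" using chart_inv_mem[OF M c] chart_subset[OF M c] by blast
    then have "(\<lambda>h. F (inv_into U \<phi> s, h)) \<in> C_inf N" by (rule C_inf_slice[OF M N F])
    then show "frechet_derivative ?K (at (s, \<psi> y)) (0, a) = v (\<lambda>h. F (inv_into U \<phi> s, h))"
      using partial_derivatives(3)[OF K, of s "\<psi> y" a] s d(2) by (simp add: a plot_vec_def)
  qed
qed

text \<open>In a chart \<open>v\<close> differentiates in the direction \<open>(0, a)\<close> and
  the time derivative in the direction \<open>(1, 0)\<close>, so this is the symmetry of mixed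
  partial derivatives.\<close>

lemma tangent_DERIV_commute:
  fixes N :: "('b, 'f::euclidean_space) mfd"
  assumes NN: "manifold N" and F: "smooth_map (prod_mfd euclid N) euclid F"
    and v: "v \<in> tangent_space N y" and y: "y \<in> points N"
    and u: "u \<in> C_inf N" and ud: "\<And>h. h \<in> points N \<Longrightarrow> ((\<lambda>t::real. F (t, h)) has_real_derivative u h) (at t0)"
  shows "((\<lambda>t. v (\<lambda>h. F (t, h))) has_real_derivative v u) (at t0)"
proof -
  have N: "charted N" by (rule manifold_charted[OF NN])
  obtain V \<psi> where d: "(V, \<psi>) \<in> atlas N" "y \<in> V" using chart_at[OF N y] by blast
  obtain a where a: "v = plot_vec N (inv_into V \<psi>) (\<psi> y) a"
    using tangent_eq_plot_vec[OF NN v d] by blast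
  let ?K = "\<lambda>z. F (fst z, inv_into V \<psi> (snd z))"
  let ?S = "(UNIV :: real set) \<times> \<psi> ` V"
  have K: "smooth_on ?S ?K"
    using smooth_on_prod_charts[OF charted_euclid N F _ d(1), of UNIV id] by (simp add: atlas_euclid inv_id)
  note oV = chart_open_image[OF N d(1)]
  have oS: "open ?S" using oV by (intro open_Times) auto
  have q: "\<psi> y \<in> \<psi> ` V" using d by auto
  have 1: "v (\<lambda>h. F (t, h)) = frechet_derivative ?K (at (t, \<psi> y)) (0, a)" for t
    using partial_derivatives(3)[OF K, of t "\<psi> y" a] q C_inf_slice(1)[OF charted_euclid N F, of t]
    by (simp add: a plot_vec_def)
  have 2: "u (inv_into V \<psi> b) = frechet_derivative ?K (at (t0, b)) (1, 0)" if b: "b \<in> \<psi> ` V" for b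
  proof -
    have "inv_into V \<psi> b \<in> points N" using chart_inv_mem[OF N d(1) b] chart_subset[OF N d(1)] by blast
    from ud[OF this] have D: "((\<lambda>t. F (t, inv_into V \<psi> b)) has_derivative (*) (u (inv_into V \<psi> b))) (at t0)"
      unfolding has_field_derivative_def .
    then show ?thesis
      using partial_derivatives(4)[OF K, of t0 b 1] b fun_cong[OF frechet_derivative_at[OF D], of 1] by simp
  qed
  note K1 = smooth_on_frechet_derivative[OF K]
  have "v u = frechet_derivative (\<lambda>b. u (inv_into V \<psi> b)) (at (\<psi> y)) a"
    using u by (simp add: a plot_vec_def)
  also have "\<dots> = frechet_derivative (\<lambda>b. frechet_derivative ?K (at (t0, b)) (1, 0)) (at (\<psi> y)) a"
  proof -
    have "((\<lambda>b. frechet_derivative ?K (at (t0, b)) (1, 0)) has_derivative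
        frechet_derivative (\<lambda>b. frechet_derivative ?K (at (t0, b)) (1, 0)) (at (\<psi> y))) (at (\<psi> y))"
      by (rule frechet_derivative_works[THEN iffD1, OF differentiableI[OF partial_derivatives(1)[OF K1]]])
         (use q in simp)
    then have "((\<lambda>b. u (inv_into V \<psi> b)) has_derivative
        frechet_derivative (\<lambda>b. frechet_derivative ?K (at (t0, b)) (1, 0)) (at (\<psi> y))) (at (\<psi> y))"
      by (rule has_derivative_transform_within_open[OF _ oV q]) (use 2 in simp)
    from frechet_derivative_at[OF this] show ?thesis by simp
  qed
  also have "\<dots> = frechet_derivative (\<lambda>z. frechet_derivative ?K (at z) (1, 0)) (at (t0, \<psi> y)) (0, a)"
    using partial_derivatives(3)[OF K1, of t0 "\<psi> y"] q by simp
  also have "\<dots> = frechet_derivative (\<lambda>z. frechet_derivative ?K (at z) (0, a)) (at (t0, \<psi> y)) (1, 0)"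
    by (rule mixed_partials_commute[OF oS _ K]) (use q in simp)
  finally have eq: "v u = frechet_derivative (\<lambda>z. frechet_derivative ?K (at z) (0, a)) (at (t0, \<psi> y)) (1, 0)" .
  have "((\<lambda>t. frechet_derivative ?K (at (t, \<psi> y)) (0, a)) has_derivative
      (\<lambda>t. frechet_derivative (\<lambda>z. frechet_derivative ?K (at z) (0, a)) (at (t0, \<psi> y)) (t, 0))) (at t0)" (is "(_ has_derivative ?D) _")
    by (rule partial_derivatives(2)[OF K1]) (use q in simp)
  moreover have "?D = (*) (?D 1)"
  proof
    fix t
    have "?D (t *\<^sub>R 1) = t *\<^sub>R ?D 1"
      by (rule linear_scale[OF has_derivative_linear[OF calculation]])
    then show "?D t = ?D 1 * t" by (simp only: real_scaleR_def mult_1_right mult.commute[of t])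
  qed
  ultimately show ?thesis
    unfolding 1 has_field_derivative_def eq by simp
qed

subsection \<open>Flows\<close>

text \<open>\<open>velocity\<close> is built from \<open>deriv\<close>, which is a choice;
  smoothness along the curve makes it a true derivative.\<close>

lemma smooth_map_curve_DERIV:
  assumes M: "charted M" and c: "smooth_map euclid M \<gamma>" and f: "f \<in> C_inf M"
  shows "((\<lambda>s. f (\<gamma> s)) has_real_derivative velocity M \<gamma> t f) (at t)"
proof -
  have "smooth_on UNIV (\<lambda>s. f (\<gamma> s))"
    using plot_smooth[OF M open_UNIV _ f] c by simp
  then have "(\<lambda>s. f (\<gamma> s)) differentiable at t"
    using smooth_on_has_derivative by (metis UNIV_I differentiableI)
  then have "(\<lambda>s. f (\<gamma> s)) field_differentiable at t"
    using field_differentiable_def real_differentiable_def by blast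
  then show ?thesis
    using f DERIV_deriv_iff_field_differentiable by (auto simp: velocity_def)
qed

lemma velocity_tangent:
  assumes M: "charted M" and c: "smooth_map euclid M \<gamma>"
  shows "velocity M \<gamma> t \<in> tangent_space M (\<gamma> t)"
proof -
  have "velocity M \<gamma> t = plot_vec M \<gamma> t 1"
  proof
    fix f
    show "velocity M \<gamma> t f = plot_vec M \<gamma> t 1 f"
    proof (cases "f \<in> C_inf M")
      case True
      from smooth_map_curve_DERIV[OF M c True, unfolded has_field_derivative_def]
      have "(*) (velocity M \<gamma> t f) = frechet_derivative (\<lambda>s. f (\<gamma> s)) (at t)" by (rule frechet_derivative_at)
      from fun_cong[OF this, of 1] show ?thesis using True by (simp add: plot_vec_def)
    qed (simp add: velocity_def plot_vec_def)
  qed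
  then show ?thesis using plot_vec_tangent[OF M open_UNIV UNIV_I] c by simp
qed

lemma is_flow_smooth:
  assumes M: "charted M" and F: "is_flow M X \<Phi>"
  shows "x \<in> points M \<Longrightarrow> smooth_map euclid M (\<lambda>t. \<Phi> t x)" and "smooth_map M M (\<Phi> t)"
proof -
  have P: "smooth_map (prod_mfd euclid M) M (\<lambda>(t, x). \<Phi> t x)" using F unfolding is_flow_def by blast
  show "smooth_map euclid M (\<lambda>t. \<Phi> t x)" if "x \<in> points M"
    using smooth_map_compose[OF charted_euclid charted_prod[OF charted_euclid M] M
        smooth_map_Pair[OF charted_euclid charted_euclid M smooth_map_ident[OF charted_euclid] smooth_map_const[OF charted_euclid M that]] P]
    by simp
  show "smooth_map M M (\<Phi> t)"
    using smooth_map_compose[OF M charted_prod[OF charted_euclid M] M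
        smooth_map_Pair[OF M charted_euclid M smooth_map_const[OF M charted_euclid] smooth_map_ident[OF M]] P, of t]
    by simp
qed

lemma is_flow_DERIV:
  assumes M: "charted M" and F: "is_flow M X \<Phi>" and x: "x \<in> points M" and f: "f \<in> C_inf M"
  shows "((\<lambda>t. f (\<Phi> t x)) has_real_derivative X (\<Phi> t x) f) (at t)"
  using smooth_map_curve_DERIV[OF M is_flow_smooth(1)[OF M F x] f, of t] F x
  unfolding is_flow_def by simp

text \<open>Both sides are the derivative at \<open>s = 0\<close> of one and the same function of
  \<open>s\<close>, read once as \<open>f (\<Phi> u (\<Phi> s x))\<close> and once as
  \<open>f (\<Phi> (u + s) x)\<close>.\<close>

lemma is_flow_invariant:
  assumes M: "charted M" and F: "is_flow M X \<Phi>" and x: "x \<in> points M" and f: "f \<in> C_inf M"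
    and add: "\<And>s. \<Phi> (u + s) x = \<Phi> u (\<Phi> s x)"
  shows "X x (\<lambda>z. f (\<Phi> u z)) = X (\<Phi> u x) f"
proof -
  have "\<Phi> 0 x = x" using F x unfolding is_flow_def by blast
  then have "((\<lambda>s. f (\<Phi> u (\<Phi> s x))) has_real_derivative X x (\<lambda>z. f (\<Phi> u z))) (at 0)"
    using is_flow_DERIV[OF M F x C_inf_compose[OF M M is_flow_smooth(2)[OF M F, of u] f], of 0] by simp
  moreover have "((\<lambda>s. f (\<Phi> (u + s) x)) has_real_derivative X (\<Phi> u x) f) (at 0)"
    using is_flow_DERIV[OF M F x f, of u] DERIV_shift[of "\<lambda>s. f (\<Phi> s x)" _ 0 u]
    by (simp add: add.commute)
  ultimately show ?thesis
    unfolding add by (rule DERIV_unique)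
qed

text \<open>If \<open>\<Psi>\<close> is a one-parameter group with generator \<open>X\<close> and \<open>\<gamma>\<close> is an integral curve of \<open>X\<close>,
  then \<open>s \<mapsto> \<Psi> (- s) (\<gamma> s)\<close> is constant. This avoids the uniqueness theorem for differential
  equations.\<close>

lemma is_flow_unique:
  assumes MM: "manifold M" and F: "is_flow M X \<Phi>" and G: "is_flow M X \<Psi>" and x: "x \<in> points M"
    and add: "\<And>s t y. y \<in> points M \<Longrightarrow> \<Psi> (s + t) y = \<Psi> s (\<Psi> t y)"
  shows "\<Phi> t x = \<Psi> t x"
proof -
  have M: "charted M" by (rule manifold_charted[OF MM])
  define \<gamma> where "\<gamma> s = \<Phi> s x" for s
  have \<gamma>: "smooth_map euclid M \<gamma>" unfolding \<gamma>_def by (rule is_flow_smooth(1)[OF M F x])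
  have gp: "\<gamma> s \<in> points M" for s using smooth_map_points[OF \<gamma>] by simp
  have G2: "smooth_map (prod_mfd euclid M) M (\<lambda>(t, x). \<Psi> t x)" using G unfolding is_flow_def by blast
  have \<Psi>p: "\<Psi> s y \<in> points M" if "y \<in> points M" for s y
    using smooth_map_points[OF is_flow_smooth(2)[OF M G] that] .
  have key: "f (\<Psi> (- s) (\<gamma> s)) = f x" if f: "f \<in> C_inf M" for f s
  proof -
    have "smooth_map euclid (prod_mfd euclid M) (\<lambda>z :: real \<times> real. (- fst z, \<gamma> (snd z)))"
      by (intro smooth_map_Pair charted_euclid M smooth_map_compose[OF charted_euclid charted_euclid M _ \<gamma>]
          smooth_map_euclid_UNIV_iff[THEN iffD2] smooth_on_bounded_linear bounded_linear_minus
          bounded_linear_fst bounded_linear_snd open_UNIV)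
    from smooth_map_compose[OF charted_euclid charted_prod[OF charted_euclid M] M this G2]
    have "smooth_map euclid M (\<lambda>z. \<Psi> (- fst z) (\<gamma> (snd z)))" by simp
    \<comment> \<open>The two occurrences of the time are separated into two variables. On the
      diagonal the partial derivatives are - X f and X f at
      \<open>\<Psi> (- s) (\<gamma> s)\<close>, the second one by \<open>is_flow_invariant\<close>,
      so they cancel.\<close>
    then have K: "smooth_on UNIV (\<lambda>z. f (\<Psi> (- fst z) (\<gamma> (snd z))))" (is "smooth_on _ ?K")
      using plot_smooth[OF M open_UNIV _ f] by simp
    have d: "((\<lambda>s. f (\<Psi> (- s) (\<gamma> s))) has_real_derivative 0) (at s)" for s
    proof -
      have dK: "(?K has_derivative frechet_derivative ?K (at (s, s))) (at (s, s))"
        by (rule smooth_on_has_derivative[OF K]) simp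
      have lin: "linear (frechet_derivative ?K (at (s, s)))" using has_derivative_linear[OF dK] .
      have "((\<lambda>r. f (\<Psi> r (\<gamma> s))) has_real_derivative X (\<Psi> (- s) (\<gamma> s)) f) (at (- s))"
        by (rule is_flow_DERIV[OF M G gp f])
      then have "((\<lambda>r. f (\<Psi> (- r) (\<gamma> s))) has_real_derivative - X (\<Psi> (- s) (\<gamma> s)) f) (at s)"
        by (simp add: DERIV_mirror)
      then have 1: "frechet_derivative ?K (at (s, s)) (1, 0) = - X (\<Psi> (- s) (\<gamma> s)) f"
        using fun_cong[OF frechet_derivative_at[of "\<lambda>r. f (\<Psi> (- r) (\<gamma> s))"], of _ s 1]
          partial_derivatives(4)[OF K, of s s 1] by (simp add: has_field_derivative_def)
      have inv: "X (\<gamma> s) (\<lambda>y. f (\<Psi> (- s) y)) = X (\<Psi> (- s) (\<gamma> s)) f"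
        using is_flow_invariant[OF M G gp[of s] f, of "- s"] add[OF gp[of s], of "- s"] by blast
      have "((\<lambda>r. f (\<Psi> (- s) (\<gamma> r))) has_real_derivative X (\<Psi> (- s) (\<gamma> s)) f) (at s)"
        using is_flow_DERIV[OF M F x C_inf_compose[OF M M is_flow_smooth(2)[OF M G, of "- s"] f], of s]
        unfolding inv[unfolded \<gamma>_def] \<gamma>_def .
      then have 2: "frechet_derivative ?K (at (s, s)) (0, 1) = X (\<Psi> (- s) (\<gamma> s)) f"
        using fun_cong[OF frechet_derivative_at[of "\<lambda>r. f (\<Psi> (- s) (\<gamma> r))"], of _ s 1]
          partial_derivatives(3)[OF K, of s s 1] by (simp add: has_field_derivative_def)
      have "((\<lambda>s. (s, s)) has_derivative (\<lambda>r. (r, r))) (at s)" by (auto intro!: derivative_eq_intros)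
      from has_derivative_compose[OF this dK]
      have "((\<lambda>s. f (\<Psi> (- s) (\<gamma> s))) has_derivative (\<lambda>r. frechet_derivative ?K (at (s, s)) (r, r))) (at s)" by simp
      moreover have "frechet_derivative ?K (at (s, s)) (r, r) = 0" for r
      proof -
        have "(r, r) = r *\<^sub>R ((1, 0) + (0, 1))" by simp
        then have "frechet_derivative ?K (at (s, s)) (r, r) =
            r *\<^sub>R (frechet_derivative ?K (at (s, s)) (1, 0) + frechet_derivative ?K (at (s, s)) (0, 1))"
          by (simp only: linear_scale[OF lin] linear_add[OF lin])
        then show ?thesis using 1 2 by simp
      qed
      ultimately show ?thesis by (simp add: has_field_derivative_def lambda_zero)
    qed
    have "f (\<Psi> (- s) (\<gamma> s)) = f (\<Psi> (- 0) (\<gamma> 0))"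
      by (rule DERIV_isconst_all) (use d in blast)
    then show ?thesis using F G x unfolding is_flow_def \<gamma>_def by simp
  qed
  \<comment> \<open>Constancy was proved for each smooth function of the curve; since these separate
    points, the curve itself is constant.\<close>
  have "\<Psi> (- t) (\<gamma> t) = x"
    by (rule C_inf_separates[OF MM \<Psi>p[OF gp] x key])
  then have "\<Psi> t x = \<Psi> (t + - t) (\<gamma> t)" using add[OF gp, of t "- t"] by simp
  also have "\<dots> = \<gamma> t" using G gp unfolding is_flow_def by simp
  finally show ?thesis by (simp add: \<gamma>_def)
qed

subsection \<open>Dimension of the tangent space\<close>

lemma sum_fun_apply: "(\<Sum>i\<in>I. f i) x = (\<Sum>i\<in>I. f i x)"
  by (induction I rule: infinite_finite_induct) auto

text \<open>Evaluating a linear relation at \<open>f j\<close> isolates the coefficient of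
  \<open>b j\<close>.\<close>

lemma independent_of_dual_functions:
  fixes b :: "'i \<Rightarrow> ('x \<Rightarrow> real)"
  assumes I: "finite I" and dual: "\<And>i j. i \<in> I \<Longrightarrow> j \<in> I \<Longrightarrow> b i (f j) = (if i = j then 1 else 0)"
  shows "inj_on b I" and "tv.independent (b ` I)"
proof -
  show inj: "inj_on b I"
  proof (rule inj_onI)
    fix i j assume ij: "i \<in> I" "j \<in> I" "b i = b j"
    have "b j (f j) = 1" using dual[OF ij(2) ij(2)] by simp
    then show "i = j" using dual[OF ij(1,2)] ij(3) by (simp split: if_splits)
  qed
  have "u v = 0" if z: "(\<Sum>v\<in>b ` I. tscale (u v) v) = 0" and v: "v \<in> b ` I" for u v
  proof -
    obtain j where j: "j \<in> I" "v = b j" using v by blast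
    have "(\<Sum>v\<in>b ` I. tscale (u v) v) (f j) = (\<Sum>i\<in>I. u (b i) * b i (f j))"
      by (simp add: sum_fun_apply sum.reindex[OF inj] tscale_def)
    also have "\<dots> = (\<Sum>i\<in>I. if i = j then u (b j) else 0)"
      by (rule sum.cong) (use dual j in auto)
    also have "\<dots> = u (b j)" using I j by simp
    finally show ?thesis using z j by simp
  qed
  then show "tv.independent (b ` I)"
    using I by (auto simp: tv.dependent_finite)
qed

text \<open>The cut off centred coordinates are dual to the coordinate vectors: the coordinate
  vanishes at the centre and \<open>\<eta> x = 1\<close>, so the cutoff does not affect the first
  derivative. The lemma serves as a lower bound for the dimension.\<close>

lemma tangent_space_independent_basis:
  fixes M :: "('a, 'e::euclidean_space) mfd"
  assumes MM: "manifold M" and x: "x \<in> points M"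
  obtains B where "finite B" "B \<subseteq> tangent_space M x" "tv.independent B" "card B = DIM('e)"
proof -
  have M: "charted M" by (rule manifold_charted[OF MM])
  obtain U \<phi> where c: "(U, \<phi>) \<in> atlas M" "x \<in> U" using chart_at[OF M x] by blast
  let ?V = "\<phi> ` U" and ?p = "\<phi> x"
  have oV: "open ?V" by (rule chart_open_image[OF M c(1)])
  have pV: "?p \<in> ?V" using c(2) by blast
  obtain \<eta> where e: "\<eta> \<in> C_inf M" "\<eta> x = 1"
    "\<And>u. smooth_on ?V u \<Longrightarrow> (\<lambda>y. \<eta> y * (if y \<in> U \<and> \<phi> y \<in> ?V then u (\<phi> y) else 0)) \<in> C_inf M"
    by (rule cutoff_extension[OF MM c oV pV]) auto
  define b where "b = plot_vec M (inv_into U \<phi>) ?p"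
  define f where "f i y = \<eta> y * (if y \<in> U \<and> \<phi> y \<in> ?V then (\<phi> y - ?p) \<bullet> i else 0)" for i y
  have f: "f i \<in> C_inf M" for i
  proof -
    have "smooth_on ?V (\<lambda>y. (y + (- ?p)) \<bullet> i)"
      by (intro smooth_on_inner smooth_on_add smooth_on_const smooth_on_bounded_linear bounded_linear_ident oV)
    from e(3)[OF this] show ?thesis unfolding f_def by (simp only: add_uminus_conv_diff)
  qed
  have "b a (f i) = a \<bullet> i" for a i
  proof -
    have "smooth_on ?V (\<lambda>y. \<eta> (inv_into U \<phi> y))"
      using smooth_map_euclidD[OF M _ c(1)] e(1) C_inf_iff by blast
    note de = smooth_on_has_derivative[OF this pV]
    have "((\<lambda>y. (y - ?p) \<bullet> i) has_derivative (\<lambda>v. v \<bullet> i)) (at ?p)"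
      by (auto intro!: derivative_eq_intros)
    from has_derivative_mult[OF de this] e(2) chart_inv[OF M c]
    have "((\<lambda>y. \<eta> (inv_into U \<phi> y) * ((y - ?p) \<bullet> i)) has_derivative (\<lambda>v. v \<bullet> i)) (at ?p)" by simp
    then have "((\<lambda>y. f i (inv_into U \<phi> y)) has_derivative (\<lambda>v. v \<bullet> i)) (at ?p)"
      by (rule has_derivative_transform_within_open[OF _ oV pV])
         (use chart_inv_mem[OF M c(1)] chart_inv[OF M c(1)] in \<open>auto simp: f_def\<close>)
    from fun_cong[OF frechet_derivative_at[OF this], of a] f show ?thesis by (simp add: b_def plot_vec_def)
  qed
  then have dual: "i \<in> Basis \<Longrightarrow> j \<in> Basis \<Longrightarrow> b i (f j) = (if i = j then 1 else 0)" for i j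
    by (simp add: inner_Basis)
  show ?thesis
  proof (rule that[of "b ` Basis"])
    show "b ` Basis \<subseteq> tangent_space M x"
      using plot_vec_tangent[OF M oV pV smooth_map_chart_inv[OF M c(1)]] chart_inv[OF M c] by (auto simp: b_def)
    show "tv.independent (b ` Basis)" "card (b ` Basis) = DIM('e)"
      using independent_of_dual_functions[OF finite_Basis, of b f, OF dual] by (auto simp: card_image)
  qed simp
qed

section \<open>Lie groups\<close>

locale lie_grp =
  fixes G :: "('g, 'e::euclidean_space) lgroup" (structure)
  assumes lie_group: "lie_group G"

sublocale lie_grp \<subseteq> group G
  using lie_group unfolding lie_group_def by blast

context lie_grp
begin

lemma manifold_G: "manifold (mfd G)"
  and points_G: "points (mfd G) = carrier G"
  and smooth_mult: "smooth_map (prod_mfd (mfd G) (mfd G)) (mfd G) (\<lambda>(x, y). x \<otimes> y)"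
  using lie_group unfolding lie_group_def by blast+

lemma charted_G: "charted (mfd G)"
  by (rule manifold_charted[OF manifold_G])

lemma one_point: "\<one> \<in> points (mfd G)"
  by (simp add: points_G)

lemma smooth_map_mult:
  assumes "charted P" "smooth_map P (mfd G) a" "smooth_map P (mfd G) b"
  shows "smooth_map P (mfd G) (\<lambda>x. a x \<otimes> b x)"
  using smooth_map_compose[OF assms(1) charted_prod[OF charted_G charted_G] charted_G
      smooth_map_Pair[OF assms(1) charted_G charted_G assms(2,3)] smooth_mult] by simp

lemma smooth_map_const_G: "charted P \<Longrightarrow> g \<in> carrier G \<Longrightarrow> smooth_map P (mfd G) (\<lambda>_. g)"
  by (rule smooth_map_const[OF _ charted_G]) (simp_all add: points_G)

lemma smooth_left_mult: "g \<in> carrier G \<Longrightarrow> smooth_map (mfd G) (mfd G) (\<lambda>h. g \<otimes> h)"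
  by (intro smooth_map_mult charted_G smooth_map_const_G smooth_map_ident)

lemma smooth_conj: "k \<in> carrier G \<Longrightarrow> l \<in> carrier G \<Longrightarrow> smooth_map (mfd G) (mfd G) (\<lambda>h. k \<otimes> h \<otimes> l)"
  by (intro smooth_map_mult charted_G smooth_map_const_G smooth_map_ident)

lemmas C_inf_left_mult = C_inf_compose[OF charted_G charted_G smooth_left_mult]
lemmas C_inf_conj = C_inf_compose[OF charted_G charted_G smooth_conj]

lemma lie_algebra_cong:
  assumes "X \<in> lie_algebra G" "\<And>h. h \<in> carrier G \<Longrightarrow> f h = f' h"
  shows "X f = X f'"
  by (rule tangent_cong[OF charted_G assms(1)[unfolded lie_algebra_def] one_point])
     (use assms(2) in \<open>simp add: points_G\<close>)

lemma lie_algebra_subspace: "tv.subspace (lie_algebra G)"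
  unfolding lie_algebra_def by (rule tangent_subspace[OF charted_G])

lemmas lie_algebra_lincomb = tangent_lincomb[OF charted_G, where x = \<one>, folded lie_algebra_def]
lemmas lie_algebra_add = tangent_add[OF charted_G, where x = \<one>, folded lie_algebra_def]
lemmas lie_algebra_cmult = tangent_cmult[OF charted_G, where x = \<one>, folded lie_algebra_def]
lemmas lie_algebra_mult = tangent_mult[OF charted_G, where x = \<one>, folded lie_algebra_def]
lemmas lie_algebra_not_smooth = tangent_not_smooth[OF charted_G, where x = \<one>, folded lie_algebra_def]
lemmas lie_algebraI = tangentI[OF charted_G, where x = \<one>, folded lie_algebra_def]

text \<open>The left-invariant vector field of \<open>X\<close> applied to \<open>f\<close>, without
  the test for smoothness in \<open>left_push\<close>, so that it can be iterated as a plain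
  function on the group.\<close>

definition left_deriv :: "'g tvec \<Rightarrow> ('g \<Rightarrow> real) \<Rightarrow> 'g \<Rightarrow> real" where
  "left_deriv X f g = X (\<lambda>h. f (g \<otimes> h))"

lemma left_push_eq: "f \<in> C_inf (mfd G) \<Longrightarrow> left_push G g X f = left_deriv X f g"
  by (simp add: left_push_def push_apply left_deriv_def)

lemma left_push_tangent:
  "X \<in> lie_algebra G \<Longrightarrow> g \<in> carrier G \<Longrightarrow> left_push G g X \<in> tangent_space (mfd G) g"
  unfolding left_push_def lie_algebra_def
  using push_tangent[OF charted_G charted_G smooth_left_mult, of g X \<one>] by simp

text \<open>Left-invariant fields are smooth because \<open>X\<close> acts on the second variable of
  the jointly smooth function \<open>f (g \<otimes> h)\<close>.\<close>

lemma left_deriv_C_inf: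
  assumes X: "X \<in> lie_algebra G" and f: "f \<in> C_inf (mfd G)"
  shows "left_deriv X f \<in> C_inf (mfd G)"
proof -
  have "smooth_map (prod_mfd (mfd G) (mfd G)) euclid (\<lambda>z. f ((\<lambda>(x, y). x \<otimes> y) z))"
    using smooth_map_compose[OF charted_prod[OF charted_G charted_G] charted_G charted_euclid smooth_mult] f
    unfolding C_inf_iff by blast
  from C_inf_tangent_param[OF charted_G manifold_G this X[unfolded lie_algebra_def] one_point]
  show ?thesis unfolding left_deriv_def by simp
qed

lemma left_deriv_one: "X \<in> lie_algebra G \<Longrightarrow> left_deriv X f \<one> = X f"
  unfolding left_deriv_def by (rule lie_algebra_cong) auto

lemma left_push_one: "X \<in> lie_algebra G \<Longrightarrow> left_push G \<one> X = X"
proof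
  fix f assume X: "X \<in> lie_algebra G"
  show "left_push G \<one> X f = X f"
  proof (cases "f \<in> C_inf (mfd G)")
    case True
    then show ?thesis using left_push_eq[OF True, of \<one> X] left_deriv_one[OF X, of f] by simp
  next
    case False
    then show ?thesis using lie_algebra_not_smooth[OF X False] by (simp add: left_push_def push_not_smooth)
  qed
qed

lemma left_deriv_lincomb:
  assumes "X \<in> lie_algebra G" "f \<in> C_inf (mfd G)" "f' \<in> C_inf (mfd G)" "g \<in> carrier G"
  shows "left_deriv X (\<lambda>y. a * f y + b * f' y) g = a * left_deriv X f g + b * left_deriv X f' g"
  unfolding left_deriv_def
  by (rule lie_algebra_lincomb[OF assms(1) C_inf_left_mult[OF assms(4,2)] C_inf_left_mult[OF assms(4,3)]])

lemma left_deriv_mult: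
  assumes "X \<in> lie_algebra G" "f \<in> C_inf (mfd G)" "f' \<in> C_inf (mfd G)" "g \<in> carrier G"
  shows "left_deriv X (\<lambda>y. f y * f' y) g = f g * left_deriv X f' g + f' g * left_deriv X f g"
  unfolding left_deriv_def
  using lie_algebra_mult[OF assms(1) C_inf_left_mult[OF assms(4,2)] C_inf_left_mult[OF assms(4,3)]] assms(4) by simp

subsection \<open>The Lie bracket\<close>

lemma lie_bracket_eq:
  assumes X: "X \<in> lie_algebra G" and Y: "Y \<in> lie_algebra G" and f: "f \<in> C_inf (mfd G)"
  shows "lie_bracket G X Y f = X (left_deriv Y f) - Y (left_deriv X f)"
proof -
  have "(\<lambda>y. left_push G y Z f) = left_deriv Z f" for Z
    using left_push_eq[OF f] by auto
  then show ?thesis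
    using f by (simp add: lie_bracket_def vf_bracket_def left_push_one[OF X] left_push_one[OF Y])
qed

lemma lie_bracket_not_smooth: "f \<notin> C_inf (mfd G) \<Longrightarrow> lie_bracket G X Y f = 0"
  by (simp add: lie_bracket_def vf_bracket_def)

text \<open>Applying Leibniz twice produces the cross terms \<open>Y g * X f + Y f * X g\<close>.
  They are symmetric in \<open>X\<close> and \<open>Y\<close> and cancel in the commutator.\<close>

lemma lie_bracket_closed:
  assumes X: "X \<in> lie_algebra G" and Y: "Y \<in> lie_algebra G"
  shows "lie_bracket G X Y \<in> lie_algebra G"
proof (rule lie_algebraI)
  note lin = lie_bracket_eq[OF X Y]
  fix f g assume f: "f \<in> C_inf (mfd G)" and g: "g \<in> C_inf (mfd G)"
  have half_lin: "X (left_deriv Y (\<lambda>y. a * f y + b * g y)) = a * X (left_deriv Y f) + b * X (left_deriv Y g)"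
    if "X \<in> lie_algebra G" "Y \<in> lie_algebra G" for X Y a b
  proof -
    have "X (left_deriv Y (\<lambda>y. a * f y + b * g y)) = X (\<lambda>y. a * left_deriv Y f y + b * left_deriv Y g y)"
      using that by (intro lie_algebra_cong[OF that(1)] left_deriv_lincomb f g)
    then show ?thesis using that by (simp add: lie_algebra_lincomb left_deriv_C_inf f g)
  qed
  show "lie_bracket G X Y (\<lambda>y. a * f y + b * g y) = a * lie_bracket G X Y f + b * lie_bracket G X Y g" for a b
    by (simp add: lie_bracket_eq X Y f g C_inf_lincomb[OF charted_G] half_lin algebra_simps)
  have half_mult: "X (left_deriv Y (\<lambda>y. f y * g y)) =
      f \<one> * X (left_deriv Y g) + Y g * X f + (g \<one> * X (left_deriv Y f) + Y f * X g)"
    if "X \<in> lie_algebra G" "Y \<in> lie_algebra G" for X Y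
  proof -
    note c = left_deriv_C_inf[OF that(2)]
    have "X (left_deriv Y (\<lambda>y. f y * g y)) = X (\<lambda>y. f y * left_deriv Y g y + g y * left_deriv Y f y)"
      using that by (intro lie_algebra_cong[OF that(1)] left_deriv_mult f g)
    also have "\<dots> = X (\<lambda>y. f y * left_deriv Y g y) + X (\<lambda>y. g y * left_deriv Y f y)"
      by (intro lie_algebra_add that C_inf_mult charted_G c f g)
    finally show ?thesis
      by (simp add: lie_algebra_mult[OF that(1)] c f g left_deriv_one[OF that(2)])
  qed
  show "lie_bracket G X Y (\<lambda>y. f y * g y) = f \<one> * lie_bracket G X Y g + g \<one> * lie_bracket G X Y f"
    by (simp add: lie_bracket_eq X Y f g C_inf_mult[OF charted_G] half_mult algebra_simps)
qed (rule lie_bracket_not_smooth)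

lemma lie_bracket_antisym:
  assumes "X \<in> lie_algebra G" "Y \<in> lie_algebra G"
  shows "lie_bracket G X Y = - lie_bracket G Y X"
proof
  fix f
  show "lie_bracket G X Y f = (- lie_bracket G Y X) f"
    using assms by (cases "f \<in> C_inf (mfd G)") (simp_all add: lie_bracket_eq lie_bracket_not_smooth)
qed

lemma lie_bracket_add:
  assumes X: "X \<in> lie_algebra G" and "Y \<in> lie_algebra G" "Z \<in> lie_algebra G"
  shows "lie_bracket G X (Y + Z) = lie_bracket G X Y + lie_bracket G X Z"
proof
  fix f
  have s: "Y + Z \<in> lie_algebra G" using assms tv.subspace_add[OF lie_algebra_subspace] by blast
  show "lie_bracket G X (Y + Z) f = (lie_bracket G X Y + lie_bracket G X Z) f"
  proof (cases "f \<in> C_inf (mfd G)")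
    case True
    have "left_deriv (Y + Z) f = (\<lambda>g. left_deriv Y f g + left_deriv Z f g)"
      by (simp add: left_deriv_def fun_eq_iff)
    then show ?thesis
      using assms True s by (simp add: lie_bracket_eq lie_algebra_add left_deriv_C_inf)
  qed (simp add: lie_bracket_not_smooth)
qed

lemma lie_bracket_scale:
  assumes X: "X \<in> lie_algebra G" and "Y \<in> lie_algebra G"
  shows "lie_bracket G X (tscale c Y) = tscale c (lie_bracket G X Y)"
proof
  fix f
  have s: "tscale c Y \<in> lie_algebra G" by (rule tv.subspace_scale[OF lie_algebra_subspace assms(2)])
  show "lie_bracket G X (tscale c Y) f = tscale c (lie_bracket G X Y) f"
  proof (cases "f \<in> C_inf (mfd G)")
    case True
    have "left_deriv (tscale c Y) f = (\<lambda>g. c * left_deriv Y f g)"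
      by (rule ext) (simp add: left_deriv_def tscale_def)
    then show ?thesis
      using lie_bracket_eq[OF X s True] lie_bracket_eq[OF assms True] lie_algebra_cmult[OF X left_deriv_C_inf[OF assms(2) True], of c]
      by (simp add: tscale_def right_diff_distrib)
  qed (simp add: lie_bracket_not_smooth tscale_def)
qed

subsection \<open>The adjoint representation\<close>

lemma Ad_eq: "f \<in> C_inf (mfd G) \<Longrightarrow> Ad G k X f = X (\<lambda>h. f (k \<otimes> h \<otimes> inv k))"
  by (simp add: Ad_def push_apply)

lemma Ad_not_smooth: "f \<notin> C_inf (mfd G) \<Longrightarrow> Ad G k X f = 0"
  by (simp add: Ad_def push_not_smooth)

lemma Ad_closed: "X \<in> lie_algebra G \<Longrightarrow> k \<in> carrier G \<Longrightarrow> Ad G k X \<in> lie_algebra G"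
  unfolding Ad_def lie_algebra_def
  using push_tangent[OF charted_G charted_G smooth_conj, of k "inv k" X \<one>] by simp

lemma Ad_mult:
  assumes "X \<in> lie_algebra G" "k \<in> carrier G" "l \<in> carrier G"
  shows "Ad G (k \<otimes> l) X = Ad G k (Ad G l X)"
proof
  fix f
  show "Ad G (k \<otimes> l) X f = Ad G k (Ad G l X) f"
  proof (cases "f \<in> C_inf (mfd G)")
    case True
    have c: "(\<lambda>h. f (k \<otimes> h \<otimes> inv k)) \<in> C_inf (mfd G)"
      using C_inf_conj[OF assms(2) inv_closed[OF assms(2)] True] .
    have "Ad G k (Ad G l X) f = X (\<lambda>h. f (k \<otimes> (l \<otimes> h \<otimes> inv l) \<otimes> inv k))"
      unfolding Ad_eq[OF True] Ad_eq[OF c] ..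
    also have "\<dots> = X (\<lambda>h. f (k \<otimes> l \<otimes> h \<otimes> inv (k \<otimes> l)))"
      by (rule lie_algebra_cong[OF assms(1)]) (use assms in \<open>simp add: m_assoc inv_mult_group\<close>)
    finally show ?thesis using True by (simp add: Ad_eq)
  qed (simp add: Ad_not_smooth)
qed

lemma Ad_one: "X \<in> lie_algebra G \<Longrightarrow> Ad G \<one> X = X"
proof
  fix f assume X: "X \<in> lie_algebra G"
  have "X (\<lambda>h. f (\<one> \<otimes> h \<otimes> inv \<one>)) = X f" by (rule lie_algebra_cong[OF X]) simp
  then show "Ad G \<one> X f = X f"
    using lie_algebra_not_smooth[OF X] by (cases "f \<in> C_inf (mfd G)") (simp_all add: Ad_eq Ad_not_smooth)
qed

text \<open>Conjugation by \<open>k\<close> is a homomorphism, so it carries the left-invariant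
  field of \<open>Y\<close> to that of \<open>Ad G k Y\<close>; \<open>half\<close> applies
  \<open>X\<close> to this relation.\<close>

lemma Ad_bracket:
  assumes X: "X \<in> lie_algebra G" and Y: "Y \<in> lie_algebra G" and k: "k \<in> carrier G"
  shows "Ad G k (lie_bracket G X Y) = lie_bracket G (Ad G k X) (Ad G k Y)"
proof
  fix f
  show "Ad G k (lie_bracket G X Y) f = lie_bracket G (Ad G k X) (Ad G k Y) f"
  proof (cases "f \<in> C_inf (mfd G)")
    case True
    have half: "X (left_deriv Y (\<lambda>h. f (k \<otimes> h \<otimes> inv k))) = Ad G k X (left_deriv (Ad G k Y) f)"
      if X: "X \<in> lie_algebra G" and Y: "Y \<in> lie_algebra G" for X Y
    proof -
      have "left_deriv Y (\<lambda>h. f (k \<otimes> h \<otimes> inv k)) g = left_deriv (Ad G k Y) f (k \<otimes> g \<otimes> inv k)"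
        if g: "g \<in> carrier G" for g
      proof -
        have "left_deriv (Ad G k Y) f (k \<otimes> g \<otimes> inv k) = Y (\<lambda>h. f (k \<otimes> g \<otimes> inv k \<otimes> (k \<otimes> h \<otimes> inv k)))"
        proof -
          have "(\<lambda>h. f (k \<otimes> g \<otimes> inv k \<otimes> h)) \<in> C_inf (mfd G)"
            by (rule C_inf_left_mult[OF _ True]) (use k g in simp)
          then show ?thesis unfolding left_deriv_def by (rule Ad_eq)
        qed
        also have "\<dots> = Y (\<lambda>h. f (k \<otimes> (g \<otimes> h) \<otimes> inv k))"
        proof (rule lie_algebra_cong[OF Y])
          fix h assume h: "h \<in> carrier G"
          have "k \<otimes> g \<otimes> inv k \<otimes> (k \<otimes> h \<otimes> inv k) = k \<otimes> g \<otimes> (inv k \<otimes> k) \<otimes> h \<otimes> inv k"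
            using k g h by (simp only: m_assoc m_closed inv_closed)
          then show "f (k \<otimes> g \<otimes> inv k \<otimes> (k \<otimes> h \<otimes> inv k)) = f (k \<otimes> (g \<otimes> h) \<otimes> inv k)"
            using k g h by (simp add: m_assoc)
        qed
        finally show ?thesis by (simp add: left_deriv_def)
      qed
      then have "X (left_deriv Y (\<lambda>h. f (k \<otimes> h \<otimes> inv k))) = X (\<lambda>g. left_deriv (Ad G k Y) f (k \<otimes> g \<otimes> inv k))"
        by (rule lie_algebra_cong[OF X])
      then show ?thesis
        unfolding Ad_eq[OF left_deriv_C_inf[OF Ad_closed[OF Y k] True]] .
    qed
    have c: "(\<lambda>h. f (k \<otimes> h \<otimes> inv k)) \<in> C_inf (mfd G)"
      using C_inf_conj[OF k inv_closed[OF k] True] .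
    show ?thesis
      unfolding Ad_eq[OF True] lie_bracket_eq[OF X Y c] lie_bracket_eq[OF Ad_closed[OF X k] Ad_closed[OF Y k] True]
        half[OF X Y] half[OF Y X] ..
  qed (simp add: lie_bracket_not_smooth Ad_not_smooth)
qed

subsection \<open>One-parameter subgroups\<close>

context
  fixes X \<gamma>
  assumes \<gamma>: "one_param G X \<gamma>"
begin

lemma one_param_smooth: "smooth_map euclid (mfd G) \<gamma>"
  and one_param_add: "\<gamma> (s + t) = \<gamma> s \<otimes> \<gamma> t"
  and one_param_velocity: "velocity (mfd G) \<gamma> 0 = X"
  using \<gamma> by (simp_all add: one_param_def)

lemma one_param_carrier [simp]: "\<gamma> t \<in> carrier G"
  using smooth_map_points[OF one_param_smooth] by (simp add: points_G)

lemma one_param_zero: "\<gamma> 0 = \<one>"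
proof -
  have "\<gamma> 0 \<otimes> \<gamma> 0 = \<gamma> 0" unfolding one_param_add[symmetric] by simp
  then show ?thesis using r_cancel_one[OF one_param_carrier[of 0] one_param_carrier[of 0]] by simp
qed

lemma one_param_minus: "\<gamma> (- t) = inv \<gamma> t"
  by (rule inv_equality[symmetric]) (simp_all add: one_param_zero flip: one_param_add)

lemma one_param_in_lie_algebra: "X \<in> lie_algebra G"
  using velocity_tangent[OF charted_G one_param_smooth, of 0]
  by (simp add: one_param_velocity one_param_zero lie_algebra_def)

text \<open>Since h \<gamma>(s + t) = (h \<gamma>(t)) \<gamma>(s), left translation reduces time
  \<open>t\<close> to the velocity at time 0.\<close>

lemma one_param_DERIV:
  assumes f: "f \<in> C_inf (mfd G)" and h: "h \<in> carrier G"
  shows "((\<lambda>t. f (h \<otimes> \<gamma> t)) has_real_derivative left_deriv X f (h \<otimes> \<gamma> t)) (at t)"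
proof -
  have c: "(\<lambda>x. f (h \<otimes> \<gamma> t \<otimes> x)) \<in> C_inf (mfd G)"
    by (rule C_inf_left_mult[OF _ f]) (use h in simp)
  have "((\<lambda>s. f (h \<otimes> \<gamma> t \<otimes> \<gamma> s)) has_real_derivative left_deriv X f (h \<otimes> \<gamma> t)) (at 0)"
    using smooth_map_curve_DERIV[OF charted_G one_param_smooth c, of 0]
    unfolding left_deriv_def one_param_velocity .
  moreover have "h \<otimes> \<gamma> t \<otimes> \<gamma> s = h \<otimes> \<gamma> (s + t)" for s
    using h m_assoc[of h "\<gamma> t" "\<gamma> s"] by (simp only: one_param_add[symmetric] one_param_carrier add.commute[of s])
  ultimately show ?thesis
    using DERIV_shift[of "\<lambda>s. f (h \<otimes> \<gamma> s)" _ 0 t] by simp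
qed

text \<open>The left and right factors of the conjugation get independent times in \<open>u\<close>,
  and \<open>Ad G (\<gamma> t) Z f\<close> is \<open>u (t, - t)\<close>. The partial derivatives of
  \<open>u\<close> at the origin are the two iterated derivatives \<open>X (left_deriv Z f)\<close>
  and \<open>Z (left_deriv X f)\<close>; along the antidiagonal their difference appears, which is
  the bracket.\<close>

lemma Ad_DERIV_zero:
  assumes f: "f \<in> C_inf (mfd G)" and Z: "Z \<in> lie_algebra G"
  shows "((\<lambda>t. Ad G (\<gamma> t) Z f) has_real_derivative lie_bracket G X Z f) (at 0)"
proof -
  note X = one_param_in_lie_algebra
  define u where "u z = Z (\<lambda>h. f (\<gamma> (fst z) \<otimes> h \<otimes> \<gamma> (snd z)))" for z :: "real \<times> real"
  have cP: "charted (prod_mfd (euclid :: (real \<times> real, real \<times> real) mfd) (mfd G))"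
    by (rule charted_prod[OF charted_euclid charted_G])
  have "smooth_map (prod_mfd euclid (mfd G)) (mfd G) (\<lambda>z :: (real \<times> real) \<times> 'g. \<gamma> (fst (fst z)) \<otimes> snd z \<otimes> \<gamma> (snd (fst z)))"
  proof (intro smooth_map_mult cP smooth_map_snd charted_euclid charted_G)
    have fs: "smooth_map euclid (mfd G) (\<lambda>z :: real \<times> real. \<gamma> (fst z))"
      by (intro smooth_map_compose[OF charted_euclid charted_euclid charted_G _ one_param_smooth]
          smooth_map_euclid_UNIV_iff[THEN iffD2] smooth_on_bounded_linear bounded_linear_fst open_UNIV)
    have sn: "smooth_map euclid (mfd G) (\<lambda>z :: real \<times> real. \<gamma> (snd z))"
      by (intro smooth_map_compose[OF charted_euclid charted_euclid charted_G _ one_param_smooth]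
          smooth_map_euclid_UNIV_iff[THEN iffD2] smooth_on_bounded_linear bounded_linear_snd open_UNIV)
    show "smooth_map (prod_mfd euclid (mfd G)) (mfd G) (\<lambda>z :: (real \<times> real) \<times> 'g. \<gamma> (fst (fst z)))"
      by (rule smooth_map_compose[OF cP charted_euclid charted_G smooth_map_fst[OF charted_euclid charted_G] fs])
    show "smooth_map (prod_mfd euclid (mfd G)) (mfd G) (\<lambda>z :: (real \<times> real) \<times> 'g. \<gamma> (snd (fst z)))"
      by (rule smooth_map_compose[OF cP charted_euclid charted_G smooth_map_fst[OF charted_euclid charted_G] sn])
  qed
  from C_inf_compose[OF cP charted_G this f]
  have "smooth_map (prod_mfd euclid (mfd G)) euclid (\<lambda>z :: (real \<times> real) \<times> 'g. f (\<gamma> (fst (fst z)) \<otimes> snd z \<otimes> \<gamma> (snd (fst z))))"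
    unfolding C_inf_iff .
  from C_inf_tangent_param[OF charted_euclid manifold_G this Z[unfolded lie_algebra_def] one_point]
  have "u \<in> C_inf euclid"
    unfolding u_def by simp
  then have u: "smooth_on UNIV u"
    using smooth_map_euclid_UNIV_iff unfolding C_inf_iff by blast
  have du: "(u has_derivative frechet_derivative u (at (0, 0))) (at (0, 0))"
    by (rule smooth_on_has_derivative[OF u]) simp
  have lin: "linear (frechet_derivative u (at (0, 0)))" by (rule has_derivative_linear[OF du])
  have "u (s, 0) = left_deriv Z f (\<one> \<otimes> \<gamma> s)" for s
    unfolding u_def left_deriv_def by (rule lie_algebra_cong[OF Z]) (simp add: one_param_zero)
  then have "((\<lambda>s. u (s, 0)) has_real_derivative X (left_deriv Z f)) (at 0)"
    using one_param_DERIV[OF left_deriv_C_inf[OF Z f] one_closed, of 0]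
    by (simp add: one_param_zero left_deriv_one X)
  then have 1: "frechet_derivative u (at (0, 0)) (1, 0) = X (left_deriv Z f)"
    using fun_cong[OF frechet_derivative_at[of "\<lambda>s. u (s, 0)"], of _ 0 1]
      partial_derivatives(4)[OF u, of 0 0 1] by (simp add: has_field_derivative_def)
  have cR: "charted (prod_mfd (euclid :: (real, real) mfd) (mfd G))"
    by (rule charted_prod[OF charted_euclid charted_G])
  have "smooth_map (prod_mfd euclid (mfd G)) (mfd G) (\<lambda>z :: real \<times> 'g. snd z \<otimes> \<gamma> (fst z))"
    by (intro smooth_map_mult cR smooth_map_snd charted_euclid charted_G
        smooth_map_compose[OF cR charted_euclid charted_G smooth_map_fst[OF charted_euclid charted_G] one_param_smooth])
  from C_inf_compose[OF cR charted_G this f]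
  have "smooth_map (prod_mfd euclid (mfd G)) euclid (\<lambda>z :: real \<times> 'g. f (snd z \<otimes> \<gamma> (fst z)))"
    unfolding C_inf_iff .
  from tangent_DERIV_commute[OF manifold_G this Z[unfolded lie_algebra_def] one_point left_deriv_C_inf[OF X f], of 0]
  have "((\<lambda>t. Z (\<lambda>h. f (h \<otimes> \<gamma> t))) has_real_derivative Z (left_deriv X f)) (at 0)"
    using one_param_DERIV[OF f, of _ 0] by (simp add: points_G one_param_zero)
  moreover have "u (0, t) = Z (\<lambda>h. f (h \<otimes> \<gamma> t))" for t
    unfolding u_def by (rule lie_algebra_cong[OF Z]) (simp add: one_param_zero)
  ultimately have 2: "frechet_derivative u (at (0, 0)) (0, 1) = Z (left_deriv X f)"
    using fun_cong[OF frechet_derivative_at[of "\<lambda>s. u (0, s)"], of _ 0 1]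
      partial_derivatives(3)[OF u, of 0 0 1] by (simp add: has_field_derivative_def)
  have "((\<lambda>t::real. (t, - t)) has_derivative (\<lambda>t. (t, - t))) (at 0)" by (auto intro!: derivative_eq_intros)
  from has_derivative_compose[OF this, of u] du
  have "((\<lambda>t. u (t, - t)) has_derivative (\<lambda>t. frechet_derivative u (at (0, 0)) (t, - t))) (at 0)" by simp
  moreover have "frechet_derivative u (at (0, 0)) (t, - t) = lie_bracket G X Z f * t" for t
  proof -
    have "(t, - t) = t *\<^sub>R ((1, 0) - (0, 1))" by simp
    then have "frechet_derivative u (at (0, 0)) (t, - t) =
        t *\<^sub>R (frechet_derivative u (at (0, 0)) (1, 0) - frechet_derivative u (at (0, 0)) (0, 1))"
      by (simp only: linear_scale[OF lin] linear_diff[OF lin])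
    then show ?thesis using 1 2 by (simp add: lie_bracket_eq[OF X Z f] mult.commute)
  qed
  moreover have "u (t, - t) = Ad G (\<gamma> t) Z f" for t
    by (simp add: u_def Ad_eq[OF f] one_param_minus)
  ultimately show ?thesis
    unfolding has_field_derivative_def by simp
qed

text \<open>\<open>Ad\<close> is multiplicative along the one-parameter group, so the derivative at
  time 0 can be conjugated to time \<open>t\<close>.\<close>

lemma Ad_DERIV:
  assumes f: "f \<in> C_inf (mfd G)" and Z: "Z \<in> lie_algebra G"
  shows "((\<lambda>t. Ad G (\<gamma> t) Z f) has_real_derivative Ad G (\<gamma> t) (lie_bracket G X Z) f) (at t)"
proof -
  have "((\<lambda>s. Ad G (\<gamma> s) Z (\<lambda>h. f (\<gamma> t \<otimes> h \<otimes> inv \<gamma> t))) has_real_derivative Ad G (\<gamma> t) (lie_bracket G X Z) f) (at 0)"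
    using Ad_DERIV_zero[OF C_inf_conj[OF _ _ f] Z, of "\<gamma> t" "inv \<gamma> t"] by (simp add: Ad_eq[OF f])
  moreover have "Ad G (\<gamma> s) Z (\<lambda>h. f (\<gamma> t \<otimes> h \<otimes> inv \<gamma> t)) = Ad G (\<gamma> (s + t)) Z f" for s
    using Ad_mult[OF Z, of "\<gamma> t" "\<gamma> s"] by (simp add: Ad_eq[OF f] add.commute[of s] one_param_add)
  ultimately show ?thesis
    using DERIV_shift[of "\<lambda>s. Ad G (\<gamma> s) Z f" _ 0 t] by simp
qed

end

end

subsection \<open>Traces and the Killing form\<close>

text \<open>Linearity is asked only on \<open>V\<close>, because the bracket is a map on all
  functionals but is shown to be linear only on the Lie algebra.\<close>

definition linear_into :: "('x \<Rightarrow> real) set \<Rightarrow> (('x \<Rightarrow> real) \<Rightarrow> ('x \<Rightarrow> real)) \<Rightarrow> bool" where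
  "linear_into V A \<longleftrightarrow> (\<forall>x\<in>V. A x \<in> V) \<and> (\<forall>x\<in>V. \<forall>y\<in>V. A (x + y) = A x + A y) \<and>
     (\<forall>c. \<forall>x\<in>V. A (tscale c x) = tscale c (A x))"

lemma linear_into_sum:
  assumes A: "linear_into V A" and V: "tv.subspace V" and b: "\<And>i. i \<in> I \<Longrightarrow> b i \<in> V"
  shows "A (\<Sum>i\<in>I. tscale (c i) (b i)) = (\<Sum>i\<in>I. tscale (c i) (A (b i)))"
  using b
proof (induction I rule: infinite_finite_induct)
  case (insert i I)
  then have "(\<Sum>i\<in>I. tscale (c i) (b i)) \<in> V"
    by (intro tv.subspace_sum[OF V] tv.subspace_scale[OF V]) auto
  moreover have "tscale (c i) (b i) \<in> V" by (intro tv.subspace_scale[OF V] insert.prems) simp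
  ultimately have "A (tscale (c i) (b i) + (\<Sum>i\<in>I. tscale (c i) (b i))) =
      A (tscale (c i) (b i)) + A (\<Sum>i\<in>I. tscale (c i) (b i))"
    using A unfolding linear_into_def by blast
  moreover have "A (tscale (c i) (b i)) = tscale (c i) (A (b i))"
    using A insert.prems[of i] unfolding linear_into_def by blast
  moreover have "A (\<Sum>i\<in>I. tscale (c i) (b i)) = (\<Sum>i\<in>I. tscale (c i) (A (b i)))"
    using insert by blast
  ultimately show ?case
    by (simp only: sum.insert[OF insert.hyps])
next
  have "A (tscale 0 0) = tscale 0 (A 0)" using A tv.subspace_0[OF V] unfolding linear_into_def by blast
  then have A0: "A 0 = 0" by (simp only: tv.scale_zero_left)
  show "A (\<Sum>i\<in>{}. tscale (c i) (b i)) = (\<Sum>i\<in>{}. tscale (c i) (A (b i)))"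
    and "infinite I \<Longrightarrow> A (\<Sum>i\<in>I. tscale (c i) (b i)) = (\<Sum>i\<in>I. tscale (c i) (A (b i)))" for I
    by (simp_all only: sum.empty sum.infinite A0 not_False_eq_True)
qed

text \<open>If the basis chosen by \<^const>\<open>trace_on\<close> is infinite, both sums are \<open>0\<close>.\<close>

lemma trace_on_commute:
  assumes V: "tv.subspace V" and A: "linear_into V A" and B: "linear_into V B"
  shows "trace_on V (\<lambda>x. A (B x)) = trace_on V (\<lambda>x. B (A x))"
proof -
  define \<B> where "\<B> = (SOME \<B>. \<B> \<subseteq> V \<and> tv.independent \<B> \<and> tv.span \<B> = V)"
  have "\<exists>\<B>. \<B> \<subseteq> V \<and> tv.independent \<B> \<and> tv.span \<B> = V"
    using tv.maximal_independent_subset[of V] tv.span_minimal[OF _ V] by (metis subset_antisym)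
  then have bas: "\<B> \<subseteq> V" "tv.independent \<B>" "tv.span \<B> = V"
    unfolding \<B>_def by (metis (mono_tags, lifting) someI_ex)+
  let ?r = "tv.representation \<B>"
  have expand: "(\<Sum>b\<in>\<B>. ?r (A (B b)) b) = (\<Sum>b\<in>\<B>. \<Sum>c\<in>\<B>. ?r (B b) c * ?r (A c) b)"
    if fin: "finite \<B>" and A: "linear_into V A" and B: "linear_into V B" for A B
  proof (rule sum.cong[OF refl])
    fix b assume b: "b \<in> \<B>"
    have inV: "c \<in> \<B> \<Longrightarrow> A c \<in> V" "c \<in> \<B> \<Longrightarrow> B c \<in> V" for c
      using A B bas(1) unfolding linear_into_def by blast+
    have "B b = (\<Sum>c\<in>\<B>. tscale (?r (B b) c) c)"
      using tv.sum_representation_eq[OF bas(2) _ fin] inV[OF b] bas(3) by auto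
    then have "A (B b) = A (\<Sum>c\<in>\<B>. tscale (?r (B b) c) c)" by simp
    also have "\<dots> = (\<Sum>c\<in>\<B>. tscale (?r (B b) c) (A c))"
      by (rule linear_into_sum[OF A V]) (use bas(1) in blast)
    finally have "?r (A (B b)) = ?r (\<Sum>c\<in>\<B>. tscale (?r (B b) c) (A c))" by simp
    also have "\<dots> = (\<lambda>b'. \<Sum>c\<in>\<B>. ?r (tscale (?r (B b) c) (A c)) b')"
      by (rule tv.representation_sum[OF bas(2)]) (rule tv.span_scale, use inV bas(3) in auto)
    finally show "?r (A (B b)) b = (\<Sum>c\<in>\<B>. ?r (B b) c * ?r (A c) b)"
      using inV bas(3) by (simp add: tv.representation_scale[OF bas(2)])
  qed
  show ?thesis
  proof (cases "finite \<B>")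
    case True
    then show ?thesis
      unfolding trace_on_def Let_def \<B>_def[symmetric] expand[OF True A B] expand[OF True B A]
      by (subst sum.swap) (simp add: mult.commute)
  qed (simp add: trace_on_def Let_def \<B>_def[symmetric])
qed

text \<open>\<open>pp\<close> puts the vector of k in the second slot of the Killing form, whereas
  the contact form is B(xi, X) with xi in the first. The symmetry, from tr (AB) = tr (BA), connects
  the two.\<close>

lemma (in lie_grp) killing_commute:
  assumes X: "X \<in> lie_algebra G" and Y: "Y \<in> lie_algebra G"
  shows "killing G X Y = killing G Y X"
proof -
  have lin: "linear_into (lie_algebra G) (lie_bracket G Z)" if "Z \<in> lie_algebra G" for Z
    using that by (auto simp: linear_into_def lie_bracket_closed lie_bracket_add lie_bracket_scale)
  then show ?thesis
    unfolding killing_def by (intro trace_on_commute[OF lie_algebra_subspace] lin X Y)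
qed

section \<open>The geometry of a compact CR symmetric contact space\<close>

locale cr_space =
  fixes S :: "('g, 'e::euclidean_space, 'f::euclidean_space) cr_data"
  assumes cr: "compact_CR_symmetric_contact_space S"

sublocale cr_space \<subseteq> lie_grp "grp S"
  using cr unfolding compact_CR_symmetric_contact_space_def Let_def by unfold_locales blast

context cr_space
begin

abbreviation G where "G \<equiv> grp S"
abbreviation Q where "Q \<equiv> quot S"
abbreviation mult_G (infixl "\<cdot>" 70) where "a \<cdot> b \<equiv> a \<otimes>\<^bsub>G\<^esub> b"

lemmas cr' = cr[unfolded compact_CR_symmetric_contact_space_def Let_def]

lemma xi_in: "xi S \<in> lie_algebra G"
  and half_dim_pos: "half_dim S \<ge> 1"
  and dim_pp: "tv.dim (pp S) = 2 * half_dim S"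
  and decomposition: "\<forall>X\<in>lie_algebra G. \<exists>Y\<in>kk S. \<exists>Z\<in>pp S. X = Y + Z"
  and adJ_complex: "\<forall>Y\<in>pp S. adJ S Y \<in> pp S \<and> adJ S (adJ S Y) = - Y"
  and exp_one_param: "one_param G (xi S) (exp_xi S)"
  and H_sub: "closed_subgroup G (subH S)"
  and H_subset_K: "subH S \<subseteq> stabK S"
  and lie_H: "lie_subalgebra G (subH S) = {X \<in> kk S. killing G (xi S) X = 0}"
  and H_exp_commute: "\<forall>h\<in>subH S. \<forall>t. h \<cdot> exp_xi S t = exp_xi S t \<cdot> h"
  and K_eq: "stabK S = subH S <#>\<^bsub>G\<^esub> range (exp_xi S)"
  and quotient: "quotient_manifold G (subH S) Q"
  and dim_Q: "DIM('f) = 2 * half_dim S + 1"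
  and contact: "contact_form Q (theta S)"
  and theta_induced: "\<forall>g\<in>carrier G. \<forall>X\<in>lie_algebra G. theta S (proj S g) (induced S g X) = killing G (xi S) X"
  and cxJ_induced: "\<forall>g\<in>carrier G. \<forall>Y\<in>pp S. cxJ S (proj S g) (induced S g Y) = induced S g (adJ S Y)"
  and reeb: "reeb_field Q (theta S) (reeb S)"
  and reeb_induced: "\<forall>g\<in>carrier G. reeb S (proj S g) = induced S g (tscale (- 1 / (2 * real (half_dim S))) (xi S))"
  by (insert cr', elim conjE, assumption)+

lemma adJ_pp: "Y \<in> pp S \<Longrightarrow> adJ S Y \<in> pp S"
  and adJ_adJ: "Y \<in> pp S \<Longrightarrow> adJ S (adJ S Y) = - Y"
  using adJ_complex by auto

lemma manifold_Q: "manifold Q"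
  and points_Q: "points Q = lcosets\<^bsub>G\<^esub> (subH S)"
  and smooth_proj: "smooth_map (mfd G) Q (proj S)"
  and local_section: "x \<in> points Q \<Longrightarrow> \<exists>W \<sigma>. openin (mtop Q) W \<and> x \<in> W \<and>
        smooth_map (restrict_mfd Q W) (mfd G) \<sigma> \<and> (\<forall>y\<in>W. proj S (\<sigma> y) = y)"
  using quotient by (simp_all add: quotient_manifold_def proj_def[abs_def])

lemma charted_Q: "charted Q"
  by (rule manifold_charted[OF manifold_Q])

lemma subgroup_H: "subgroup (subH S) G"
  using H_sub unfolding closed_subgroup_def by blast

lemma H_carrier: "h \<in> subH S \<Longrightarrow> h \<in> carrier G"
  by (rule subgroup.mem_carrier[OF subgroup_H])

lemma exp_xi_carrier [simp]: "exp_xi S t \<in> carrier G"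
  by (rule one_param_carrier[OF exp_one_param])

lemma exp_xi_add: "exp_xi S (s + t) = exp_xi S s \<cdot> exp_xi S t"
  by (rule one_param_add[OF exp_one_param])

lemma exp_xi_zero: "exp_xi S 0 = \<one>\<^bsub>G\<^esub>"
  by (rule one_param_zero[OF exp_one_param])

lemma exp_xi_minus: "exp_xi S (- t) = inv\<^bsub>G\<^esub> exp_xi S t"
  by (rule one_param_minus[OF exp_one_param])

section \<open>Points of the quotient as cosets\<close>

lemma proj_point: "g \<in> carrier G \<Longrightarrow> proj S g \<in> points Q"
  unfolding points_Q proj_def LCOSETS_def by blast

lemma point_proj:
  assumes "x \<in> points Q" obtains g where "g \<in> carrier G" "x = proj S g"
  using assms unfolding points_Q proj_def LCOSETS_def by blast

lemma proj_mult_H: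
  assumes g: "g \<in> carrier G" and h: "h \<in> subH S"
  shows "proj S (g \<cdot> h) = proj S g"
proof -
  have "h <#\<^bsub>G\<^esub> subH S = subH S" by (rule coset_join3[OF H_carrier[OF h] subgroup_H h])
  then show ?thesis
    using lcos_m_assoc[OF subgroup.subset[OF subgroup_H] g H_carrier[OF h]] by (simp add: proj_def)
qed

lemma proj_eqD:
  assumes g: "g \<in> carrier G" "g' \<in> carrier G" and eq: "proj S g' = proj S g"
  obtains h where "h \<in> subH S" "g' = g \<cdot> h"
proof -
  have "g' \<in> g <#\<^bsub>G\<^esub> subH S"
    using lcos_self[OF g(2) subgroup_H] eq by (simp add: proj_def)
  then show ?thesis using that unfolding l_coset_def by blast
qed

text \<open>Right translation by exp (t xi) descends to \<open>G/H\<close> because exp (t xi)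
  commutes with \<open>H\<close>.\<close>

lemma proj_mult_exp_cong:
  assumes "g \<in> carrier G" "g' \<in> carrier G" "proj S g' = proj S g"
  shows "proj S (g' \<cdot> exp_xi S t) = proj S (g \<cdot> exp_xi S t)"
proof -
  obtain h where h: "h \<in> subH S" "g' = g \<cdot> h" using proj_eqD[OF assms] .
  have "g' \<cdot> exp_xi S t = g \<cdot> exp_xi S t \<cdot> h"
    using assms(1) h H_carrier[OF h(1)] bspec[OF H_exp_commute h(1), THEN spec, of t] by (simp add: m_assoc)
  then show ?thesis using proj_mult_H[OF _ h(1)] assms(1) by simp
qed

subsection \<open>The decomposition of the Lie algebra\<close>

lemma kk_subset: "Y \<in> kk S \<Longrightarrow> Y \<in> lie_algebra G"
  unfolding kk_def lie_subalgebra_def by blast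

lemma pp_subset: "Y \<in> pp S \<Longrightarrow> Y \<in> lie_algebra G"
  unfolding pp_def by blast

lemma exp_in_K: "exp_xi S t \<in> stabK S"
  unfolding K_eq set_mult_def using subgroup.one_closed[OF subgroup_H] l_one[OF exp_xi_carrier, of t] by force

lemma xi_in_kk: "xi S \<in> kk S"
  unfolding kk_def lie_subalgebra_def using xi_in exp_one_param exp_in_K by blast

text \<open>\<open>K\<close> fixes xi, so the curve \<open>Ad G (\<gamma> t) (xi S)\<close> is
  constant, and its derivative at 0 is the bracket of \<open>Y\<close> with xi.\<close>

lemma adJ_kk:
  assumes Y: "Y \<in> kk S"
  shows "adJ S Y = 0"
proof -
  obtain \<gamma> where \<gamma>: "one_param G Y \<gamma>" "\<And>t. \<gamma> t \<in> stabK S"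
    using Y unfolding kk_def lie_subalgebra_def by blast
  have Ad: "Ad G (\<gamma> t) (xi S) = xi S" for t using \<gamma>(2) unfolding stabK_def by blast
  have "lie_bracket G Y (xi S) f = 0" for f
  proof (cases "f \<in> C_inf (mfd G)")
    case True
    have "((\<lambda>t::real. xi S f) has_real_derivative lie_bracket G Y (xi S) f) (at 0)"
      using Ad_DERIV_zero[OF \<gamma>(1) True xi_in] unfolding Ad .
    from DERIV_unique[OF this DERIV_const] show ?thesis .
  qed (simp add: lie_bracket_not_smooth)
  then have "lie_bracket G Y (xi S) = 0" by (simp add: fun_eq_iff)
  then show ?thesis
    unfolding adJ_def using lie_bracket_antisym[OF xi_in kk_subset[OF Y]] by (simp add: fun_eq_iff)
qed

lemma adJ_add: "X \<in> lie_algebra G \<Longrightarrow> Y \<in> lie_algebra G \<Longrightarrow> adJ S (X + Y) = adJ S X + adJ S Y"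
  unfolding adJ_def by (rule lie_bracket_add[OF xi_in])

lemma adJ_scale: "X \<in> lie_algebra G \<Longrightarrow> adJ S (tscale c X) = tscale c (adJ S X)"
  unfolding adJ_def by (rule lie_bracket_scale[OF xi_in])

text \<open>Only the p-component of \<open>X\<close> survives ad xi, and p is stable under
  it.\<close>

lemma adJ_in_pp:
  assumes X: "X \<in> lie_algebra G"
  shows "adJ S X \<in> pp S"
proof -
  obtain Y Z where YZ: "Y \<in> kk S" "Z \<in> pp S" "X = Y + Z" using bspec[OF decomposition X] by blast
  then have "adJ S X = 0 + adJ S Z" by (simp only: adJ_add kk_subset pp_subset adJ_kk)
  then show ?thesis using adJ_pp[OF YZ(2)] by simp
qed

text \<open>X = J (- J X). Together with \<open>adJ_in_pp\<close> this makes p the image of ad xi, a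
  description through which linear structure and invariance of p follow from those of the bracket
  instead of from the Killing form.\<close>

lemma pp_eq_adJ:
  assumes X: "X \<in> pp S"
  shows "X = adJ S (tscale (- 1) (adJ S X))"
proof -
  have "adJ S (tscale (- 1) (adJ S X)) = tscale (- 1) (- X)"
    using adJ_scale[OF pp_subset[OF adJ_pp[OF X]], of "- 1"] adJ_adJ[OF X] by simp
  then show ?thesis by (simp add: tscale_def fun_eq_iff)
qed

lemma pp_subspace: "tv.subspace (pp S)"
  unfolding tv.subspace_def
proof (intro conjI ballI allI)
  note sub = lie_algebra_subspace
  show "0 \<in> pp S" using adJ_in_pp[OF kk_subset[OF xi_in_kk]] adJ_kk[OF xi_in_kk] by simp
  have sc: "tscale c X \<in> pp S" if X: "X \<in> pp S" for c X
  proof -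
    have Z: "tscale (- 1) (adJ S X) \<in> lie_algebra G"
      by (rule tv.subspace_scale[OF sub pp_subset[OF adJ_pp[OF X]]])
    have "tscale c X = adJ S (tscale c (tscale (- 1) (adJ S X)))"
      using pp_eq_adJ[OF X] adJ_scale[OF Z, of c] by simp
    then show ?thesis using adJ_in_pp[OF tv.subspace_scale[OF sub Z]] by simp
  qed
  then show "tscale c X \<in> pp S" if "X \<in> pp S" for c X using that by blast
  show "X + Y \<in> pp S" if XY: "X \<in> pp S" "Y \<in> pp S" for X Y
  proof -
    have Z: "tscale (- 1) (adJ S X) \<in> lie_algebra G" "tscale (- 1) (adJ S Y) \<in> lie_algebra G"
      by (intro tv.subspace_scale[OF sub] pp_subset adJ_pp XY)+
    have "X + Y = adJ S (tscale (- 1) (adJ S X) + tscale (- 1) (adJ S Y))"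
      using pp_eq_adJ[OF XY(1)] pp_eq_adJ[OF XY(2)] adJ_add[OF Z] by simp
    then show ?thesis using adJ_in_pp[OF tv.subspace_add[OF sub Z]] by simp
  qed
qed

lemma Ad_adJ:
  assumes k: "k \<in> stabK S" and X: "X \<in> lie_algebra G"
  shows "Ad G k (adJ S X) = adJ S (Ad G k X)"
  using Ad_bracket[OF xi_in X, of k] k unfolding stabK_def adJ_def by simp

text \<open>An element of \<open>K\<close> fixes xi, so its adjoint action commutes with ad xi and
  preserves the image of ad xi.\<close>

lemma Ad_pp:
  assumes k: "k \<in> stabK S" and X: "X \<in> pp S"
  shows "Ad G k X \<in> pp S"
proof -
  have kc: "k \<in> carrier G" using k unfolding stabK_def by blast
  have Z: "tscale (- 1) (adJ S X) \<in> lie_algebra G"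
    by (rule tv.subspace_scale[OF lie_algebra_subspace pp_subset[OF adJ_pp[OF X]]])
  have "Ad G k X = adJ S (Ad G k (tscale (- 1) (adJ S X)))"
    using pp_eq_adJ[OF X] Ad_adJ[OF k Z] by simp
  then show ?thesis using adJ_in_pp[OF Ad_closed[OF Z kc]] by simp
qed

lemma killing_xi_pp: "X \<in> pp S \<Longrightarrow> killing G (xi S) X = 0"
  using xi_in_kk killing_commute[OF xi_in pp_subset, of X] unfolding pp_def by auto

text \<open>On \<open>\<pp>\<close> the curve \<open>Ad (exp (t \<xi>)) X\<close> solves \<open>a' = b\<close>, \<open>b' = - a\<close>.\<close>

lemma Ad_exp_pp:
  assumes X: "X \<in> pp S"
  shows "Ad G (exp_xi S t) X = (\<lambda>f. cos t * X f + sin t * adJ S X f)"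
proof
  fix f
  note JX = adJ_pp[OF X]
  show "Ad G (exp_xi S t) X f = cos t * X f + sin t * adJ S X f"
  proof (cases "f \<in> C_inf (mfd G)")
    case True
    define a where "a t = Ad G (exp_xi S t) X f" for t
    define b where "b t = Ad G (exp_xi S t) (adJ S X) f" for t
    have a: "(a has_real_derivative b t) (at t)" for t
      using Ad_DERIV[OF exp_one_param True pp_subset[OF X], of t] unfolding a_def[abs_def] b_def adJ_def .
    have "Ad G k (- X) f = - Ad G k X f" for k
      by (simp add: Ad_def push_def)
    then have b: "(b has_real_derivative - a t) (at t)" for t
      using Ad_DERIV[OF exp_one_param True pp_subset[OF JX], of t] adJ_adJ[OF X]
      unfolding b_def[abs_def] a_def by (simp add: adJ_def)
    have 0: "a 0 = X f" "b 0 = adJ S X f"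
      by (simp_all add: a_def b_def exp_xi_zero Ad_one pp_subset X JX)
    \<comment> \<open>\<open>u\<close> and \<open>v\<close> rotate the pair \<open>a\<close>,
      \<open>b\<close> back by the angle \<open>t\<close>; the system makes them constant.\<close>
    define u where "u t = a t * cos t - b t * sin t" for t
    define v where "v t = a t * sin t + b t * cos t" for t
    have "(u has_real_derivative 0) (at t)" for t
      unfolding u_def[abs_def] by (auto intro!: derivative_eq_intros a b simp: algebra_simps)
    then have "u t = u 0" by (intro DERIV_isconst_all) blast
    moreover have "(v has_real_derivative 0) (at t)" for t
      unfolding v_def[abs_def] by (auto intro!: derivative_eq_intros a b simp: algebra_simps)
    then have "v t = v 0" by (intro DERIV_isconst_all) blast
    ultimately have uv: "u t = X f" "v t = adJ S X f" by (simp_all add: u_def v_def 0)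
    have "a t = a t * ((cos t)\<^sup>2 + (sin t)\<^sup>2)" by simp
    also have "\<dots> = cos t * u t + sin t * v t"
      by (simp only: u_def v_def power2_eq_square) algebra
    finally show ?thesis using uv by (simp add: a_def)
  next
    case False
    then show ?thesis
      using lie_algebra_not_smooth[OF pp_subset[OF X]] lie_algebra_not_smooth[OF pp_subset[OF JX]]
      by (simp add: Ad_not_smooth)
  qed
qed

subsection \<open>Tangent vectors of the quotient\<close>

lemma C_inf_proj: "f \<in> C_inf Q \<Longrightarrow> (\<lambda>h. f (proj S h)) \<in> C_inf (mfd G)"
  by (rule C_inf_compose[OF charted_G charted_Q smooth_proj])

lemma induced_eq: "f \<in> C_inf Q \<Longrightarrow> induced S g X f = X (\<lambda>h. f (proj S (g \<cdot> h)))"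
  unfolding induced_def using left_push_eq[OF C_inf_proj] by (simp add: push_apply left_deriv_def)

lemma induced_not_smooth: "f \<notin> C_inf Q \<Longrightarrow> induced S g X f = 0"
  unfolding induced_def by (rule push_not_smooth)

lemma induced_tangent:
  "g \<in> carrier G \<Longrightarrow> X \<in> lie_algebra G \<Longrightarrow> induced S g X \<in> tangent_space Q (proj S g)"
  unfolding induced_def by (rule push_tangent[OF charted_G charted_Q smooth_proj left_push_tangent])

lemma induced_add: "induced S g (X + Y) = induced S g X + induced S g Y"
  by (auto simp: induced_def left_push_def push_def fun_eq_iff)

lemma induced_scale: "induced S g (tscale c X) = tscale c (induced S g X)"
  by (auto simp: induced_def left_push_def push_def fun_eq_iff tscale_def)

text \<open>Modulo \<open>H\<close> on the right, g h y and g (h y h^-1) are the same point.\<close>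

lemma induced_mult_H:
  assumes g: "g \<in> carrier G" and h: "h \<in> subH S" and X: "X \<in> lie_algebra G"
  shows "induced S (g \<cdot> h) X = induced S g (Ad G h X)"
proof
  fix f
  show "induced S (g \<cdot> h) X f = induced S g (Ad G h X) f"
  proof (cases "f \<in> C_inf Q")
    case True
    note hc = H_carrier[OF h]
    have c: "(\<lambda>y. f (proj S (g \<cdot> y))) \<in> C_inf (mfd G)"
      using C_inf_left_mult[OF g C_inf_proj[OF True]] .
    have "proj S (g \<cdot> h \<cdot> y) = proj S (g \<cdot> (h \<cdot> y \<cdot> inv\<^bsub>G\<^esub> h))" if y: "y \<in> carrier G" for y
      using proj_mult_H[OF _ subgroup.m_inv_closed[OF subgroup_H h], of "g \<cdot> h \<cdot> y"] g hc y
      by (simp add: m_assoc)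
    then show ?thesis
      unfolding induced_eq[OF True] Ad_eq[OF c] by (intro lie_algebra_cong[OF X]) simp
  qed (simp add: induced_not_smooth)
qed

text \<open>The one-parameter group of \<open>Y\<close> stays in \<open>H\<close>, so its projection
  is a constant curve.\<close>

lemma induced_lie_H:
  assumes g: "g \<in> carrier G" and Y: "Y \<in> lie_subalgebra G (subH S)"
  shows "induced S g Y = 0"
proof
  fix f
  obtain \<gamma> where \<gamma>: "one_param G Y \<gamma>" "\<And>t. \<gamma> t \<in> subH S"
    using Y unfolding lie_subalgebra_def by blast
  show "induced S g Y f = 0 f"
  proof (cases "f \<in> C_inf Q")
    case True
    have "((\<lambda>t. f (proj S (g \<cdot> \<gamma> t))) has_real_derivative left_deriv Y (\<lambda>h. f (proj S h)) (g \<cdot> \<gamma> 0)) (at 0)"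
      by (rule one_param_DERIV[OF \<gamma>(1) C_inf_proj[OF True] g])
    then have "((\<lambda>t::real. f (proj S g)) has_real_derivative induced S g Y f) (at 0)"
      using g by (simp add: proj_mult_H[OF g \<gamma>(2)] one_param_zero[OF \<gamma>(1)] left_deriv_def induced_eq[OF True])
    from DERIV_unique[OF this DERIV_const] show ?thesis by simp
  qed (simp add: induced_not_smooth)
qed

text \<open>A local section lifts \<open>v\<close> to a tangent vector \<open>w\<close> of the
  group, and left translation brings \<open>w\<close> back to the identity.\<close>

lemma tangent_Q_induced:
  assumes g: "g \<in> carrier G" and v: "v \<in> tangent_space Q (proj S g)"
  obtains X where "X \<in> lie_algebra G" "v = induced S g X"
proof -
  let ?x = "proj S g"
  have x: "?x \<in> points Q" by (rule proj_point[OF g])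
  obtain W \<sigma> where W: "openin (mtop Q) W" "?x \<in> W" and \<sigma>: "smooth_map (restrict_mfd Q W) (mfd G) \<sigma>"
    and sec: "\<And>y. y \<in> W \<Longrightarrow> proj S (\<sigma> y) = y"
    using local_section[OF x] by blast
  obtain U \<phi> where c: "(U, \<phi>) \<in> atlas Q" "?x \<in> U" using chart_at[OF charted_Q x] by blast
  obtain a where a: "v = plot_vec Q (inv_into U \<phi>) (\<phi> ?x) a"
    using tangent_eq_plot_vec[OF manifold_Q v c] .
  let ?T = "\<phi> ` (U \<inter> W)"
  have oT: "open ?T"
    by (rule chart_open[OF charted_Q c(1)]) (use chart_openin[OF charted_Q c(1)] W(1) in auto)
  have pT: "\<phi> ?x \<in> ?T" using c(2) W(2) by blast
  have cT: "charted (restrict_mfd (euclid :: ('f, 'f) mfd) ?T)"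
    using charted_restrict[OF charted_euclid] oT by simp
  have "smooth_map (restrict_mfd euclid ?T) Q (inv_into U \<phi>)"
    by (rule smooth_map_restrict_subset[OF charted_euclid charted_Q _ _ _ smooth_map_chart_inv[OF charted_Q c(1)]])
       (use oT chart_open_image[OF charted_Q c(1)] in auto)
  moreover have "inv_into U \<phi> y \<in> W" if "y \<in> points (restrict_mfd euclid ?T)" for y
    using that oT chart_inv[OF charted_Q c(1)] by (auto simp: points_restrict)
  ultimately have "smooth_map (restrict_mfd euclid ?T) (restrict_mfd Q W) (inv_into U \<phi>)"
    using smooth_map_into_restrict[OF cT _ W(1)] by blast
  then have cs: "smooth_map (restrict_mfd euclid ?T) (mfd G) (\<lambda>y. \<sigma> (inv_into U \<phi> y))"
    by (rule smooth_map_compose[OF cT charted_restrict[OF charted_Q W(1)] charted_G _ \<sigma>])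
  define w where "w = plot_vec (mfd G) (\<lambda>y. \<sigma> (inv_into U \<phi> y)) (\<phi> ?x) a"
  have w: "w \<in> tangent_space (mfd G) (\<sigma> ?x)"
    unfolding w_def using plot_vec_tangent[OF charted_G oT pT cs] chart_inv[OF charted_Q c] by simp
  have "v = push Q (proj S) w"
  proof
    fix f
    show "v f = push Q (proj S) w f"
    proof (cases "f \<in> C_inf Q")
      case True
      have "smooth_on ?T (\<lambda>y. f (inv_into U \<phi> y))"
        by (rule smooth_on_subset[OF smooth_map_euclidD[OF charted_Q _ c(1)]]) (use True C_inf_iff in auto)
      from smooth_on_has_derivative[OF this pT]
      have "((\<lambda>y. f (proj S (\<sigma> (inv_into U \<phi> y)))) has_derivative frechet_derivative (\<lambda>y. f (inv_into U \<phi> y)) (at (\<phi> ?x))) (at (\<phi> ?x))"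
        by (rule has_derivative_transform_within_open[OF _ oT pT])
           (use sec chart_inv[OF charted_Q c(1)] in auto)
      from frechet_derivative_at[OF this] show ?thesis
        using True C_inf_proj[OF True] by (simp add: a w_def push_apply plot_vec_def)
    qed (simp add: a plot_vec_def push_not_smooth)
  qed
  moreover
  have \<sigma>x: "\<sigma> ?x \<in> carrier G"
    using smooth_map_points[OF \<sigma>] W by (simp add: points_restrict points_G)
  define X where "X = left_push G (inv\<^bsub>G\<^esub> \<sigma> ?x) w"
  have X: "X \<in> lie_algebra G"
    unfolding X_def left_push_def lie_algebra_def
    using push_tangent[OF charted_G charted_G smooth_left_mult[OF inv_closed[OF \<sigma>x]] w] \<sigma>x by simp
  have "push Q (proj S) w f = induced S (\<sigma> ?x) X f" for f
  proof (cases "f \<in> C_inf Q")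
    case True
    have c': "(\<lambda>h. f (proj S (\<sigma> ?x \<cdot> h))) \<in> C_inf (mfd G)"
      using C_inf_left_mult[OF \<sigma>x C_inf_proj[OF True]] .
    have "w (\<lambda>h. f (proj S h)) = w (\<lambda>h. f (proj S (\<sigma> ?x \<cdot> (inv\<^bsub>G\<^esub> \<sigma> ?x \<cdot> h))))"
      by (rule tangent_cong[OF charted_G w]) (use \<sigma>x in \<open>simp_all add: points_G flip: m_assoc\<close>)
    then show ?thesis
      using c' True unfolding induced_eq[OF True] X_def left_push_def by (simp add: push_apply)
  qed (simp add: induced_not_smooth push_not_smooth)
  ultimately have v\<sigma>: "v = induced S (\<sigma> ?x) X" by (simp add: fun_eq_iff)
  \<comment> \<open>The section need not pass through \<open>g\<close> but only through the same
    coset; the discrepancy \<open>h\<close> is absorbed by \<open>Ad G h\<close>.\<close>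
  obtain h where h: "h \<in> subH S" "\<sigma> ?x = g \<cdot> h"
    using proj_eqD[OF g \<sigma>x sec[OF W(2)]] .
  show ?thesis
    using that[OF Ad_closed[OF X H_carrier[OF h(1)]]] v\<sigma> induced_mult_H[OF g h(1) X] h(2) by simp
qed

lemma theta_linear:
  assumes "x \<in> points Q" "v \<in> tangent_space Q x" "w \<in> tangent_space Q x"
  shows "theta S x (tscale a v + tscale b w) = a * theta S x v + b * theta S x w"
  using contact assms unfolding contact_form_def one_form_def by blast

text \<open>Split X = Y + Z along k and p. The contact form sees only B(xi, Y); if this vanishes,
  \<open>Y\<close> lies in the Lie algebra of \<open>H\<close> and induces 0, so \<open>Z\<close>
  alone induces the vector.\<close>

lemma cdist_eq:
  assumes g: "g \<in> carrier G"
  shows "cdist S (proj S g) = induced S g ` pp S"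
proof
  show "induced S g ` pp S \<subseteq> cdist S (proj S g)"
    using induced_tangent[OF g pp_subset] theta_induced pp_subset g killing_xi_pp
    unfolding cdist_def contact_dist_def by auto
  show "cdist S (proj S g) \<subseteq> induced S g ` pp S"
  proof
    fix v assume "v \<in> cdist S (proj S g)"
    then have v: "v \<in> tangent_space Q (proj S g)" "theta S (proj S g) v = 0"
      unfolding cdist_def contact_dist_def by auto
    obtain X where X: "X \<in> lie_algebra G" "v = induced S g X" using tangent_Q_induced[OF g v(1)] .
    obtain Y Z where YZ: "Y \<in> kk S" "Z \<in> pp S" "X = Y + Z" using bspec[OF decomposition X(1)] by blast
    note Y = kk_subset[OF YZ(1)] and Z = pp_subset[OF YZ(2)]
    have "theta S (proj S g) (tscale 1 (induced S g Y) + tscale 1 (induced S g Z)) =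
        1 * theta S (proj S g) (induced S g Y) + 1 * theta S (proj S g) (induced S g Z)"
      by (rule theta_linear[OF proj_point[OF g] induced_tangent[OF g Y] induced_tangent[OF g Z]])
    then have "killing G (xi S) Y = 0"
      using v(2) X(2) YZ(3) bspec[OF bspec[OF theta_induced g] Y] bspec[OF bspec[OF theta_induced g] Z] killing_xi_pp[OF YZ(2)]
      by (simp add: induced_add)
    then have "induced S g Y = 0"
      using induced_lie_H[OF g] YZ(1) lie_H by blast
    then have "v = induced S g Z" using X(2) YZ(3) by (simp add: induced_add)
    then show "v \<in> induced S g ` pp S" using YZ(2) by blast
  qed
qed

interpretation tvp: vector_space_pair "tscale :: real \<Rightarrow> 'g tvec \<Rightarrow> 'g tvec" "tscale :: real \<Rightarrow> 'g set tvec \<Rightarrow> 'g set tvec"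
  by unfold_locales

lemma induced_linear: "Vector_Spaces.linear tscale tscale (induced S g)"
  by unfold_locales (simp_all only: induced_add induced_scale)

lemma span_induced_basis: "g \<in> carrier G \<Longrightarrow> tv.span B = pp S \<Longrightarrow> tv.span (induced S g ` B) = cdist S (proj S g)"
  using tvp.linear_span_image[OF induced_linear, of g B] cdist_eq[of g] by simp

lemma pp_basis:
  obtains B where "finite B" "tv.independent B" "tv.span B = pp S" "card B = 2 * half_dim S"
proof -
  obtain B where B: "B \<subseteq> pp S" "tv.independent B" "pp S \<subseteq> tv.span B" "card B = tv.dim (pp S)"
    using tv.basis_exists[of "pp S"] .
  \<comment> \<open>An infinite set has \<open>card\<close> 0, so the positive dimension forces
    finiteness.\<close>
  have "finite B" using B(4) dim_pp half_dim_pos by (metis card.infinite mult_eq_0_iff not_one_le_zero zero_neq_numeral)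
  moreover have "tv.span B = pp S" using B(1,3) tv.span_minimal[OF B(1) pp_subspace] by blast
  ultimately show ?thesis using that B dim_pp by simp
qed

text \<open>The tangent space of \<open>G/H\<close> has dimension \<open>2n + 1\<close> and is spanned by the image of a basis
  of \<open>\<pp>\<close> together with the Reeb vector, so these vectors are independent.\<close>

lemma induced_basis:
  assumes g: "g \<in> carrier G" and B: "finite B" "tv.independent B" "tv.span B = pp S" "card B = 2 * half_dim S"
  shows "tv.independent (induced S g ` B)" and "inj_on (induced S g) (pp S)"
proof -
  let ?I = "induced S g ` B" and ?T = "reeb S (proj S g)"
  note x = proj_point[OF g]
  have T: "?T \<in> tangent_space Q (proj S g)" "theta S (proj S g) ?T = 1"
    using reeb x unfolding reeb_field_def local_vector_field_def by blast+
  note spanI = span_induced_basis[OF g B(3)]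
  have all: "tangent_space Q (proj S g) \<subseteq> tv.span (insert ?T ?I)"
  proof
    fix v assume v: "v \<in> tangent_space Q (proj S g)"
    let ?c = "theta S (proj S g) v"
    have "theta S (proj S g) (tscale 1 v + tscale (- ?c) ?T) = 0"
      using theta_linear[OF x v T(1), of 1 "- ?c"] T(2) by simp
    moreover have "tscale 1 v + tscale (- ?c) ?T \<in> tangent_space Q (proj S g)"
      by (intro tv.subspace_add tv.subspace_scale tangent_subspace charted_Q v T)
    ultimately have "tscale 1 v + tscale (- ?c) ?T \<in> tv.span ?I"
      unfolding spanI cdist_def contact_dist_def by simp
    then have 1: "tscale 1 v + tscale (- ?c) ?T \<in> tv.span (insert ?T ?I)"
      using tv.span_mono[of ?I "insert ?T ?I"] by blast
    have 2: "tscale ?c ?T \<in> tv.span (insert ?T ?I)"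
      by (intro tv.span_scale tv.span_base) simp
    have "v = (tscale 1 v + tscale (- ?c) ?T) + tscale ?c ?T"
      by (simp add: fun_eq_iff tscale_def)
    then show "v \<in> tv.span (insert ?T ?I)" using tv.span_add[OF 1 2] by simp
  qed
  obtain D where D: "finite D" "D \<subseteq> tangent_space Q (proj S g)" "tv.independent D" "card D = DIM('f)"
    using tangent_space_independent_basis[OF manifold_Q x] .
  \<comment> \<open>A finite set with this span also spans the tangent space, so it has at least as
    many elements as the independent set \<open>D\<close>.\<close>
  have low: "2 * half_dim S + 1 \<le> card E" if "finite E" "tv.span E = tv.span (insert ?T ?I)" for E
    using tv.independent_span_bound[OF that(1) D(3)] D(2,4) dim_Q all that(2) by auto
  have fI: "finite ?I" using B(1) by simp
  have cI: "card ?I \<le> 2 * half_dim S" using card_image_le[OF B(1)] B(4) by metis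
  show ind: "tv.independent ?I"
  proof (rule ccontr)
    assume "\<not> tv.independent ?I"
    then obtain a where a: "a \<in> ?I" "a \<in> tv.span (?I - {a})" unfolding tv.dependent_def by blast
    \<comment> \<open>A dependent vector could be dropped, leaving at most
      \<open>2 * half_dim S\<close> spanning vectors against the bound \<open>low\<close>.\<close>
    have "a \<in> tv.span (insert ?T (?I - {a}))"
      using a(2) tv.span_mono[of "?I - {a}" "insert ?T (?I - {a})"] by blast
    then have "tv.span (insert a (insert ?T (?I - {a}))) = tv.span (insert ?T (?I - {a}))"
      by (rule tv.span_redundant)
    moreover have "insert a (insert ?T (?I - {a})) = insert ?T ?I" using a(1) by blast
    ultimately have "2 * half_dim S + 1 \<le> card (insert ?T (?I - {a}))"
      using fI by (intro low) auto
    also have "\<dots> \<le> Suc (card (?I - {a}))" by (rule card_insert_le_m1) simp_all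
    also have "\<dots> = card ?I" by (rule card_Suc_Diff1[OF fI a(1)])
    finally show False using cI by simp
  qed
  \<comment> \<open>The same bound excludes that two vectors of \<open>B\<close> have the same
    image, which independence of the image set alone would allow.\<close>
  have "2 * half_dim S + 1 \<le> Suc (card ?I)"
    using low[of "insert ?T ?I"] fI card_insert_if[OF fI, of ?T] by (auto split: if_splits)
  then have "inj_on (induced S g) B"
    using cI B(4) by (intro eq_card_imp_inj_on[OF B(1)]) simp
  then show "inj_on (induced S g) (pp S)"
    using tvp.linear_inj_on_span_independent_image[OF induced_linear ind] B(3) by simp
qed

lemma induced_inj: "g \<in> carrier G \<Longrightarrow> inj_on (induced S g) (pp S)"
  by (rule pp_basis, rule induced_basis(2))

subsection \<open>The flow of the Reeb field\<close>

abbreviation rate where "rate \<equiv> - 1 / (2 * real (half_dim S))"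

text \<open>The choice of the coset representative does not matter, by
  \<open>proj_mult_exp_cong\<close>.\<close>

definition reeb_flow where
  "reeb_flow t x = proj S ((SOME g. g \<in> carrier G \<and> x = proj S g) \<cdot> exp_xi S (rate * t))"

lemma reeb_flow_proj:
  assumes g: "g \<in> carrier G"
  shows "reeb_flow t (proj S g) = proj S (g \<cdot> exp_xi S (rate * t))"
proof -
  let ?r = "SOME g'. g' \<in> carrier G \<and> proj S g = proj S g'"
  have "?r \<in> carrier G \<and> proj S g = proj S ?r" by (rule someI[of _ g]) (use g in simp)
  then have "?r \<in> carrier G" "proj S ?r = proj S g" by simp_all
  then show ?thesis
    unfolding reeb_flow_def by (rule proj_mult_exp_cong[OF g])
qed

lemma reeb_flow_add:
  assumes "x \<in> points Q"
  shows "reeb_flow (s + t) x = reeb_flow s (reeb_flow t x)"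
proof -
  obtain g where g: "g \<in> carrier G" "x = proj S g" using point_proj[OF assms] .
  have "exp_xi S (rate * (s + t)) = exp_xi S (rate * t) \<cdot> exp_xi S (rate * s)"
    by (simp only: distrib_left add.commute flip: exp_xi_add)
  then show ?thesis using g by (simp add: reeb_flow_proj m_assoc)
qed

text \<open>Smoothness is local: over the domain of a section the chosen representative may be
  replaced by the smooth \<open>\<sigma>\<close>. The velocity is computed on the group and
  projected.\<close>

lemma is_flow_reeb_flow: "is_flow Q (reeb S) reeb_flow"
  unfolding is_flow_def
proof (intro conjI ballI allI)
  have cR: "charted (prod_mfd (euclid :: (real, real) mfd) Q)" by (rule charted_prod[OF charted_euclid charted_Q])
  show "smooth_map (prod_mfd euclid Q) Q (\<lambda>(t, x). reeb_flow t x)"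
  proof (rule smooth_map_local[OF cR charted_Q])
    fix z assume "z \<in> points (prod_mfd (euclid :: (real, real) mfd) Q)"
    then have sz: "snd z \<in> points Q" by auto
    obtain W \<sigma> where W: "openin (mtop Q) W" "snd z \<in> W" and \<sigma>: "smooth_map (restrict_mfd Q W) (mfd G) \<sigma>"
      and sec: "\<And>y. y \<in> W \<Longrightarrow> proj S (\<sigma> y) = y"
      using local_section[OF sz] by blast
    note cW = charted_restrict[OF charted_Q W(1)]
    note cRW = charted_prod[OF charted_euclid cW]
    have "smooth_map (euclid :: (real, real) mfd) euclid ((*) rate)"
      unfolding smooth_map_euclid_UNIV_iff by (rule smooth_on_bounded_linear[OF bounded_linear_mult_right open_UNIV])
    from smooth_map_compose[OF charted_euclid charted_euclid charted_G this one_param_smooth[OF exp_one_param]]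
    have "smooth_map euclid (mfd G) (\<lambda>t. exp_xi S (rate * t))" .
    from smooth_map_mult[OF cRW smooth_map_compose[OF cRW cW charted_G smooth_map_snd[OF charted_euclid cW] \<sigma>]
        smooth_map_compose[OF cRW charted_euclid charted_G smooth_map_fst[OF charted_euclid cW] this]]
    have "smooth_map (prod_mfd euclid (restrict_mfd Q W)) Q (\<lambda>z. proj S (\<sigma> (snd z) \<cdot> exp_xi S (rate * fst z)))"
      by (rule smooth_map_compose[OF cRW charted_G charted_Q _ smooth_proj])
    then have "smooth_map (prod_mfd euclid (restrict_mfd Q W)) Q (\<lambda>(t, x). reeb_flow t x)"
    proof (rule smooth_map_cong[OF cRW charted_Q])
      fix y assume "y \<in> points (prod_mfd (euclid :: (real, real) mfd) (restrict_mfd Q W))"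
      then have y: "snd y \<in> W" using W(1) by (auto simp: points_restrict)
      then have "\<sigma> (snd y) \<in> carrier G"
        using smooth_map_points[OF \<sigma>] W(1) by (simp add: points_restrict points_G)
      from reeb_flow_proj[OF this, of "fst y"]
      show "proj S (\<sigma> (snd y) \<cdot> exp_xi S (rate * fst y)) = (case y of (t, x) \<Rightarrow> reeb_flow t x)"
        by (simp add: sec[OF y] split_beta)
    qed
    then have "smooth_map (restrict_mfd (prod_mfd euclid Q) (UNIV \<times> W)) Q (\<lambda>(t, x). reeb_flow t x)"
      by (simp add: restrict_prod_Times)
    moreover have "openin (mtop (prod_mfd (euclid :: (real, real) mfd) Q)) (UNIV \<times> W)"
      using W(1) by (simp add: openin_prod_Times_iff)
    ultimately show "\<exists>W. openin (mtop (prod_mfd (euclid :: (real, real) mfd) Q)) W \<and> z \<in> W \<and>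
        smooth_map (restrict_mfd (prod_mfd euclid Q) W) Q (\<lambda>(t, x). reeb_flow t x)"
      using W(2) by (intro exI[of _ "UNIV \<times> W"]) (auto simp: mem_Times_iff)
  qed
  fix x assume x: "x \<in> points Q"
  then obtain g where g: "g \<in> carrier G" "x = proj S g" using point_proj by blast
  show "reeb_flow 0 x = x" using g by (simp add: reeb_flow_proj exp_xi_zero)
  show "velocity Q (\<lambda>s. reeb_flow s x) t = reeb S (reeb_flow t x)" for t
  proof
    fix f
    show "velocity Q (\<lambda>s. reeb_flow s x) t f = reeb S (reeb_flow t x) f"
    proof (cases "f \<in> C_inf Q")
      case True
      let ?e = "exp_xi S (rate * t)"
      have d: "((\<lambda>s. f (proj S (g \<cdot> exp_xi S s))) has_real_derivative
          left_deriv (xi S) (\<lambda>h. f (proj S h)) (g \<cdot> ?e)) (at (rate * t))"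
        by (rule one_param_DERIV[OF exp_one_param C_inf_proj[OF True] g(1)])
      have "((\<lambda>s. f (proj S (g \<cdot> exp_xi S (rate * s)))) has_real_derivative
          left_deriv (xi S) (\<lambda>h. f (proj S h)) (g \<cdot> ?e) * rate) (at t)"
        by (rule DERIV_chain2[where f = "\<lambda>s. f (proj S (g \<cdot> exp_xi S s))" and g = "\<lambda>s. rate * s", OF d DERIV_cmult_Id])
      then have "((\<lambda>s. f (reeb_flow s x)) has_real_derivative
          left_deriv (xi S) (\<lambda>h. f (proj S h)) (g \<cdot> ?e) * rate) (at t)"
        using g(2) reeb_flow_proj[OF g(1)] by simp
      then have "velocity Q (\<lambda>s. reeb_flow s x) t f = left_deriv (xi S) (\<lambda>h. f (proj S h)) (g \<cdot> ?e) * rate"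
        using True by (simp add: velocity_def DERIV_imp_deriv)
      also have "\<dots> = reeb S (reeb_flow t x) f"
        using g by (simp add: reeb_flow_proj reeb_induced induced_scale tscale_def induced_eq[OF True] left_deriv_def)
      finally show ?thesis .
    next
      case False
      then show ?thesis
        using g by (simp add: velocity_def reeb_flow_proj reeb_induced induced_not_smooth)
    qed
  qed
qed

lemma is_flow_flow: "is_flow Q (reeb S) (flow Q (reeb S))"
  unfolding flow_def by (rule someI[of _ reeb_flow]) (rule is_flow_reeb_flow)

text \<open>\<open>reeb_flow\<close> is additive in time, so \<open>is_flow_unique\<close>
  identifies the chosen flow with it.\<close>

lemma flow_proj:
  assumes g: "g \<in> carrier G"
  shows "flow Q (reeb S) t (proj S g) = proj S (g \<cdot> exp_xi S (rate * t))"
  using is_flow_unique[OF manifold_Q is_flow_flow is_flow_reeb_flow proj_point[OF g] reeb_flow_add]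
    reeb_flow_proj[OF g] by simp

text \<open>With e the translating element, g h e = (g e) (e^-1 h e): moving e past h costs a
  conjugation by its inverse.\<close>

lemma push_flow_induced:
  assumes g: "g \<in> carrier G" and X: "X \<in> lie_algebra G"
  shows "push Q (flow Q (reeb S) t) (induced S g X) =
    induced S (g \<cdot> exp_xi S (rate * t)) (Ad G (exp_xi S (- (rate * t))) X)"
proof
  fix f
  let ?e = "exp_xi S (rate * t)"
  show "push Q (flow Q (reeb S) t) (induced S g X) f = induced S (g \<cdot> ?e) (Ad G (exp_xi S (- (rate * t))) X) f"
  proof (cases "f \<in> C_inf Q")
    case True
    have ge: "g \<cdot> ?e \<in> carrier G" using g by simp
    have c: "(\<lambda>x. f (flow Q (reeb S) t x)) \<in> C_inf Q"
      by (rule C_inf_compose[OF charted_Q charted_Q is_flow_smooth(2)[OF charted_Q is_flow_flow] True])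
    have c': "(\<lambda>h. f (proj S (g \<cdot> ?e \<cdot> h))) \<in> C_inf (mfd G)"
      using C_inf_left_mult[OF ge C_inf_proj[OF True]] .
    have "push Q (flow Q (reeb S) t) (induced S g X) f = X (\<lambda>h. f (flow Q (reeb S) t (proj S (g \<cdot> h))))"
      unfolding push_apply[OF True] by (rule induced_eq[OF c])
    also have "\<dots> = X (\<lambda>h. f (proj S (g \<cdot> ?e \<cdot>
        (exp_xi S (- (rate * t)) \<cdot> h \<cdot> inv\<^bsub>G\<^esub> exp_xi S (- (rate * t))))))"
    proof (rule lie_algebra_cong[OF X])
      fix h assume h: "h \<in> carrier G"
      have "g \<cdot> ?e \<cdot> (inv\<^bsub>G\<^esub> ?e \<cdot> h \<cdot> ?e) = g \<cdot> (?e \<cdot> inv\<^bsub>G\<^esub> ?e) \<cdot> h \<cdot> ?e"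
        using g h by (simp only: m_assoc m_closed inv_closed exp_xi_carrier)
      then show "f (flow Q (reeb S) t (proj S (g \<cdot> h))) = f (proj S (g \<cdot> ?e \<cdot>
          (exp_xi S (- (rate * t)) \<cdot> h \<cdot> inv\<^bsub>G\<^esub> exp_xi S (- (rate * t)))))"
        using g h flow_proj[of "g \<cdot> h" t] by (simp add: exp_xi_minus)
    qed
    also have "\<dots> = induced S (g \<cdot> ?e) (Ad G (exp_xi S (- (rate * t))) X) f"
      unfolding induced_eq[OF True] Ad_eq[OF c'] ..
    finally show ?thesis .
  qed (simp add: induced_not_smooth push_not_smooth)
qed

end

section \<open>Complex tangent vectors and forms\<close>

text \<open>Real and imaginary parts as a pair: \<open>push\<close>, \<open>Ad\<close> and
  \<open>cx_map\<close> act on each part separately, so facts about real vectors carry over.\<close>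

definition cvec :: "('x \<Rightarrow> real) \<Rightarrow> ('x \<Rightarrow> real) \<Rightarrow> 'x \<Rightarrow> complex" where
  "cvec Y Z = (\<lambda>f. Complex (Y f) (Z f))"

lemma cx_space_cvec: "cx_space V = {cvec Y Z | Y Z. Y \<in> V \<and> Z \<in> V}"
  by (simp add: cx_space_def cvec_def)

lemma cvec_in_cx_space: "Y \<in> V \<Longrightarrow> Z \<in> V \<Longrightarrow> cvec Y Z \<in> cx_space V"
  unfolding cx_space_cvec by blast

lemma cx_spaceE:
  assumes "W \<in> cx_space V" obtains Y Z where "Y \<in> V" "Z \<in> V" "W = cvec Y Z"
  using assms unfolding cx_space_cvec by blast

lemma cvec_eq_iff: "cvec Y Z = cvec Y' Z' \<longleftrightarrow> Y = Y' \<and> Z = Z'"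
  by (auto simp: cvec_def fun_eq_iff)

lemma push_cvec: "push N F (cvec Y Z) = cvec (push N F Y) (push N F Z)"
  by (auto simp: push_def cvec_def fun_eq_iff complex_eq_iff)

lemma cx_map_cvec: "cx_map A (cvec Y Z) = cvec (A Y) (A Z)"
  by (simp add: cx_map_def cvec_def)

lemma cx_vec_cvec: "cx_vec Y = cvec Y 0"
  by (simp add: cx_vec_def cvec_def fun_eq_iff complex_eq_iff)

lemma cvec_lincomb:
  "(\<lambda>f. a * cvec Y Z f + b * cvec Y' Z' f) =
    cvec (tscale (Re a) Y + tscale (- Im a) Z + (tscale (Re b) Y' + tscale (- Im b) Z'))
      (tscale (Re a) Z + tscale (Im a) Y + (tscale (Re b) Z' + tscale (Im b) Y'))"
  by (simp add: cvec_def tscale_def fun_eq_iff complex_eq_iff)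

lemma cx_space_lincomb:
  assumes V: "tv.subspace V" and v: "v \<in> cx_space V" and w: "w \<in> cx_space V"
  shows "(\<lambda>f. a * v f + b * w f) \<in> cx_space V"
proof -
  obtain Y Z where 1: "Y \<in> V" "Z \<in> V" "v = cvec Y Z" using cx_spaceE[OF v] .
  obtain Y' Z' where 2: "Y' \<in> V" "Z' \<in> V" "w = cvec Y' Z'" using cx_spaceE[OF w] .
  show ?thesis
    unfolding 1(3) 2(3) cvec_lincomb
    by (intro cvec_in_cx_space tv.subspace_add[OF V] tv.subspace_scale[OF V] 1 2)
qed

section \<open>Forms of type (p,q) under linear maps\<close>

lemma wedge_map:
  assumes "length vs = k"
  shows "wedge k l (map A vs) = wedge k (\<lambda>i v. l i (A v)) vs"
  unfolding wedge_def
proof (rule sum.cong[OF refl])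
  fix \<sigma> assume "\<sigma> \<in> {\<sigma>. \<sigma> permutes {..<k}}"
  then have "i < k \<Longrightarrow> \<sigma> i < k" for i using permutes_in_image[of \<sigma> "{..<k}" i] by simp
  then show "of_int (sign \<sigma>) * (\<Prod>i<k. l i (map A vs ! \<sigma> i)) = of_int (sign \<sigma>) * (\<Prod>i<k. l i (A (vs ! \<sigma> i)))"
    using assms by simp
qed

text \<open>The factor \<open>c i\<close> belongs to the covector and not to the argument, so
  permuting the arguments leaves the product of the factors unchanged.\<close>

lemma wedge_scale:
  assumes "length vs = k" and "\<And>i v. i < k \<Longrightarrow> v \<in> set vs \<Longrightarrow> l' i v = c i * l i v"
  shows "wedge k l' vs = (\<Prod>i<k. c i) * wedge k l vs"
  unfolding wedge_def sum_distrib_left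
proof (rule sum.cong[OF refl])
  fix \<sigma> assume "\<sigma> \<in> {\<sigma>. \<sigma> permutes {..<k}}"
  then have "i < k \<Longrightarrow> \<sigma> i < k" for i using permutes_in_image[of \<sigma> "{..<k}" i] by simp
  then have "(\<Prod>i<k. l' i (vs ! \<sigma> i)) = (\<Prod>i<k. c i * l i (vs ! \<sigma> i))"
    using assms by (intro prod.cong) auto
  then show "of_int (sign \<sigma>) * (\<Prod>i<k. l' i (vs ! \<sigma> i)) =
      (\<Prod>i<k. c i) * (of_int (sign \<sigma>) * (\<Prod>i<k. l i (vs ! \<sigma> i)))"
    by (simp add: prod.distrib)
qed

lemma pq_formsE:
  assumes "\<omega> \<in> pq_forms V J p q"
  obtains r :: nat and l and a :: "nat \<Rightarrow> complex" where "\<forall>j<r. \<forall>i<p. l j i \<in> dual10 V J"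
    "\<forall>j<r. \<forall>i\<in>{p..<p + q}. l j i \<in> dual01 V J"
    "\<omega> = (\<lambda>vs. if length vs = p + q \<and> set vs \<subseteq> cx_space V
                then \<Sum>j<r. a j * wedge (p + q) (l j) vs else 0)"
proof -
  obtain r :: nat and a :: "nat \<Rightarrow> complex" and l where
    "(\<forall>j<r. (\<forall>i<p. l j i \<in> dual10 V J) \<and> (\<forall>i\<in>{p..<p + q}. l j i \<in> dual01 V J)) \<and>
     \<omega> = (\<lambda>vs. if length vs = p + q \<and> set vs \<subseteq> cx_space V
                then \<Sum>j<r. a j * wedge (p + q) (l j) vs else 0)"
    using assms unfolding pq_forms_def by blast
  then show ?thesis by (intro that[of r l a]) simp_all
qed

lemma pq_formsI:
  fixes r :: nat and a :: "nat \<Rightarrow> complex"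
  assumes "\<And>j i. j < r \<Longrightarrow> i < p \<Longrightarrow> l j i \<in> dual10 V J"
    "\<And>j i. j < r \<Longrightarrow> i \<in> {p..<p + q} \<Longrightarrow> l j i \<in> dual01 V J"
    "\<omega> = (\<lambda>vs. if length vs = p + q \<and> set vs \<subseteq> cx_space V
                then \<Sum>j<r. a j * wedge (p + q) (l j) vs else 0)"
  shows "\<omega> \<in> pq_forms V J p q"
  unfolding pq_forms_def using assms by (intro CollectI exI[of _ r] exI[of _ a] exI[of _ l]) blast

lemma pq_forms_zero:
  assumes "\<omega> \<in> pq_forms V J p q" "\<not> set vs \<subseteq> cx_space V"
  shows "\<omega> vs = 0"
  using pq_formsE[OF assms(1)] assms(2) by metis

text \<open>A covector of type (1,0) is one that kills the (0,1) vectors. Its pullback keeps this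
  type because \<open>A\<close> preserves (0,1) vectors, and the other type is handled with the
  roles exchanged.\<close>

lemma pq_forms_pullback:
  assumes \<omega>: "\<omega> \<in> pq_forms V J p q"
    and A: "\<And>v. v \<in> cx_space V' \<Longrightarrow> A v \<in> cx_space V"
    and lin: "\<And>v w a b. v \<in> cx_space V' \<Longrightarrow> w \<in> cx_space V' \<Longrightarrow> A (\<lambda>f. a * v f + b * w f) = (\<lambda>f. a * A v f + b * A w f)"
    and A10: "\<And>v. v \<in> space10 V' J' \<Longrightarrow> A v \<in> space10 V J"
    and A01: "\<And>v. v \<in> space01 V' J' \<Longrightarrow> A v \<in> space01 V J"
  shows "(\<lambda>vs. if set vs \<subseteq> cx_space V' then \<omega> (map A vs) else 0) \<in> pq_forms V' J' p q"
proof -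
  obtain r :: nat and l and a :: "nat \<Rightarrow> complex" where l: "\<forall>j<r. \<forall>i<p. l j i \<in> dual10 V J"
    "\<forall>j<r. \<forall>i\<in>{p..<p + q}. l j i \<in> dual01 V J"
    and eq: "\<omega> = (\<lambda>vs. if length vs = p + q \<and> set vs \<subseteq> cx_space V
                then \<Sum>j<r. a j * wedge (p + q) (l j) vs else 0)"
    using pq_formsE[OF \<omega>] .
  note l = l(1)[rule_format] l(2)[rule_format]
  have cl: "clinear_form_on (cx_space V') (\<lambda>v. m (A v))" if "clinear_form_on (cx_space V) m" for m
    using that A lin unfolding clinear_form_on_def by simp
  show ?thesis
  proof (rule pq_formsI[where r = r and a = a and l = "\<lambda>j i v. l j i (A v)"])
    show "(\<lambda>v. l j i (A v)) \<in> dual10 V' J'" if "j < r" "i < p" for i j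
      using l(1)[OF that] cl A01 unfolding dual10_def by blast
    show "(\<lambda>v. l j i (A v)) \<in> dual01 V' J'" if "j < r" "i \<in> {p..<p + q}" for i j
      using l(2)[OF that] cl A10 unfolding dual01_def by blast
    show "(\<lambda>vs. if set vs \<subseteq> cx_space V' then \<omega> (map A vs) else 0) =
      (\<lambda>vs. if length vs = p + q \<and> set vs \<subseteq> cx_space V'
         then \<Sum>j<r. a j * wedge (p + q) (\<lambda>i v. l j i (A v)) vs else 0)"
    proof
      fix vs
      have "set (map A vs) \<subseteq> cx_space V" if "set vs \<subseteq> cx_space V'" using that A by auto
      then show "(if set vs \<subseteq> cx_space V' then \<omega> (map A vs) else 0) =
        (if length vs = p + q \<and> set vs \<subseteq> cx_space V'
           then \<Sum>j<r. a j * wedge (p + q) (\<lambda>i v. l j i (A v)) vs else 0)"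
        unfolding eq by (auto simp: wedge_map)
    qed
  qed
qed

context cr_space
begin

section \<open>The complexified isomorphism from p to the contact distribution\<close>

definition cx_induced :: "'g \<Rightarrow> 'g ctvec \<Rightarrow> 'g set ctvec" where
  "cx_induced g W = push Q (proj S) (left_push G g W)"

lemma cx_induced_cvec: "cx_induced g (cvec Y Z) = cvec (induced S g Y) (induced S g Z)"
  by (simp add: cx_induced_def induced_def left_push_def push_cvec)

lemma Ad_cvec: "Ad G k (cvec Y Z) = cvec (Ad G k Y) (Ad G k Z)"
  by (simp add: Ad_def push_cvec)

lemma cx_induced_lincomb: "cx_induced g (\<lambda>f. a * v f + b * w f) = (\<lambda>f. a * cx_induced g v f + b * cx_induced g w f)"
  by (auto simp: cx_induced_def left_push_def push_def fun_eq_iff)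

lemma cx_induced_inj: "g \<in> carrier G \<Longrightarrow> inj_on (cx_induced g) (cx_space (pp S))"
  using induced_inj by (auto simp: inj_on_def cx_induced_cvec cvec_eq_iff elim!: cx_spaceE)

lemma cx_induced_image:
  assumes "g \<in> carrier G"
  shows "cx_induced g ` cx_space (pp S) = cx_space (cdist S (proj S g))"
proof
  show "cx_induced g ` cx_space (pp S) \<subseteq> cx_space (cdist S (proj S g))"
    unfolding cdist_eq[OF assms] by (auto simp: cx_induced_cvec intro!: cvec_in_cx_space elim!: cx_spaceE)
  show "cx_space (cdist S (proj S g)) \<subseteq> cx_induced g ` cx_space (pp S)"
  proof
    fix W assume "W \<in> cx_space (cdist S (proj S g))"
    then obtain Y Z where "Y \<in> pp S" "Z \<in> pp S" "W = cvec (induced S g Y) (induced S g Z)"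
      unfolding cdist_eq[OF assms] by (auto elim!: cx_spaceE)
    then show "W \<in> cx_induced g ` cx_space (pp S)"
      using cvec_in_cx_space[of Y "pp S" Z] cx_induced_cvec[of g Y Z] by (metis image_eqI)
  qed
qed

lemma cx_induced_mem: "g \<in> carrier G \<Longrightarrow> W \<in> cx_space (pp S) \<Longrightarrow> cx_induced g W \<in> cx_space (cdist S (proj S g))"
  using cx_induced_image by blast

lemma Ad_cx_pp: "k \<in> stabK S \<Longrightarrow> W \<in> cx_space (pp S) \<Longrightarrow> Ad G k W \<in> cx_space (pp S)"
  by (auto simp: Ad_cvec intro!: cvec_in_cx_space Ad_pp elim!: cx_spaceE)

lemma cx_adJ_pp: "W \<in> cx_space (pp S) \<Longrightarrow> cx_map (adJ S) W \<in> cx_space (pp S)"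
  by (auto simp: cx_map_cvec intro!: cvec_in_cx_space adJ_pp elim!: cx_spaceE)

lemma cx_induced_adJ:
  assumes "g \<in> carrier G" "W \<in> cx_space (pp S)"
  shows "cx_map (cxJ S (proj S g)) (cx_induced g W) = cx_induced g (cx_map (adJ S) W)"
  using assms cxJ_induced by (auto simp: cx_induced_cvec cx_map_cvec elim!: cx_spaceE)

lemma cx_induced_mult_H:
  assumes "g \<in> carrier G" "h \<in> subH S" "W \<in> cx_space (pp S)"
  shows "cx_induced (g \<cdot> h) W = cx_induced g (Ad G h W)"
  using assms by (auto simp: cx_induced_cvec Ad_cvec induced_mult_H pp_subset elim!: cx_spaceE)

lemma Ad_mult_cx:
  assumes "W \<in> cx_space (pp S)" "k \<in> carrier G" "l \<in> carrier G"
  shows "Ad G k (Ad G l W) = Ad G (k \<cdot> l) W"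
  using assms by (auto simp: Ad_cvec Ad_mult pp_subset elim!: cx_spaceE)

lemma Ad_one_cx: "W \<in> cx_space (pp S) \<Longrightarrow> Ad G \<one>\<^bsub>G\<^esub> W = W"
  by (auto simp: Ad_cvec Ad_one pp_subset elim!: cx_spaceE)

subsection \<open>Surjectivity of \<open>\<psi>\<close>\<close>

text \<open>The inverse of \<open>psi\<close>: arguments are carried back to p at a chosen
  representative of the coset. \<open>cx_induced_inj\<close> and \<open>cx_induced_image\<close>
  make \<open>inv_into\<close> a true inverse here.\<close>

definition descend :: "('g \<Rightarrow> 'g ctvec list \<Rightarrow> complex) \<Rightarrow> 'g set \<Rightarrow> 'g set ctvec list \<Rightarrow> complex" where
  "descend \<alpha> x = (\<lambda>vs. if x \<in> points Q \<and> set vs \<subseteq> cx_space (cdist S x) then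
     (let g = (SOME g. g \<in> carrier G \<and> x = proj S g) in
       \<alpha> g (map (inv_into (cx_space (pp S)) (cx_induced g)) vs)) else 0)"

context
  fixes p q \<alpha>
  assumes \<alpha>: "\<alpha> \<in> C_inf_H S p q"
begin

lemma alpha_pq: "g \<in> carrier G \<Longrightarrow> \<alpha> g \<in> pq_forms (pp S) (adJ S) p q"
  and alpha_outside: "g \<notin> carrier G \<Longrightarrow> \<alpha> g = (\<lambda>_. 0)"
  and alpha_smooth: "set Ys \<subseteq> cx_space (pp S) \<Longrightarrow> length Ys = p + q \<Longrightarrow> smooth_map (mfd G) euclid (\<lambda>g. \<alpha> g Ys)"
  and alpha_equivariant: "g \<in> carrier G \<Longrightarrow> h \<in> subH S \<Longrightarrow> set Ys \<subseteq> cx_space (pp S) \<Longrightarrow>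
     \<alpha> (g \<cdot> h) Ys = \<alpha> g (map (Ad G h) Ys)"
  using \<alpha> unfolding C_inf_H_def by blast+

text \<open>If the chosen representative is g h instead of g, carrying the arguments back gives Ad
  (h^-1) of them, and equivariance of \<open>\<alpha>\<close> compensates with Ad h.\<close>

lemma descend_cx_induced:
  assumes g: "g \<in> carrier G" and Ys: "set Ys \<subseteq> cx_space (pp S)"
  shows "descend \<alpha> (proj S g) (map (cx_induced g) Ys) = \<alpha> g Ys"
proof -
  define g' where "g' = (SOME g'. g' \<in> carrier G \<and> proj S g = proj S g')"
  have "g' \<in> carrier G \<and> proj S g = proj S g'"
    unfolding g'_def by (rule someI[of _ g]) (use g in simp)
  then have g': "g' \<in> carrier G" "proj S g' = proj S g" by simp_all
  obtain h where h: "h \<in> subH S" "g' = g \<cdot> h" using proj_eqD[OF g g'] .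
  note hc = H_carrier[OF h(1)]
  have ih: "inv\<^bsub>G\<^esub> h \<in> subH S" by (rule subgroup.m_inv_closed[OF subgroup_H h(1)])
  have Ad: "Ad G (inv\<^bsub>G\<^esub> h) W \<in> cx_space (pp S)" if "W \<in> cx_space (pp S)" for W
    using Ad_cx_pp[OF _ that] ih H_subset_K by blast
  have AdAd: "Ad G h (Ad G (inv\<^bsub>G\<^esub> h) W) = W" if "W \<in> cx_space (pp S)" for W
    using Ad_mult_cx[OF that hc, of "inv\<^bsub>G\<^esub> h"] Ad_one_cx[OF that] hc by simp
  have "inv_into (cx_space (pp S)) (cx_induced g') (cx_induced g W) = Ad G (inv\<^bsub>G\<^esub> h) W"
    if W: "W \<in> cx_space (pp S)" for W
    by (rule inv_into_f_eq[OF cx_induced_inj[OF g'(1)] Ad[OF W]])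
       (simp add: h(2) cx_induced_mult_H[OF g h(1) Ad[OF W]] AdAd[OF W])
  then have "map (inv_into (cx_space (pp S)) (cx_induced g')) (map (cx_induced g) Ys) = map (Ad G (inv\<^bsub>G\<^esub> h)) Ys"
    using Ys by auto
  moreover have "set (map (cx_induced g) Ys) \<subseteq> cx_space (cdist S (proj S g))"
    using cx_induced_mem[OF g] Ys by auto
  ultimately have "descend \<alpha> (proj S g) (map (cx_induced g) Ys) = \<alpha> g' (map (Ad G (inv\<^bsub>G\<^esub> h)) Ys)"
    unfolding descend_def g'_def[symmetric] Let_def using proj_point[OF g] by (simp del: map_map)
  also have "\<dots> = \<alpha> g (map (Ad G h) (map (Ad G (inv\<^bsub>G\<^esub> h)) Ys))"
    unfolding h(2) by (rule alpha_equivariant[OF g h(1)]) (use Ys Ad in auto)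
  also have "map (Ad G h) (map (Ad G (inv\<^bsub>G\<^esub> h)) Ys) = Ys"
    using Ys AdAd by (auto intro!: map_idI)
  finally show ?thesis .
qed

lemma psi_descend: "psi S (descend \<alpha>) = \<alpha>"
proof (intro ext)
  fix g Ys
  show "psi S (descend \<alpha>) g Ys = \<alpha> g Ys"
  proof (cases "g \<in> carrier G \<and> set Ys \<subseteq> cx_space (pp S)")
    case True
    have "map (push Q (proj S)) (map (left_push G g) Ys) = map (cx_induced g) Ys"
      by (simp add: cx_induced_def)
    then show ?thesis
      using True descend_cx_induced[of g Ys] by (simp add: psi_def pull_form_def del: map_map)
  next
    case False
    then have "\<alpha> g Ys = 0" using pq_forms_zero[OF alpha_pq] alpha_outside by metis
    then show ?thesis unfolding psi_def if_not_P[OF False] by simp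
  qed
qed

lemma descend_pq:
  assumes x: "x \<in> points Q"
  shows "descend \<alpha> x \<in> pq_forms (cdist S x) (cxJ S x) p q"
proof -
  define g where "g = (SOME g. g \<in> carrier G \<and> x = proj S g)"
  obtain g0 where "g0 \<in> carrier G \<and> x = proj S g0" using point_proj[OF x] by blast
  then have "g \<in> carrier G \<and> x = proj S g" unfolding g_def by (rule someI)
  then have g: "g \<in> carrier G" "x = proj S g" by simp_all
  let ?A = "inv_into (cx_space (pp S)) (cx_induced g)"
  note inj = cx_induced_inj[OF g(1)]
  have im: "cx_induced g ` cx_space (pp S) = cx_space (cdist S x)" using cx_induced_image[OF g(1)] g(2) by simp
  have A: "?A v \<in> cx_space (pp S)" "cx_induced g (?A v) = v" if "v \<in> cx_space (cdist S x)" for v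
    using that inv_into_into[of v "cx_induced g" "cx_space (pp S)"] f_inv_into_f[of v "cx_induced g" "cx_space (pp S)"]
    unfolding im by auto
  have lin: "?A (\<lambda>f. a * v f + b * w f) = (\<lambda>f. a * ?A v f + b * ?A w f)"
    if "v \<in> cx_space (cdist S x)" "w \<in> cx_space (cdist S x)" for v w a b
    by (rule inv_into_f_eq[OF inj cx_space_lincomb[OF pp_subspace A(1)[OF that(1)] A(1)[OF that(2)]]])
       (simp add: cx_induced_lincomb A(2) that)
  \<comment> \<open>\<open>cx_induced g\<close> intertwines ad xi with the complex structure, hence
    so does its inverse \<open>?A\<close>, which therefore preserves types.\<close>
  have eigen: "cx_map (adJ S) (?A v) = (\<lambda>f. c * ?A v f)"
    if v: "v \<in> cx_space (cdist S x)" "cx_map (cxJ S x) v = (\<lambda>f. c * v f)" for v c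
  proof (rule inj_onD[OF inj])
    have 1: "(\<lambda>f. c * ?A v f + 0 * ?A v f) \<in> cx_space (pp S)"
      by (rule cx_space_lincomb[OF pp_subspace A(1)[OF v(1)] A(1)[OF v(1)]])
    then show "(\<lambda>f. c * ?A v f) \<in> cx_space (pp S)" by simp
    have "cx_induced g (\<lambda>f. c * ?A v f) = (\<lambda>f. c * v f)"
      using cx_induced_lincomb[of g c "?A v" 0 "?A v"] A(2)[OF v(1)] by simp
    then show "cx_induced g (cx_map (adJ S) (?A v)) = cx_induced g (\<lambda>f. c * ?A v f)"
      using cx_induced_adJ[OF g(1) A(1)[OF v(1)]] A(2)[OF v(1)] v(2) g(2) by simp
  qed (rule cx_adJ_pp[OF A(1)[OF v(1)]])
  have "(\<lambda>vs. if set vs \<subseteq> cx_space (cdist S x) then \<alpha> g (map ?A vs) else 0) \<in> pq_forms (cdist S x) (cxJ S x) p q"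
  proof (rule pq_forms_pullback[OF alpha_pq[OF g(1)] A(1) lin])
    show "?A v \<in> space10 (pp S) (adJ S)" if "v \<in> space10 (cdist S x) (cxJ S x)" for v
      using that A(1) eigen unfolding space10_def by blast
    show "?A v \<in> space01 (pp S) (adJ S)" if "v \<in> space01 (cdist S x) (cxJ S x)" for v
      using that A(1) eigen[of v "- \<i>"] unfolding space01_def by blast
  qed
  moreover have "descend \<alpha> x = (\<lambda>vs. if set vs \<subseteq> cx_space (cdist S x) then \<alpha> g (map ?A vs) else 0)"
    unfolding descend_def g_def[symmetric] Let_def using x by simp
  ultimately show ?thesis by simp
qed

text \<open>Moving a fixed basis of p along a local section \<open>\<sigma>\<close> gives a smooth
  frame of the contact distribution. In this frame the components of the descended form are those of
  \<open>\<alpha> (\<sigma> y)\<close> on fixed vectors, hence smooth.\<close>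

lemma descend_in_A_D: "descend \<alpha> \<in> A_D S p q"
  unfolding A_D_def A_forms_def
proof (intro CollectI conjI ballI allI impI)
  show "descend \<alpha> x = (\<lambda>_. 0)" if "x \<notin> points Q" for x
    using that by (simp add: descend_def)
  fix x assume x: "x \<in> points Q"
  show "descend \<alpha> x \<in> pq_forms (cdist S x) (cxJ S x) p q" by (rule descend_pq[OF x])
  obtain W \<sigma> where W: "openin (mtop Q) W" "x \<in> W" and \<sigma>: "smooth_map (restrict_mfd Q W) (mfd G) \<sigma>"
    and sec: "\<And>y. y \<in> W \<Longrightarrow> proj S (\<sigma> y) = y"
    using local_section[OF x] by blast
  note cW = charted_restrict[OF charted_Q W(1)]
  have \<sigma>c: "\<sigma> y \<in> carrier G" if "y \<in> W" for y
    using smooth_map_points[OF \<sigma>] W(1) that by (simp add: points_restrict points_G)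
  obtain B where B: "finite B" "tv.independent B" "tv.span B = pp S" "card B = 2 * half_dim S"
    using pp_basis .
  obtain bs where bs: "set bs = B" "distinct bs" using finite_distinct_list[OF B(1)] by blast
  have Bpp: "b \<in> B \<Longrightarrow> b \<in> pp S" for b using B(3) tv.span_base by blast
  define Es where "Es = map (\<lambda>b y. induced S (\<sigma> y) b) bs"
  have "local_frame Q (cdist S) W Es"
    unfolding local_frame_def
  proof (intro conjI ballI)
    fix E assume "E \<in> set Es"
    then obtain b where b: "b \<in> pp S" "E = (\<lambda>y. induced S (\<sigma> y) b)" using bs(1) Bpp by (auto simp: Es_def)
    show "local_vector_field Q W E"
      unfolding local_vector_field_def
    proof (intro conjI ballI)
      show "E y \<in> tangent_space Q y" if "y \<in> W" for y
        using induced_tangent[OF \<sigma>c[OF that] pp_subset[OF b(1)]] sec[OF that] by (simp add: b(2))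
      fix f assume f: "f \<in> C_inf Q"
      have "(\<lambda>y. left_deriv b (\<lambda>h. f (proj S h)) (\<sigma> y)) \<in> C_inf (restrict_mfd Q W)"
        by (rule C_inf_compose[OF cW charted_G \<sigma> left_deriv_C_inf[OF pp_subset[OF b(1)] C_inf_proj[OF f]]])
      then show "(\<lambda>y. E y f) \<in> C_inf (restrict_mfd Q W)"
        by (simp add: b(2) induced_eq[OF f] left_deriv_def)
    qed
  next
    fix y assume y: "y \<in> W"
    have im: "(\<lambda>E. E y) ` set Es = induced S (\<sigma> y) ` B"
      using bs(1) by (auto simp: Es_def)
    have "inj_on (induced S (\<sigma> y)) B"
      using induced_inj[OF \<sigma>c[OF y]] Bpp by (auto simp: inj_on_def)
    then show "distinct (map (\<lambda>E. E y) Es)"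
      using bs by (simp add: Es_def distinct_map o_def)
    show "tv.independent ((\<lambda>E. E y) ` set Es)"
      unfolding im by (rule induced_basis(1)[OF \<sigma>c[OF y] B])
    show "tv.span ((\<lambda>E. E y) ` set Es) = cdist S y"
      unfolding im using span_induced_basis[OF \<sigma>c[OF y] B(3)] sec[OF y] by simp
  qed
  moreover have "smooth_map (restrict_mfd Q W) euclid (\<lambda>y. descend \<alpha> y (map (\<lambda>i. cx_vec ((Es ! i) y)) js))"
    if js: "set js \<subseteq> {..<length Es} \<and> length js = p + q" for js
  proof -
    let ?Ys = "map (\<lambda>i. cx_vec (bs ! i)) js"
    have len: "length Es = length bs" by (simp add: Es_def)
    have Ys: "set ?Ys \<subseteq> cx_space (pp S)"
      using js len bs(1) Bpp tv.subspace_0[OF pp_subspace]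
      by (auto simp: cx_vec_cvec intro!: cvec_in_cx_space)
    have "smooth_map (restrict_mfd Q W) euclid (\<lambda>y. \<alpha> (\<sigma> y) ?Ys)"
      using js by (intro smooth_map_compose[OF cW charted_G charted_euclid \<sigma> alpha_smooth[OF Ys]]) simp
    then show ?thesis
    proof (rule smooth_map_cong[OF cW charted_euclid])
      fix y assume "y \<in> points (restrict_mfd Q W)"
      then have y: "y \<in> W" using W(1) by (simp add: points_restrict)
      \<comment> \<open>The frame consists of real vectors, whose imaginary part 0 has to be carried
        to 0.\<close>
      have "induced S (\<sigma> y) 0 = 0" by (simp add: induced_def left_push_def push_def fun_eq_iff)
      then have "map (cx_induced (\<sigma> y)) ?Ys = map (\<lambda>i. cx_vec ((Es ! i) y)) js"
        using js len by (auto simp: Es_def cx_vec_cvec cx_induced_cvec)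
      then show "\<alpha> (\<sigma> y) ?Ys = descend \<alpha> y (map (\<lambda>i. cx_vec ((Es ! i) y)) js)"
        using descend_cx_induced[OF \<sigma>c[OF y] Ys] sec[OF y] by (simp del: map_map)
    qed
  qed
  ultimately show "\<exists>W Es. openin (mtop Q) W \<and> x \<in> W \<and> local_frame Q (cdist S) W Es \<and>
        (\<forall>js. set js \<subseteq> {..<length Es} \<and> length js = p + q \<longrightarrow>
           smooth_map (restrict_mfd Q W) euclid (\<lambda>y. descend \<alpha> y (map (\<lambda>i. cx_vec ((Es ! i) y)) js)))"
    using W by blast
qed

end

subsection \<open>The Lie derivative along the Reeb field\<close>

lemma cx_Ad_exp:
  assumes "W \<in> cx_space (pp S)"
  shows "Ad G (exp_xi S t) W = (\<lambda>f. of_real (cos t) * W f + of_real (sin t) * cx_map (adJ S) W f)"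
proof -
  obtain Y Z where YZ: "Y \<in> pp S" "Z \<in> pp S" "W = cvec Y Z" using cx_spaceE[OF assms] .
  show ?thesis
    unfolding YZ(3) Ad_cvec cx_map_cvec Ad_exp_pp[OF YZ(1)] Ad_exp_pp[OF YZ(2)]
    by (simp add: cvec_def fun_eq_iff complex_eq_iff)
qed

text \<open>Up to the factor 2 this is the projection of \<open>W\<close> to the eigenspace of J for
  the eigenvalue \<open>- c\<close>.\<close>

lemma cx_adJ_eigen:
  assumes W: "W \<in> cx_space (pp S)" and c: "c * c = -1"
  shows "(\<lambda>f. 1 * W f + c * cx_map (adJ S) W f) \<in> cx_space (pp S)"
    and "cx_map (adJ S) (\<lambda>f. 1 * W f + c * cx_map (adJ S) W f) = (\<lambda>f. - c * (1 * W f + c * cx_map (adJ S) W f))"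
proof -
  obtain Y Z where YZ: "Y \<in> pp S" "Z \<in> pp S" "W = cvec Y Z" using cx_spaceE[OF W] .
  show "(\<lambda>f. 1 * W f + c * cx_map (adJ S) W f) \<in> cx_space (pp S)"
    by (rule cx_space_lincomb[OF pp_subspace W cx_adJ_pp[OF W]])
  note pl = pp_subset adJ_pp YZ(1,2) tv.subspace_scale[OF lie_algebra_subspace] tv.subspace_add[OF lie_algebra_subspace]
  have "adJ S (adJ S Y) = - Y" "adJ S (adJ S Z) = - Z" using adJ_adJ YZ by auto
  then have "cx_map (adJ S) (\<lambda>f. 1 * W f + c * cx_map (adJ S) W f) = (\<lambda>f. 1 * cx_map (adJ S) W f + c * (- W f))"
    unfolding YZ(3) cx_map_cvec cvec_lincomb
    by (simp only: adJ_add adJ_scale pl) (simp add: cvec_def tscale_def fun_eq_iff complex_eq_iff)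
  also have "\<dots> = (\<lambda>f. - c * (1 * W f + c * cx_map (adJ S) W f))"
  proof
    fix f
    have "- c * (1 * W f + c * cx_map (adJ S) W f) = - (c * W f) - (c * c) * cx_map (adJ S) W f"
      by (simp add: algebra_simps)
    then show "1 * cx_map (adJ S) W f + c * (- W f) = - c * (1 * W f + c * cx_map (adJ S) W f)"
      by (simp add: c)
  qed
  finally show "cx_map (adJ S) (\<lambda>f. 1 * W f + c * cx_map (adJ S) W f) = (\<lambda>f. - c * (1 * W f + c * cx_map (adJ S) W f))" .
qed

text \<open>Vanishing on W + c J W means l (J W) = c l W, so on the rotation cos t + sin t J the
  covector acts through the scalar cos t + c sin t. The cases c = i and c = - i are the types (1,0)
  and (0,1).\<close>

lemma dual_Ad_exp:
  assumes l: "clinear_form_on (cx_space (pp S)) l" and W: "W \<in> cx_space (pp S)"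
    and c: "c * c = -1" and z: "l (\<lambda>f. 1 * W f + c * cx_map (adJ S) W f) = 0"
  shows "l (Ad G (exp_xi S t) W) = (of_real (cos t) + c * of_real (sin t)) * l W"
proof -
  have lin: "l (\<lambda>f. a * W f + b * cx_map (adJ S) W f) = a * l W + b * l (cx_map (adJ S) W)" for a b
    using l W cx_adJ_pp[OF W] unfolding clinear_form_on_def by blast
  have "l W + c * l (cx_map (adJ S) W) = 0" using z lin[of 1 c] by simp
  then have "c * l W + (c * c) * l (cx_map (adJ S) W) = 0"
    by (simp add: mult.assoc flip: distrib_left)
  then have "l (cx_map (adJ S) W) = c * l W" by (simp add: c)
  then show ?thesis
    unfolding cx_Ad_exp[OF W] lin by (simp add: algebra_simps)
qed

lemma dual10_Ad_exp:
  assumes l: "l \<in> dual10 (pp S) (adJ S)" and W: "W \<in> cx_space (pp S)"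
  shows "l (Ad G (exp_xi S t) W) = cis t * l W"
proof -
  have "(\<lambda>f. 1 * W f + \<i> * cx_map (adJ S) W f) \<in> space01 (pp S) (adJ S)"
    using cx_adJ_eigen[OF W, of \<i>] unfolding space01_def by simp
  then show ?thesis
    using dual_Ad_exp[of l W \<i> t] l W unfolding dual10_def by (simp add: cis_conv_exp flip: cos_of_real sin_of_real exp_Euler)
qed

lemma dual01_Ad_exp:
  assumes l: "l \<in> dual01 (pp S) (adJ S)" and W: "W \<in> cx_space (pp S)"
  shows "l (Ad G (exp_xi S t) W) = cis (- t) * l W"
proof -
  have "(\<lambda>f. 1 * W f + - \<i> * cx_map (adJ S) W f) \<in> space10 (pp S) (adJ S)"
    using cx_adJ_eigen[OF W, of "- \<i>"] unfolding space10_def by simp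
  moreover have "cis (- t) = of_real (cos t) + - \<i> * of_real (sin t)"
    by (simp add: complex_eq_iff)
  ultimately show ?thesis
    using dual_Ad_exp[of l W "- \<i>" t] l W unfolding dual01_def by simp
qed

lemma form_Ad_exp:
  assumes \<omega>: "\<omega> \<in> pq_forms (pp S) (adJ S) p q" and Ys: "set Ys \<subseteq> cx_space (pp S)"
  shows "\<omega> (map (Ad G (exp_xi S t)) Ys) = exp (\<i> * of_int (int p - int q) * of_real t) * \<omega> Ys"
proof -
  obtain r :: nat and l and a :: "nat \<Rightarrow> complex" where l: "\<forall>j<r. \<forall>i<p. l j i \<in> dual10 (pp S) (adJ S)"
    "\<forall>j<r. \<forall>i\<in>{p..<p + q}. l j i \<in> dual01 (pp S) (adJ S)"
    and eq: "\<omega> = (\<lambda>vs. if length vs = p + q \<and> set vs \<subseteq> cx_space (pp S)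
                then \<Sum>j<r. a j * wedge (p + q) (l j) vs else 0)"
    using pq_formsE[OF \<omega>] .
  note l = l(1)[rule_format] l(2)[rule_format]
  \<comment> \<open>The first \<open>p\<close> slots hold covectors of type (1,0), the remaining
    \<open>q\<close> those of type (0,1).\<close>
  define c where "c i = (if i < p then cis t else cis (- t))" for i
  have "(\<Prod>i<p + q. c i) = (\<Prod>i<p. c i) * (\<Prod>i\<in>{p..<p + q}. c i)"
    by (subst prod.union_disjoint[symmetric]) (auto intro: prod.cong)
  also have "\<dots> = cis t ^ p * cis (- t) ^ q" by (simp add: c_def)
  also have "\<dots> = exp (\<i> * of_int (int p - int q) * of_real t)"
    by (simp add: cis_conv_exp algebra_simps flip: exp_of_nat_mult exp_add)
  finally have C: "(\<Prod>i<p + q. c i) = exp (\<i> * of_int (int p - int q) * of_real t)" .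
  have w: "wedge (p + q) (l j) (map (Ad G (exp_xi S t)) Ys) =
      exp (\<i> * of_int (int p - int q) * of_real t) * wedge (p + q) (l j) Ys" if j: "j < r" and len: "length Ys = p + q" for j
    unfolding wedge_map[OF len] C[symmetric]
  proof (rule wedge_scale[OF len])
    fix i v assume i: "i < p + q" and v: "v \<in> set Ys"
    show "l j i (Ad G (exp_xi S t) v) = c i * l j i v"
      using dual10_Ad_exp[OF l(1)[OF j]] dual01_Ad_exp[OF l(2)[OF j]] i v Ys
      by (auto simp: c_def)
  qed
  have "set (map (Ad G (exp_xi S t)) Ys) \<subseteq> cx_space (pp S)"
    using Ys Ad_cx_pp[OF exp_in_K] by auto
  then show ?thesis
    unfolding eq using Ys w by (simp add: sum_distrib_left mult.left_commute)
qed

lemma push_flow_cx_induced: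
  assumes "g \<in> carrier G" "W \<in> cx_space (pp S)"
  shows "push Q (flow Q (reeb S) t) (cx_induced g W) =
    cx_induced (g \<cdot> exp_xi S (rate * t)) (Ad G (exp_xi S (- (rate * t))) W)"
proof -
  obtain Y Z where YZ: "Y \<in> pp S" "Z \<in> pp S" "W = cvec Y Z" using cx_spaceE[OF assms(2)] .
  show ?thesis
    unfolding YZ(3) cx_induced_cvec push_cvec Ad_cvec
    using push_flow_induced[OF assms(1)] YZ(1,2) by (simp add: pp_subset)
qed

lemma psi_eq: "g \<in> carrier G \<Longrightarrow> set Ys \<subseteq> cx_space (pp S) \<Longrightarrow> psi S \<beta> g Ys = \<beta> (proj S g) (map (cx_induced g) Ys)"
proof -
  assume "g \<in> carrier G" "set Ys \<subseteq> cx_space (pp S)"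
  moreover have "map (push Q (proj S)) (map (left_push G g) Ys) = map (cx_induced g) Ys"
    by (simp add: cx_induced_def)
  ultimately show ?thesis by (simp add: psi_def pull_form_def del: map_map)
qed

text \<open>The constant \<open>c\<close> gives hypothesis and conclusion the same shape, so the
  lemma can be applied to its own result for the second Lie derivative.\<close>

lemma psi_lie_T:
  assumes \<alpha>: "\<alpha> \<in> C_inf_H_m S p q m" and \<beta>: "psi S \<beta> = (\<lambda>g Ys. c * \<alpha> g Ys)"
  shows "psi S (lie_T S \<beta>) = (\<lambda>g Ys. c * (of_int (m + int p - int q) / of_nat (2 * half_dim S) * \<i>) * \<alpha> g Ys)"
proof (intro ext)
  fix g Ys
  have \<alpha>H: "\<alpha> \<in> C_inf_H S p q"
    and weight: "\<And>g t. g \<in> carrier G \<Longrightarrow> \<alpha> (g \<cdot> exp_xi S t) = (\<lambda>Ys. exp (- \<i> * of_int m * of_real t) * \<alpha> g Ys)"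
    using \<alpha> unfolding C_inf_H_m_def by blast+
  let ?k = "of_int (m + int p - int q) / of_nat (2 * half_dim S) * \<i>"
  show "psi S (lie_T S \<beta>) g Ys = c * ?k * \<alpha> g Ys"
  proof (cases "g \<in> carrier G \<and> set Ys \<subseteq> cx_space (pp S)")
    case True
    then have g: "g \<in> carrier G" and Ys: "set Ys \<subseteq> cx_space (pp S)" by auto
    have "pull_form Q (flow Q (reeb S) t) \<beta> (proj S g) (map (cx_induced g) Ys) = c * \<alpha> g Ys * exp (?k * of_real t)" for t
    proof -
      let ?s = "rate * t"
      let ?Zs = "map (Ad G (exp_xi S (- ?s))) Ys"
      have ge: "g \<cdot> exp_xi S ?s \<in> carrier G" using g by simp
      have Zs: "set ?Zs \<subseteq> cx_space (pp S)" using Ys Ad_cx_pp[OF exp_in_K] by auto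
      have "map (push Q (flow Q (reeb S) t)) (map (cx_induced g) Ys) = map (cx_induced (g \<cdot> exp_xi S ?s)) ?Zs"
        using push_flow_cx_induced[OF g] Ys by auto
      then have "pull_form Q (flow Q (reeb S) t) \<beta> (proj S g) (map (cx_induced g) Ys) = psi S \<beta> (g \<cdot> exp_xi S ?s) ?Zs"
        unfolding pull_form_def psi_eq[OF ge Zs] flow_proj[OF g] by (rule arg_cong)
      also have "\<dots> = c * (exp (- \<i> * of_int m * of_real ?s) * \<alpha> g ?Zs)"
        unfolding \<beta> weight[OF g] ..
      also have "\<alpha> g ?Zs = exp (\<i> * of_int (int p - int q) * of_real (- ?s)) * \<alpha> g Ys"
        by (rule form_Ad_exp[OF alpha_pq[OF \<alpha>H g] Ys])
      also have "c * (exp (- \<i> * of_int m * of_real ?s) * (exp (\<i> * of_int (int p - int q) * of_real (- ?s)) * \<alpha> g Ys)) =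
          c * \<alpha> g Ys * (exp (- \<i> * of_int m * of_real ?s) * exp (\<i> * of_int (int p - int q) * of_real (- ?s)))"
        by (simp only: mult_ac)
      \<comment> \<open>Weight and bidegree contribute with the same sign, - i m s and - i (p - q)
        s; with s = - t / 2n the exponent becomes i (m + p - q) t / 2n.\<close>
      also have "exp (- \<i> * of_int m * of_real ?s) * exp (\<i> * of_int (int p - int q) * of_real (- ?s)) = exp (?k * of_real t)"
        unfolding exp_add[symmetric]
        by (rule arg_cong[of _ _ exp]) (use half_dim_pos in \<open>simp add: field_simps\<close>)
      finally show ?thesis .
    qed
    moreover have "((\<lambda>t. c * \<alpha> g Ys * exp (?k * of_real t)) has_vector_derivative c * \<alpha> g Ys * ?k) (at 0)"
      by (rule has_vector_derivative_real_field) (use half_dim_pos in \<open>auto intro!: derivative_eq_intros\<close>)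
    ultimately have "vector_derivative (\<lambda>t. pull_form Q (flow Q (reeb S) t) \<beta> (proj S g) (map (cx_induced g) Ys)) (at 0)
        = c * \<alpha> g Ys * ?k"
      by (simp add: vector_derivative_at)
    moreover have "set (map (cx_induced g) Ys) \<subseteq> cx_space (cdist S (proj S g))"
      using cx_induced_mem[OF g] Ys by auto
    ultimately show ?thesis
      unfolding psi_eq[OF g Ys] lie_T_def lie_derivative_def using proj_point[OF g] by (simp add: mult_ac)
  next
    case False
    \<comment> \<open>Off the group, or on arguments outside p, both \<open>psi\<close> and
      \<open>\<alpha>\<close> take the default value 0.\<close>
    then have "\<alpha> g Ys = 0" using pq_forms_zero[OF alpha_pq[OF \<alpha>H]] alpha_outside[OF \<alpha>H] by metis
    then show ?thesis unfolding psi_def if_not_P[OF False] by simp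
  qed
qed

end

theorem corollary4p13:
  fixes S :: "('g, 'e::euclidean_space, 'f::euclidean_space) cr_data"
    and p q :: nat and m :: int
    and \<alpha> :: "'g \<Rightarrow> 'g ctvec list \<Rightarrow> complex"
  assumes "compact_CR_symmetric_contact_space S"
    and "\<alpha> \<in> C_inf_H_m S p q m"
  shows "tilde S p q (lie_T S) \<alpha> =
      (\<lambda>g Ys. (of_int (m + int p - int q) / of_nat (2 * half_dim S)) * \<i> * \<alpha> g Ys) \<and>
    tilde S p q (\<lambda>\<beta> x vs. - lie_T S (lie_T S \<beta>) x vs) \<alpha> =
      (\<lambda>g Ys. (of_int (m + int p - int q) / of_nat (2 * half_dim S))\<^sup>2 * \<alpha> g Ys)"
proof -
  interpret cr_space S by unfold_locales (rule assms(1))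
  let ?k = "of_int (m + int p - int q) / of_nat (2 * half_dim S) :: complex"
  define \<beta> where "\<beta> = inv_into (A_D S p q) (psi S) \<alpha>"
  have H: "\<alpha> \<in> C_inf_H S p q" using assms(2) unfolding C_inf_H_m_def by blast
  have "\<alpha> \<in> psi S ` A_D S p q"
    using psi_descend[OF H] descend_in_A_D[OF H] by (metis image_eqI)
  then have "psi S \<beta> = (\<lambda>g Ys. 1 * \<alpha> g Ys)"
    unfolding \<beta>_def by (simp add: f_inv_into_f)
  note 1 = psi_lie_T[OF assms(2) this]
  \<comment> \<open>The constant of the first application is \<open>?k * \<i>\<close>, so the second
    gives its square, - \<open>?k\<close> squared, and the sign in front makes it positive.\<close>
  note 2 = psi_lie_T[OF assms(2) 1]
  have "psi S (\<lambda>x vs. - lie_T S (lie_T S \<beta>) x vs) = (\<lambda>g Ys. - psi S (lie_T S (lie_T S \<beta>)) g Ys)"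
    by (auto simp: psi_def pull_form_def fun_eq_iff)
  also have "\<dots> = (\<lambda>g Ys. ?k\<^sup>2 * \<alpha> g Ys)"
    unfolding 2 by (simp add: power2_eq_square mult_ac)
  finally show ?thesis
    using 1 unfolding tilde_def \<beta>_def by simp
qed

end
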